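(* Let $(\Delta,\mathbf x;\boldsymbol\sigma)$ be a graded seed and let $e$ be a vertex of $\Delta$ such that $\epsilon=\boldsymbol\sigma(e)$ is real. Suppose that $e$ is frozen or that $B(\Delta)$ has full rank. Let $\mathcal A:=\overline{\mathcal C}(\Delta,\mathbf x;\boldsymbol\sigma)$ and $\mathcal S:=\overline{\mathcal C}(\Delta_e,\mathbf x_e;\boldsymbol\sigma_e)$. Then $(\mathcal A_e)_{\epsilon^\perp}\cong\mathcal S$.
   Context: $k$ is the base field. An ice quiver $\Delta$ is a finite quiver without loops or oriented 2-cycles whose vertices $1,\dots,q$ are divided into mutable ones ($1,\dots,p$) and frozen ones ($p+1,\dots,q$). Its $B$-matrix is the $p\times q$ matrix $b_{u,v}=\#\{u\to v\}-\#\{v\to u\}$; full rank means rank $p$. A seed $(\Delta,\mathbf x)$ consists of an ice quiver and a family $\mathbf x=(x_v)_{v\in\Delta_0}$ (also written $\mathbf x(v)$) of elements of a field extension of $k$, algebraically independent over $k$. Mutation at a mutable $u$ is Fomin-Zelevinsky mutation (no arrows created between frozen vertices), with $x_ux_u'=\prod_{v\to u}x_v+\prod_{u\to w}x_w$. Put $\mathcal L_{\mathbf x}=k[x_1^{\pm1},\dots,x_p^{\pm1},x_{p+1},\dots,x_q]$ (frozen variables not inverted). The upper cluster algebra is $\overline{\mathcal C}(\Delta,\mathbf x)=\bigcap\mathcal L_{\mathbf x^\dagger}$ over all seeds $(\Delta^\dagger,\mathbf x^\dagger)$ mutation-equivalent to $(\Delta,\mathbf x)$. $\mathbb L\cong\mathbb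 Z^n$ carries a unimodular (not necessarily symmetric) bilinear form $\langle-,-\rangle$. A weight configuration $\boldsymbol\sigma$ assigns $\boldsymbol\sigma(v)\in\mathbb L$ to each vertex with $\sum_{v\to u}\boldsymbol\sigma(v)=\sum_{u\to w}\boldsymbol\sigma(w)$ for each mutable $u$; setting $\deg x_v=\boldsymbol\sigma(v)$ grades the upper cluster algebra, written $\overline{\mathcal C}(\Delta,\mathbf x;\boldsymbol\sigma)$, and $(\Delta,\mathbf x;\boldsymbol\sigma)$ is a graded seed. A vector $\epsilon\in\mathbb L$ is real if $\langle\epsilon,\epsilon\rangle=1$. For an $\mathbb L$-graded algebra $A$, $A_{\epsilon^\perp}=\bigoplus_{\alpha:\langle\epsilon,\alpha\rangle=0}A_\alpha$. $\mathcal A_e$ is the localization of $\mathcal A$ at the element $\mathbf x(e)$. $\Delta_e$ is the full ice subquiver of $\Delta$ obtained by deleting $e$, and for $v\ne e$: $\mathbf x_e(v)=\mathbf x(e)^{-\langle\epsilon,\boldsymbol\sigma(v)\rangle}\mathbf x(v)$, $\boldsymbol\sigma_e(v)=\boldsymbol\sigma(v)-\langle\epsilon,\boldsymbol\sigma(v)\rangle\epsilon$. Then $(\Delta_e,\mathbf x_e;\boldsymbol\sigma_e)$ is again a graded seed. *)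

theory Defs
  imports "HOL-Analysis.Determinants" "HOL-Library.Function_Algebras"
begin

section \<open>Ice quivers\<close>

text \<open>
  A quiver is recorded by its numbers of arrows: \<open>arr Q u v\<close> is the number of arrows
  \<open>u \<rightarrow> v\<close>.  The frozen vertices are those in \<open>verts Q - mut Q\<close>.
\<close>

record 'v ice_quiver =
  verts :: "'v set"
  mut :: "'v set"
  arr :: "'v \<Rightarrow> 'v \<Rightarrow> nat"

definition ice_quiver :: "'v ice_quiver \<Rightarrow> bool" where
  "ice_quiver Q \<longleftrightarrow>
     finite (verts Q) \<and> mut Q \<subseteq> verts Q \<and>
     (\<forall>u v. arr Q u v \<noteq> 0 \<longrightarrow> u \<in> verts Q \<and> v \<in> verts Q) \<and>
     (\<forall>v. arr Q v v = 0) \<and>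
     (\<forall>u v. arr Q u v = 0 \<or> arr Q v u = 0)"

definition frozen :: "'v ice_quiver \<Rightarrow> 'v set" where
  "frozen Q = verts Q - mut Q"

definition B_entry :: "'v ice_quiver \<Rightarrow> 'v \<Rightarrow> 'v \<Rightarrow> int" where
  "B_entry Q u v = int (arr Q u v) - int (arr Q v u)"

global_interpretation rat_fun: vector_space "\<lambda>(c::rat) (f::'v \<Rightarrow> rat) v. c * f v"
  by unfold_locales (auto simp: fun_eq_iff algebra_simps)

text \<open>
  The rows of the \<open>B\<close>-matrix are indexed by mutable vertices and its columns by all vertices;
  a row is a rational function on the vertex type, zero off the vertex set.  The rank is the
  dimension over the rationals of the row space.
\<close>

definition B_row :: "'v ice_quiver \<Rightarrow> 'v \<Rightarrow> 'v \<Rightarrow> rat" where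
  "B_row Q u = (\<lambda>v. if v \<in> verts Q then of_int (B_entry Q u v) else 0)"

definition B_rank :: "'v ice_quiver \<Rightarrow> nat" where
  "B_rank Q = rat_fun.dim (B_row Q ` mut Q)"

definition B_full_rank :: "'v ice_quiver \<Rightarrow> bool" where
  "B_full_rank Q \<longleftrightarrow> B_rank Q = card (mut Q)"

text \<open>
  For \<open>v, w \<noteq> u\<close> not both frozen, adding an arrow \<open>v \<rightarrow> w\<close> for every path
  \<open>v \<rightarrow> u \<rightarrow> w\<close> and then cancelling 2-cycles leaves the truncated difference below.
\<close>

definition mutate_quiver :: "'v \<Rightarrow> 'v ice_quiver \<Rightarrow> 'v ice_quiver" where
  "mutate_quiver u Q = Q\<lparr>arr := (\<lambda>v w.
     if v = u \<or> w = u then arr Q w v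
     else if v \<notin> mut Q \<and> w \<notin> mut Q then arr Q v w
     else (arr Q v w + arr Q v u * arr Q u w) - (arr Q w v + arr Q w u * arr Q u v))\<rparr>"

definition delete_vertex :: "'v \<Rightarrow> 'v ice_quiver \<Rightarrow> 'v ice_quiver" where
  "delete_vertex e Q =
     \<lparr>verts = verts Q - {e}, mut = mut Q - {e},
      arr = (\<lambda>u v. if u = e \<or> v = e then 0 else arr Q u v)\<rparr>"

section \<open>Seeds and upper cluster algebras\<close>

text \<open>
  The field extension of the base field is a type \<open>'a\<close> of class \<open>field\<close>, and the base
  field is a subset \<open>k\<close> of it that is a subfield.
\<close>

definition is_subfield :: "'a::field set \<Rightarrow> bool" where
  "is_subfield k \<longleftrightarrow>
     0 \<in> k \<and> 1 \<in> k \<and>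
     (\<forall>a\<in>k. \<forall>b\<in>k. a + b \<in> k \<and> a * b \<in> k) \<and>
     (\<forall>a\<in>k. - a \<in> k \<and> inverse a \<in> k)"

definition k_span :: "'a::field set \<Rightarrow> 'a set \<Rightarrow> 'a set" where
  "k_span k B = {(\<Sum>b\<in>F. c b * b) | F c. finite F \<and> F \<subseteq> B \<and> c ` F \<subseteq> k}"

text \<open>A polynomial in variables indexed by \<open>V\<close> is a finite set \<open>M\<close> of exponent functions
  supported in \<open>V\<close> together with coefficients.\<close>

definition alg_independent :: "'a::field set \<Rightarrow> 'v set \<Rightarrow> ('v \<Rightarrow> 'a) \<Rightarrow> bool" where
  "alg_independent k V x \<longleftrightarrow>
     (\<forall>M c. finite M \<and> M \<subseteq> {m :: 'v \<Rightarrow> nat. \<forall>v. v \<notin> V \<longrightarrow> m v = 0} \<and> c ` M \<subseteq> k \<and>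
        (\<Sum>m\<in>M. c m * (\<Prod>v\<in>V. x v ^ m v)) = 0 \<longrightarrow> (\<forall>m\<in>M. c m = 0))"

type_synonym ('v, 'a) seed = "'v ice_quiver \<times> ('v \<Rightarrow> 'a)"

definition is_seed :: "'a::field set \<Rightarrow> ('v, 'a) seed \<Rightarrow> bool" where
  "is_seed k = (\<lambda>(Q, x). ice_quiver Q \<and> alg_independent k (verts Q) x)"

definition mutate_seed :: "'v \<Rightarrow> ('v, 'a::field) seed \<Rightarrow> ('v, 'a) seed" where
  "mutate_seed u = (\<lambda>(Q, x). (mutate_quiver u Q,
     x(u := ((\<Prod>v\<in>verts Q. x v ^ arr Q v u) + (\<Prod>w\<in>verts Q. x w ^ arr Q u w)) / x u)))"

text \<open>
  Both ends of a mutation step are required to be seeds.  This matters only in characteristic 2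
  for a mutable vertex without arrows: there the exchange relation gives
  \<open>x\<^sub>u x\<^sub>u' = 1 + 1 = 0\<close>, so the mutation does not yield a seed.
\<close>

definition mutation_step :: "'a::field set \<Rightarrow> ('v, 'a) seed \<Rightarrow> ('v, 'a) seed \<Rightarrow> bool" where
  "mutation_step k s t \<longleftrightarrow>
     is_seed k s \<and> is_seed k t \<and> (\<exists>u \<in> mut (fst s). t = mutate_seed u s)"

text \<open>Mutation is an involution, so the reflexive transitive closure is symmetric.\<close>

definition mutation_equivalent :: "'a::field set \<Rightarrow> ('v, 'a) seed \<Rightarrow> ('v, 'a) seed \<Rightarrow> bool" where
  "mutation_equivalent k = (mutation_step k)\<^sup>*\<^sup>*"

definition laurent_monom :: "'v set \<Rightarrow> ('v \<Rightarrow> 'a::field) \<Rightarrow> ('v \<Rightarrow> int) \<Rightarrow> 'a" where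
  "laurent_monom V x a = (\<Prod>v\<in>V. x v powi a v)"

definition laurent_ring :: "'a::field set \<Rightarrow> ('v, 'a) seed \<Rightarrow> 'a set" where
  "laurent_ring k = (\<lambda>(Q, x).
     k_span k {laurent_monom (verts Q) x a | a. \<forall>v\<in>frozen Q. a v \<ge> 0})"

definition upper_cluster_algebra :: "'a::field set \<Rightarrow> ('v, 'a) seed \<Rightarrow> 'a set" where
  "upper_cluster_algebra k s = (\<Inter>t \<in> {t. mutation_equivalent k s t}. laurent_ring k t)"

section \<open>Gradings\<close>

definition bilinear_form :: "(int^'n \<Rightarrow> int^'n \<Rightarrow> int) \<Rightarrow> bool" where
  "bilinear_form f \<longleftrightarrow>
     (\<forall>a b c. f (a + b) c = f a c + f b c) \<and> (\<forall>a b c. f a (b + c) = f a b + f a c)"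

definition unimodular :: "(int^'n \<Rightarrow> int^'n \<Rightarrow> int) \<Rightarrow> bool" where
  "unimodular f \<longleftrightarrow> \<bar>det (\<chi> i j. f (axis i 1) (axis j 1))\<bar> = 1"

definition real_vec :: "(int^'n \<Rightarrow> int^'n \<Rightarrow> int) \<Rightarrow> int^'n \<Rightarrow> bool" where
  "real_vec f \<epsilon> \<longleftrightarrow> f \<epsilon> \<epsilon> = 1"

definition weight_config :: "'v ice_quiver \<Rightarrow> ('v \<Rightarrow> int^'n) \<Rightarrow> bool" where
  "weight_config Q \<sigma> \<longleftrightarrow>
     (\<forall>u \<in> mut Q. (\<Sum>v\<in>verts Q. int (arr Q v u) *s \<sigma> v) = (\<Sum>w\<in>verts Q. int (arr Q u w) *s \<sigma> w))"

definition graded_seed :: "'a::field set \<Rightarrow> ('v, 'a) seed \<Rightarrow> ('v \<Rightarrow> int^'n) \<Rightarrow> bool" where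
  "graded_seed k s \<sigma> \<longleftrightarrow> is_seed k s \<and> weight_config (fst s) \<sigma>"

text \<open>
  Degree \<open>\<alpha>\<close> component, for \<open>deg x\<^sub>v = \<sigma> v\<close>, of a subalgebra \<open>A\<close> of the ring of all
  Laurent polynomials in the cluster \<open>x\<close>.  It is used for upper cluster algebras and for
  their localizations at cluster or frozen variables; frozen exponents may be negative in the latter.
\<close>

definition graded_part ::
  "'a::field set \<Rightarrow> ('v, 'a) seed \<Rightarrow> ('v \<Rightarrow> int^'n) \<Rightarrow> 'a set \<Rightarrow> int^'n \<Rightarrow> 'a set" where
  "graded_part k s \<sigma> A \<alpha> =
     A \<inter> k_span k {laurent_monom (verts (fst s)) (snd s) a | a.
                     (\<Sum>v\<in>verts (fst s). a v *s \<sigma> v) = \<alpha>}"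

text \<open>The direct sum of the graded pieces \<open>G \<alpha>\<close> with \<open>\<langle>\<epsilon>, \<alpha>\<rangle> = 0\<close>, as an internal sum.\<close>

definition perp_part ::
  "(int^'n \<Rightarrow> int^'n \<Rightarrow> int) \<Rightarrow> int^'n \<Rightarrow> (int^'n \<Rightarrow> 'a::field set) \<Rightarrow> 'a set" where
  "perp_part f \<epsilon> G =
     {(\<Sum>\<alpha>\<in>F. g \<alpha>) | F g. finite F \<and> (\<forall>\<alpha>\<in>F. f \<epsilon> \<alpha> = 0 \<and> g \<alpha> \<in> G \<alpha>)}"

text \<open>For a subring of a field and \<open>y \<noteq> 0\<close> the localization is realised inside the field.\<close>

definition localization_at :: "'a::field set \<Rightarrow> 'a \<Rightarrow> 'a set" where
  "localization_at A y = {a / y ^ n | a n. a \<in> A}"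

definition graded_algebra_iso ::
  "'a::field set \<Rightarrow> 'a set \<Rightarrow> (int^'n \<Rightarrow> 'a set) \<Rightarrow> 'a set \<Rightarrow> (int^'n \<Rightarrow> 'a set) \<Rightarrow> bool" where
  "graded_algebra_iso k A GA B GB \<longleftrightarrow>
     (\<exists>\<phi>. bij_betw \<phi> A B \<and>
          (\<forall>a\<in>A. \<forall>b\<in>A. \<phi> (a + b) = \<phi> a + \<phi> b \<and> \<phi> (a * b) = \<phi> a * \<phi> b) \<and>
          (\<forall>c\<in>k. \<phi> c = c) \<and>
          (\<forall>\<alpha>. \<phi> ` GA \<alpha> = GB \<alpha>))"

section \<open>Projection along a real vertex\<close>

definition proj_vars ::
  "(int^'n \<Rightarrow> int^'n \<Rightarrow> int) \<Rightarrow> 'v \<Rightarrow> ('v \<Rightarrow> int^'n) \<Rightarrow> ('v \<Rightarrow> 'a::field) \<Rightarrow> 'v \<Rightarrow> 'a" where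
  "proj_vars f e \<sigma> x v = x e powi (- f (\<sigma> e) (\<sigma> v)) * x v"

definition proj_weights ::
  "(int^'n \<Rightarrow> int^'n \<Rightarrow> int) \<Rightarrow> 'v \<Rightarrow> ('v \<Rightarrow> int^'n) \<Rightarrow> 'v \<Rightarrow> int^'n" where
  "proj_weights f e \<sigma> v = \<sigma> v - f (\<sigma> e) (\<sigma> v) *s \<sigma> e"

definition proj_seed ::
  "(int^'n \<Rightarrow> int^'n \<Rightarrow> int) \<Rightarrow> 'v \<Rightarrow> ('v \<Rightarrow> int^'n) \<Rightarrow> ('v, 'a::field) seed \<Rightarrow> ('v, 'a) seed" where
  "proj_seed f e \<sigma> = (\<lambda>(Q, x). (delete_vertex e Q, proj_vars f e \<sigma> x))"

end

theory Submission
  imports Defs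
begin

text \<open>
  The isomorphism is the identity of the ambient field: both algebras are the same subset.

  A Laurent monomial of degree orthogonal to \<open>\<epsilon>\<close> in the cluster \<open>x\<close> is a Laurent monomial in the projected
  cluster, and mutation at \<open>u \<noteq> e\<close> commutes with the projection; so the Laurent ring of the projected
  seed is the part orthogonal to \<open>\<epsilon>\<close> of the Laurent ring of the seed with \<open>x(e)\<close> inverted. Two clusters
  related by an exchange induce the same homogeneous components on the intersection of their Laurent
  rings, since after multiplication by a power of the (homogeneous) exchange polynomial everything
  becomes a Laurent polynomial in both. This gives one inclusion.

  For the other one, \<open>z\<close> in the projected algebra needs one power \<open>n\<close> such that \<open>x(e)\<^sup>n z\<close> lies in the Laurent
  rings of all seeds. If \<open>e\<close> is frozen, the order along \<open>x(e) = 0\<close> does not depend on the seed. If \<open>e\<close> is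
  mutable, \<open>x(e)\<^sup>n z\<close> lies for some \<open>n\<close> in the Laurent rings of the seed and of its neighbours, and full
  rank of \<open>B\<close> makes this upper bound invariant under mutation, as in the theorem of Berenstein, Fomin
  and Zelevinsky.
\<close>

section \<open>Spans of Laurent monomials\<close>

text \<open>The projected algebra sees only mutations away from \<open>e\<close>, while
  \<open>upper\<close> also tests seeds reached through \<open>e\<close>. This is the obstacle when
  \<open>e\<close> is mutable, and the reason why a criterion involving only a cluster and its
  neighbours is needed there. Divisibility is never argued through factorization: to divide by an
  exchange polynomial, an integer grading is chosen in which the lowest component of the polynomial
  can be cancelled, and the components of the quotient are recovered from the bottom up. The
  gradings come from the quiver: the exponent of one variable, or the coefficients of a nonzero 2x2
  minor of the exchange matrix. Conditions on frozen exponents are kept apart. Membership is first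
  shown with all variables inverted, then the order along each frozen variable is treated by itself.
  This works because there are no 2-cycles, so that no exchange polynomial is divisible by a frozen
  variable. Reality of \<epsilon> enters as the fact that the degree of \<open>x e\<close> pairs to
  1 with \<epsilon>: each monomial has exactly one multiple by a power of \<open>x e\<close> whose
  degree is orthogonal to \<epsilon>.\<close>

lemma k_span_zero [simp]: "0 \<in> k_span k B"
  unfolding k_span_def by (intro CollectI exI[of _ "{}"]) auto

lemma k_span_mono: "B \<subseteq> C \<Longrightarrow> k_span k B \<subseteq> k_span k C"
  unfolding k_span_def by blast

lemma k_span_induct [consumes 1, case_names zero step]:
  assumes "z \<in> k_span k B" and "P 0"
    and step: "\<And>z c b. P z \<Longrightarrow> c \<in> k \<Longrightarrow> b \<in> B \<Longrightarrow> P (c * b + z)"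
  shows "P z"
proof -
  obtain F c where F: "finite F" "F \<subseteq> B" "c ` F \<subseteq> k" and z: "z = (\<Sum>b\<in>F. c b * b)"
    using assms(1) unfolding k_span_def by blast
  from F have "P (\<Sum>b\<in>F. c b * b)"
    by (induction F rule: finite_induct) (auto intro!: step assms(2))
  then show ?thesis using z by simp
qed

locale subfield =
  fixes k :: "'a::field set"
  assumes is_subfield: "is_subfield k"
begin

lemma zero_mem: "0 \<in> k" and one_mem: "1 \<in> k"
  and add_mem: "a \<in> k \<Longrightarrow> b \<in> k \<Longrightarrow> a + b \<in> k"
  and mult_mem: "a \<in> k \<Longrightarrow> b \<in> k \<Longrightarrow> a * b \<in> k"
  and minus_mem: "a \<in> k \<Longrightarrow> - a \<in> k"
  using is_subfield unfolding is_subfield_def by simp_all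

lemma k_span_step:
  assumes "z \<in> k_span k B" "c \<in> k" "b \<in> B"
  shows "c * b + z \<in> k_span k B"
proof -
  obtain F d where F: "finite F" "F \<subseteq> B" "d ` F \<subseteq> k" and z: "z = (\<Sum>b\<in>F. d b * b)"
    using assms(1) unfolding k_span_def by blast
  define d' where "d' i = (if i = b then c else 0) + (if i \<in> F then d i else 0)" for i
  have "(\<Sum>i\<in>insert b F. d' i * i)
      = (\<Sum>i\<in>insert b F. (if i = b then c else 0) * i) + (\<Sum>i\<in>insert b F. (if i \<in> F then d i else 0) * i)"
    by (simp add: d'_def distrib_right sum.distrib)
  also have "(\<Sum>i\<in>insert b F. (if i = b then c else 0) * i) = c * b"
    using F(1) by (simp add: if_distrib[of "\<lambda>t. t * _"] sum.delta cong: if_cong)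
  also have "(\<Sum>i\<in>insert b F. (if i \<in> F then d i else 0) * i) = z"
    unfolding z using F(1) by (intro sum.mono_neutral_cong_right) auto
  finally have eq: "c * b + z = (\<Sum>i\<in>insert b F. d' i * i)" by simp
  have "d' ` insert b F \<subseteq> k"
    using F(3) assms(2) zero_mem by (auto simp: d'_def intro!: add_mem)
  then show ?thesis
    unfolding k_span_def using F assms(3) eq
    by (intro CollectI exI[of _ "insert b F"] exI[of _ d']) auto
qed

lemma k_span_base: "b \<in> B \<Longrightarrow> b \<in> k_span k B"
  using k_span_step[OF k_span_zero one_mem] by simp

lemma k_span_add:
  assumes "z \<in> k_span k B" "w \<in> k_span k B"
  shows "z + w \<in> k_span k B"
  using assms(1)
proof (induction rule: k_span_induct)
  case (step z c b)
  then show ?case using k_span_step[of "z + w" B c b] by (simp add: add.assoc)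
qed (use assms(2) in simp)

lemma k_span_scale:
  assumes "z \<in> k_span k B" "c \<in> k"
  shows "c * z \<in> k_span k B"
  using assms(1)
proof (induction rule: k_span_induct)
  case (step z d b)
  then show ?case
    using k_span_step[of "c * z" B "c * d" b] mult_mem[OF assms(2)] by (simp add: algebra_simps)
qed simp

lemma k_span_minus: "z \<in> k_span k B \<Longrightarrow> - z \<in> k_span k B"
  using k_span_scale[of z B "- 1"] minus_mem[OF one_mem] by simp

lemma k_span_diff: "z \<in> k_span k B \<Longrightarrow> w \<in> k_span k B \<Longrightarrow> z - w \<in> k_span k B"
  using k_span_add[of z B "- w"] k_span_minus[of w B] by simp

lemma k_span_sum: "(\<And>i. i \<in> I \<Longrightarrow> g i \<in> k_span k B) \<Longrightarrow> (\<Sum>i\<in>I. g i) \<in> k_span k B"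
  by (induction I rule: infinite_finite_induct) (auto intro: k_span_add)

lemma k_span_mult:
  assumes "z \<in> k_span k A" "w \<in> k_span k B"
    and AB: "\<And>a b. a \<in> A \<Longrightarrow> b \<in> B \<Longrightarrow> a * b \<in> k_span k C"
  shows "z * w \<in> k_span k C"
  using assms(1)
proof (induction rule: k_span_induct)
  case (step z c a)
  from assms(2) have "a * w \<in> k_span k C"
  proof (induction rule: k_span_induct)
    case (step v d b)
    have "d * (a * b) + a * v \<in> k_span k C"
      by (rule k_span_add[OF k_span_scale[OF AB[OF \<open>a \<in> A\<close> \<open>b \<in> B\<close>] \<open>d \<in> k\<close>] step.IH])
    then show ?case by (simp add: algebra_simps)
  qed simp
  then have "c * (a * w) + z * w \<in> k_span k C"
    by (rule k_span_add[OF k_span_scale[OF _ \<open>c \<in> k\<close>] step.IH])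
  then show ?case by (simp add: algebra_simps)
qed simp

end

text \<open>Values off \<open>V\<close> do not affect a monomial; fixing them to 0 makes the
  exponent vector of a monomial unique.\<close>

definition exps_on :: "'v set \<Rightarrow> ('v \<Rightarrow> int) set" where
  "exps_on V = {a. \<forall>v. v \<notin> V \<longrightarrow> a v = 0}"

text \<open>The intersection with \<open>exps_on V\<close> is built in, so that \<open>A\<close> can
  be any condition on exponents, such as \<open>UNIV\<close> or nonnegativity at one vertex.\<close>

definition lspan :: "'a::field set \<Rightarrow> 'v set \<Rightarrow> ('v \<Rightarrow> 'a) \<Rightarrow> ('v \<Rightarrow> int) set \<Rightarrow> 'a set" where
  "lspan k V x A = k_span k (laurent_monom V x ` (A \<inter> exps_on V))"

definition laurent_independent :: "'a::field set \<Rightarrow> 'v set \<Rightarrow> ('v \<Rightarrow> 'a) \<Rightarrow> bool" where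
  "laurent_independent k V x \<longleftrightarrow>
     (\<forall>F c. finite F \<and> F \<subseteq> exps_on V \<and> c ` F \<subseteq> k \<and> (\<Sum>a\<in>F. c a * laurent_monom V x a) = 0
        \<longrightarrow> (\<forall>a\<in>F. c a = 0))"

lemma laurent_monom_cong:
  "(\<And>v. v \<in> V \<Longrightarrow> a v = b v) \<Longrightarrow> (\<And>v. v \<in> V \<Longrightarrow> b v \<noteq> 0 \<Longrightarrow> x v = y v) \<Longrightarrow>
    laurent_monom V x a = laurent_monom V y b"
  unfolding laurent_monom_def by (rule prod.cong[OF refl]) (metis power_int_0_right)

lemma laurent_monom_zero [simp]: "laurent_monom V x (\<lambda>v. 0) = 1"
  by (simp add: laurent_monom_def)

lemma laurent_monom_nonzero:
  "finite V \<Longrightarrow> (\<And>v. v \<in> V \<Longrightarrow> x v \<noteq> 0) \<Longrightarrow> laurent_monom V x a \<noteq> 0"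
  by (simp add: laurent_monom_def power_int_eq_0_iff)

lemma laurent_monom_add:
  "(\<And>v. v \<in> V \<Longrightarrow> x v \<noteq> 0) \<Longrightarrow>
    laurent_monom V x (\<lambda>v. a v + b v) = laurent_monom V x a * laurent_monom V x b"
  unfolding laurent_monom_def prod.distrib[symmetric] by (intro prod.cong) (auto simp: power_int_add)

lemma laurent_monom_scale:
  "laurent_monom V x (\<lambda>v. int n * a v) = laurent_monom V x a ^ n"
  unfolding laurent_monom_def prod_power_distrib
  by (intro prod.cong) (auto simp: power_int_mult mult.commute[of "int n"])

lemma laurent_monom_nat: "laurent_monom V x (\<lambda>v. int (m v)) = (\<Prod>v\<in>V. x v ^ m v)"
  by (simp add: laurent_monom_def)

lemma laurent_monom_single:
  "finite V \<Longrightarrow> u \<in> V \<Longrightarrow> laurent_monom V x (\<lambda>v. if v = u then n else 0) = x u powi n"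
  unfolding laurent_monom_def
  by (subst prod.cong[OF refl, of _ _ "\<lambda>v. if v = u then x u powi n else 1"]) auto

lemma restrict_exps:
  "(\<lambda>v. if v \<in> V then a v else 0) \<in> exps_on V"
  "laurent_monom V x (\<lambda>v. if v \<in> V then a v else 0) = laurent_monom V x a"
  by (auto simp: exps_on_def intro: laurent_monom_cong)

lemma lspan_mono: "A \<inter> exps_on V \<subseteq> B \<Longrightarrow> lspan k V x A \<subseteq> lspan k V x B"
  unfolding lspan_def by (intro k_span_mono image_mono) auto

lemma laurent_independentD:
  "laurent_independent k V x \<Longrightarrow> finite F \<Longrightarrow> F \<subseteq> exps_on V \<Longrightarrow> (\<And>a. a \<in> F \<Longrightarrow> c a \<in> k) \<Longrightarrow>
    (\<Sum>a\<in>F. c a * laurent_monom V x a) = 0 \<Longrightarrow> a \<in> F \<Longrightarrow> c a = 0"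
  unfolding laurent_independent_def by blast

locale cluster_vars = subfield k for k :: "'a::field set" +
  fixes V :: "'v set" and x :: "'v \<Rightarrow> 'a"
  assumes finite_V: "finite V" and indep: "laurent_independent k V x"
begin

lemma var_nonzero: "v \<in> V \<Longrightarrow> x v \<noteq> 0"
proof
  assume v: "v \<in> V" "x v = 0"
  let ?a = "\<lambda>w. if w = v then 1 else (0::int)"
  have "(\<Sum>a\<in>{?a}. 1 * laurent_monom V x a) = 0"
    using v laurent_monom_single[OF finite_V v(1), of x 1] by simp
  moreover have "?a \<in> exps_on V" using v by (auto simp: exps_on_def)
  ultimately have "(1::'a) = 0"
    using laurent_independentD[OF indep, of "{?a}" "\<lambda>_. 1" ?a] one_mem by simp
  then show False by simp
qed

abbreviation "mon \<equiv> laurent_monom V x"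
abbreviation "sp \<equiv> lspan k V x"

lemma mono_nonzero: "mon a \<noteq> 0"
  by (rule laurent_monom_nonzero[OF finite_V var_nonzero])

lemma mono_add: "mon (\<lambda>v. a v + b v) = mon a * mon b"
  by (rule laurent_monom_add[OF var_nonzero])

lemma mono_minus: "mon (\<lambda>v. - a v) = inverse (mon a)"
  unfolding laurent_monom_def by (simp add: power_int_minus prod_inversef[symmetric] comp_def)

lemma span_zero [simp]: "0 \<in> sp A"
  and span_add: "z \<in> sp A \<Longrightarrow> w \<in> sp A \<Longrightarrow> z + w \<in> sp A"
  and span_diff: "z \<in> sp A \<Longrightarrow> w \<in> sp A \<Longrightarrow> z - w \<in> sp A"
  and span_minus: "z \<in> sp A \<Longrightarrow> - z \<in> sp A"
  and span_sum: "(\<And>i. i \<in> I \<Longrightarrow> g i \<in> sp A) \<Longrightarrow> sum g I \<in> sp A"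
  unfolding lspan_def by (auto intro: k_span_add k_span_diff k_span_minus k_span_sum)

lemma span_mono_mem: "a \<in> A \<Longrightarrow> a \<in> exps_on V \<Longrightarrow> mon a \<in> sp A"
  unfolding lspan_def by (intro k_span_base) auto

lemma span_mono_mem': "(\<lambda>v. if v \<in> V then a v else 0) \<in> A \<Longrightarrow> mon a \<in> sp A"
  using span_mono_mem[OF _ restrict_exps(1)] restrict_exps(2) by metis

lemma one_mem_span: "(\<lambda>v. 0) \<in> A \<Longrightarrow> 1 \<in> sp A"
  using span_mono_mem[of "\<lambda>v. 0" A] by (simp add: exps_on_def)

lemma span_induct [consumes 1, case_names zero step]:
  assumes "z \<in> sp A" and "P 0"
    and "\<And>z c a. P z \<Longrightarrow> c \<in> k \<Longrightarrow> a \<in> A \<Longrightarrow> a \<in> exps_on V \<Longrightarrow> P (c * mon a + z)"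
  shows "P z"
  using assms unfolding lspan_def by (induction rule: k_span_induct) auto

lemma span_step:
  "z \<in> sp A \<Longrightarrow> c \<in> k \<Longrightarrow> a \<in> A \<Longrightarrow> a \<in> exps_on V \<Longrightarrow> c * mon a + z \<in> sp A"
  unfolding lspan_def by (intro k_span_step) auto

lemma span_scale: "z \<in> sp A \<Longrightarrow> c \<in> k \<Longrightarrow> c * z \<in> sp A"
  unfolding lspan_def by (rule k_span_scale)

lemma span_mult:
  assumes "z \<in> sp A" "w \<in> sp B"
    and "\<And>a b. a \<in> A \<Longrightarrow> b \<in> B \<Longrightarrow> a \<in> exps_on V \<Longrightarrow> b \<in> exps_on V \<Longrightarrow> (\<lambda>v. a v + b v) \<in> C"
  shows "z * w \<in> sp C"
  using assms(1,2) unfolding lspan_def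
proof (rule k_span_mult)
  fix a b assume "a \<in> mon ` (A \<inter> exps_on V)" "b \<in> mon ` (B \<inter> exps_on V)"
  then obtain a' b' where ab: "a = mon a'" "b = mon b'" "a' \<in> A" "b' \<in> B"
      "a' \<in> exps_on V" "b' \<in> exps_on V" by auto
  then have "(\<lambda>v. a' v + b' v) \<in> C \<inter> exps_on V" using assms(3) by (auto simp: exps_on_def)
  then show "a * b \<in> k_span k (mon ` (C \<inter> exps_on V))"
    unfolding ab mono_add[symmetric] by (intro k_span_base) auto
qed

lemma span_split:
  assumes "z \<in> sp A"
  obtains z1 z2 where "z = z1 + z2" "z1 \<in> sp (A \<inter> D)" "z2 \<in> sp (A - D)"
proof -
  from assms have "\<exists>z1 z2. z = z1 + z2 \<and> z1 \<in> sp (A \<inter> D) \<and> z2 \<in> sp (A - D)"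
  proof (induction rule: span_induct)
    case zero
    then show ?case by (intro exI[of _ 0]) simp
  next
    case (step z c a)
    then obtain z1 z2 where z: "z = z1 + z2" "z1 \<in> sp (A \<inter> D)" "z2 \<in> sp (A - D)" by blast
    show ?case
    proof (cases "a \<in> D")
      case True
      then show ?thesis using z step span_step[OF z(2), of c a]
        by (intro exI[of _ "c * mon a + z1"] exI[of _ z2]) (auto simp: add.assoc)
    next
      case False
      then show ?thesis using z step span_step[OF z(3), of c a]
        by (intro exI[of _ z1] exI[of _ "c * mon a + z2"]) (auto simp: add_ac)
    qed
  qed
  then show thesis using that by blast
qed

text \<open>The coefficients are a total function vanishing off the support, so that two expansions
  can be compared over the union of their supports.\<close>

lemma span_coeffs:
  assumes "z \<in> sp A"
  obtains F c where "finite F" "F \<subseteq> A \<inter> exps_on V" "range c \<subseteq> k" "\<And>a. a \<notin> F \<Longrightarrow> c a = 0"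
    "z = (\<Sum>a\<in>F. c a * mon a)"
proof -
  from assms have "\<exists>F c. finite F \<and> F \<subseteq> A \<inter> exps_on V \<and> range c \<subseteq> k \<and> (\<forall>a. a \<notin> F \<longrightarrow> c a = 0) \<and>
    z = (\<Sum>a\<in>F. c a * mon a)"
  proof (induction rule: span_induct)
    case zero
    then show ?case using zero_mem by (intro exI[of _ "{}"] exI[of _ "\<lambda>_. 0"]) auto
  next
    case (step z d b)
    then obtain F c where F: "finite F" "F \<subseteq> A \<inter> exps_on V" "range c \<subseteq> k" "\<forall>a. a \<notin> F \<longrightarrow> c a = 0"
      "z = (\<Sum>a\<in>F. c a * mon a)" by auto
    let ?c = "c(b := d + c b)"
    have "(\<Sum>a\<in>insert b F. ?c a * mon a) = ?c b * mon b + (\<Sum>a\<in>F - {b}. ?c a * mon a)"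
      using F(1) by (simp add: sum.insert_remove)
    also have "(\<Sum>a\<in>F - {b}. ?c a * mon a) = (\<Sum>a\<in>F - {b}. c a * mon a)"
      by (intro sum.cong) auto
    also have "?c b * mon b + \<dots> = d * mon b + (\<Sum>a\<in>insert b F. c a * mon a)"
      using F(1) by (simp add: sum.insert_remove algebra_simps)
    also have "(\<Sum>a\<in>insert b F. c a * mon a) = z"
      unfolding F(5) using F(1,4) by (intro sum.mono_neutral_right) auto
    finally show ?case
      using F step by (intro exI[of _ "insert b F"] exI[of _ ?c]) (auto intro!: add_mem)
  qed
  then show thesis using that by auto
qed

text \<open>Coefficients are unique by independence, so both expansions live on the common support.
  Every later argument that intersects conditions on supports rests on this.\<close>

lemma span_Int:
  assumes "z \<in> sp A" "z \<in> sp B"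
  shows "z \<in> sp (A \<inter> B)"
proof -
  obtain F c where F: "finite F" "F \<subseteq> A \<inter> exps_on V" "range c \<subseteq> k" "\<And>a. a \<notin> F \<Longrightarrow> c a = 0"
    "z = (\<Sum>a\<in>F. c a * mon a)" using span_coeffs[OF assms(1)] by metis
  obtain G d where G: "finite G" "G \<subseteq> B \<inter> exps_on V" "range d \<subseteq> k" "\<And>a. a \<notin> G \<Longrightarrow> d a = 0"
    "z = (\<Sum>a\<in>G. d a * mon a)" using span_coeffs[OF assms(2)] by metis
  have zF: "z = (\<Sum>a\<in>F \<union> G. c a * mon a)"
    unfolding F(5) using F(1,4) G(1) by (intro sum.mono_neutral_left) auto
  have zG: "z = (\<Sum>a\<in>F \<union> G. d a * mon a)"
    unfolding G(5) using F(1) G(1,4) by (intro sum.mono_neutral_left) auto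
  have "(\<Sum>a\<in>F \<union> G. (c a + - d a) * mon a) = z - z"
    unfolding distrib_right sum.distrib zF[symmetric] using zG by (simp add: sum_negf)
  moreover have "c a + - d a \<in> k" for a
    using F(3) G(3) by (intro add_mem minus_mem) auto
  ultimately have cd: "c a = d a" if "a \<in> F \<union> G" for a
    using laurent_independentD[OF indep, of "F \<union> G" "\<lambda>a. c a + - d a" a] F(1,2) G(1,2) that by auto
  have z: "z = (\<Sum>a\<in>F \<inter> G. c a * mon a)"
    unfolding zF
  proof (rule sum.mono_neutral_right)
    show "\<forall>i\<in>F \<union> G - F \<inter> G. c i * mon i = 0"
    proof
      fix i assume "i \<in> F \<union> G - F \<inter> G"
      then have "c i = 0" using F(4)[of i] G(4)[of i] cd[of i] by auto
      then show "c i * mon i = 0" by simp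
    qed
  qed (use F(1) G(1) in auto)
  have "c a * mon a \<in> sp (A \<inter> B)" if "a \<in> F \<inter> G" for a
    using that F(2,3) G(2) span_mono_mem[of a "A \<inter> B"] span_scale[of "mon a" "A \<inter> B" "c a"] by auto
  then show ?thesis by (subst z) (rule span_sum)
qed

lemma span_empty: "z \<in> sp {} \<Longrightarrow> z = 0"
  by (induction rule: span_induct) auto

lemma span_disjoint: "z \<in> sp A \<Longrightarrow> z \<in> sp B \<Longrightarrow> A \<inter> B = {} \<Longrightarrow> z = 0"
  using span_Int span_empty by metis

lemma span_split_unique:
  assumes "z1 + z2 = w1 + w2" "z1 \<in> sp A" "w1 \<in> sp A" "z2 \<in> sp B" "w2 \<in> sp B" "A \<inter> B = {}"
  shows "z1 = w1"
proof -
  have "z1 - w1 = w2 - z2" using assms(1) by (simp add: algebra_simps)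
  then have "z1 - w1 = 0"
    using span_disjoint[of "z1 - w1" A B] span_diff assms by metis
  then show ?thesis by simp
qed

lemma span_summand:
  assumes "z1 + z2 \<in> sp A" "z1 \<in> sp D" "z2 \<in> sp (- D)"
  shows "z1 \<in> sp (A \<inter> D)"
proof -
  obtain w1 w2 where w: "z1 + z2 = w1 + w2" "w1 \<in> sp (A \<inter> D)" "w2 \<in> sp (A - D)"
    using span_split[OF assms(1)] by metis
  moreover have "w1 \<in> sp D" "w2 \<in> sp (- D)"
    using w lspan_mono[of "A \<inter> D" V D] lspan_mono[of "A - D" V "- D"] by blast+
  ultimately have "z1 = w1" using assms span_split_unique[of z1 z2 w1 w2 D "- D"] by simp
  then show ?thesis using w by simp
qed

lemma span_grading:
  assumes "z \<in> sp A"
  obtains D g where "finite D" "z = sum g D" "\<And>d. g d \<in> sp (A \<inter> {a. deg a = d})"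
proof -
  from assms have "\<exists>D g. finite D \<and> z = sum g D \<and> (\<forall>d. g d \<in> sp (A \<inter> {a. deg a = d}))"
  proof (induction rule: span_induct)
    case zero
    show ?case by (intro exI[of _ "{}"] exI[of _ "\<lambda>_. 0"]) simp
  next
    case (step z c a)
    then obtain D g where D: "finite D" "z = sum g D" "\<forall>d. g d \<in> sp (A \<inter> {a. deg a = d})" by blast
    define h where "h d = (if d \<in> D then g d else 0)" for d
    have z: "z = sum h (insert (deg a) D)"
      unfolding D(2) h_def using D(1) by (intro sum.mono_neutral_cong_left) auto
    have "c * mon a + z = sum (h(deg a := c * mon a + h (deg a))) (insert (deg a) D)"
      using D(1) unfolding z by (simp add: sum.insert_remove add.assoc)
    moreover have "(h(deg a := c * mon a + h (deg a))) d \<in> sp (A \<inter> {a. deg a = d})" for d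
      using D(3) step by (auto simp: h_def intro!: span_step span_scale span_mono_mem)
    ultimately show ?case using D(1) by blast
  qed
  then show thesis using that by metis
qed

lemma span_sum_eq_0:
  assumes "finite D" "sum g D = 0" "\<And>d. d \<in> D \<Longrightarrow> g d \<in> sp {a. deg a = d}" "d \<in> D"
  shows "g d = 0"
proof -
  have "sum g D = g d + sum g (D - {d})"
    using assms(1,4) by (simp add: sum.remove)
  moreover have "sum g (D - {d}) \<in> sp {a. deg a \<noteq> d}"
  proof (intro span_sum)
    fix i assume "i \<in> D - {d}"
    then show "g i \<in> sp {a. deg a \<noteq> d}"
      using assms(3)[of i] lspan_mono[of "{a. deg a = i}" V "{a. deg a \<noteq> d}"] by auto
  qed
  ultimately show ?thesis
    using span_split_unique[of "g d" "sum g (D - {d})" 0 0 "{a. deg a = d}" "{a. deg a \<noteq> d}"] assms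
    by auto
qed

end

section \<open>Independence of monomials with natural and with integer exponents\<close>

lemma alg_independentD:
  "alg_independent k V x \<Longrightarrow> finite M \<Longrightarrow> (\<And>m v. m \<in> M \<Longrightarrow> v \<notin> V \<Longrightarrow> m v = 0) \<Longrightarrow> (\<And>m. m \<in> M \<Longrightarrow> c m \<in> k) \<Longrightarrow>
    (\<Sum>m\<in>M. c m * (\<Prod>v\<in>V. x v ^ m v)) = 0 \<Longrightarrow> m \<in> M \<Longrightarrow> c m = 0"
  unfolding alg_independent_def by blast

lemma (in subfield) laurent_independent_iff:
  fixes x :: "'v \<Rightarrow> 'a"
  assumes V: "finite V"
  shows "alg_independent k V x \<longleftrightarrow> laurent_independent k V x"
proof
  assume alg: "alg_independent k V x"
  have nz: "x v \<noteq> 0" if "v \<in> V" for v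
  proof
    assume "x v = 0"
    let ?m = "\<lambda>w. if w = v then 1 else (0::nat)"
    have "(\<Sum>m\<in>{?m}. 1 * (\<Prod>v\<in>V. x v ^ m v)) = 0"
      using \<open>x v = 0\<close> that V by (simp add: prod_zero_iff)
    then have "(1::'a) = 0"
      using that one_mem by (intro alg_independentD[OF alg, of "{?m}" "\<lambda>_. 1" ?m]) auto
    then show False by simp
  qed
  show "laurent_independent k V x"
    unfolding laurent_independent_def
  proof (intro allI impI)
    fix F c assume *: "finite F \<and> F \<subseteq> exps_on V \<and> c ` F \<subseteq> k \<and> (\<Sum>a\<in>F. c a * laurent_monom V x a) = 0"
    \<comment> \<open>A crude bound for all negative parts of all exponents at once: multiplying the
      relation by the monomial with every exponent \<open>N\<close> turns it into a polynomial
      relation.\<close>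
    define N where "N = (\<Sum>a\<in>F. \<Sum>v\<in>V. nat (- a v))"
    have N: "a v + int N \<ge> 0" if "a \<in> F" "v \<in> V" for a v
    proof -
      have "nat (- a v) \<le> (\<Sum>v\<in>V. nat (- a v))" using V that by (intro member_le_sum) auto
      also have "\<dots> \<le> N" unfolding N_def using * that by (intro member_le_sum) auto
      finally show ?thesis by simp
    qed
    define h where "h a = (\<lambda>v. if v \<in> V then nat (a v + int N) else 0)" for a :: "'v \<Rightarrow> int"
    have hv: "int (h a v) = a v + int N" if "a \<in> F" "v \<in> V" for a v
      using N[OF that] that by (simp add: h_def)
    have inj: "inj_on h F"
    proof
      fix a b assume ab: "a \<in> F" "b \<in> F" "h a = h b"
      show "a = b"
      proof
        fix v
        have "a v = 0 \<and> b v = 0" if "v \<notin> V" using * ab(1,2) that unfolding exps_on_def by blast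
        then show "a v = b v"
          using hv[OF ab(1), of v] hv[OF ab(2), of v] ab(3) by (cases "v \<in> V") auto
      qed
    qed
    have "(\<Sum>m\<in>h ` F. c (inv_into F h m) * (\<Prod>v\<in>V. x v ^ m v))
        = (\<Sum>a\<in>F. c a * laurent_monom V x (\<lambda>v. int (h a v)))"
      using inj by (simp add: sum.reindex laurent_monom_nat)
    also have "\<dots> = (\<Sum>a\<in>F. c a * (laurent_monom V x a * laurent_monom V x (\<lambda>v. int N)))"
    proof (intro sum.cong refl)
      fix a assume "a \<in> F"
      then have "laurent_monom V x (\<lambda>v. int (h a v)) = laurent_monom V x (\<lambda>v. a v + int N)"
        using hv by (intro laurent_monom_cong) auto
      also have "\<dots> = laurent_monom V x a * laurent_monom V x (\<lambda>v. int N)"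
        using nz by (rule laurent_monom_add)
      finally show "c a * laurent_monom V x (\<lambda>v. int (h a v)) = c a * (laurent_monom V x a * laurent_monom V x (\<lambda>v. int N))"
        by simp
    qed
    also have "\<dots> = (\<Sum>a\<in>F. c a * laurent_monom V x a) * laurent_monom V x (\<lambda>v. int N)"
      by (simp add: sum_distrib_right mult.assoc)
    finally have "(\<Sum>m\<in>h ` F. c (inv_into F h m) * (\<Prod>v\<in>V. x v ^ m v)) = 0" using * by simp
    moreover have "h a v = 0" if "v \<notin> V" for a v using that by (simp add: h_def)
    ultimately have "\<forall>m\<in>h ` F. c (inv_into F h m) = 0"
      using * inj by (intro ballI alg_independentD[OF alg, of "h ` F" "\<lambda>m. c (inv_into F h m)"]) auto
    then show "\<forall>a\<in>F. c a = 0" using inj by auto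
  qed
next
  assume lin: "laurent_independent k V x"
  show "alg_independent k V x"
    unfolding alg_independent_def
  proof (intro allI impI)
    fix M :: "('v \<Rightarrow> nat) set" and c
    assume *: "finite M \<and> M \<subseteq> {m. \<forall>v. v \<notin> V \<longrightarrow> m v = 0} \<and> c ` M \<subseteq> k \<and>
      (\<Sum>m\<in>M. c m * (\<Prod>v\<in>V. x v ^ m v)) = 0"
    define h where "h m = (\<lambda>v. int (m v))" for m :: "'v \<Rightarrow> nat"
    have inj: "inj_on h M" by (auto simp: inj_on_def fun_eq_iff h_def)
    have "laurent_monom V x (h m) = (\<Prod>v\<in>V. x v ^ m v)" for m
      by (simp add: h_def laurent_monom_nat)
    then have "(\<Sum>a\<in>h ` M. c (inv_into M h a) * laurent_monom V x a) = 0"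
      using * inj by (simp add: sum.reindex)
    moreover have "h ` M \<subseteq> exps_on V" using * by (auto simp: exps_on_def h_def)
    ultimately have "\<forall>a\<in>h ` M. c (inv_into M h a) = 0"
      using * inj by (intro ballI laurent_independentD[OF lin, of "h ` M" "\<lambda>a. c (inv_into M h a)"]) auto
    then show "\<forall>m\<in>M. c m = 0" using inj by auto
  qed
qed

section \<open>Exchanging one variable\<close>

text \<open>
  The exponents, in the cluster with \<open>x\<^sub>u\<close> exchanged, of the monomials of \<open>P\<^sup>n x\<^sup>a\<close>, where
  \<open>P = x\<^sup>p + x\<^sup>q = x\<^sub>u y\<^sub>u\<close> and \<open>i + j = n + a\<^sub>u\<close>.
\<close>

definition exch_exp :: "'v \<Rightarrow> ('v \<Rightarrow> int) \<Rightarrow> ('v \<Rightarrow> int) \<Rightarrow> ('v \<Rightarrow> int) \<Rightarrow> nat \<Rightarrow> nat \<Rightarrow> 'v \<Rightarrow> int" where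
  "exch_exp u p q a i j = (\<lambda>v. (if v = u then - a v else a v) + (int i * p v + int j * q v))"

lemma lspan_subset:
  "z \<in> lspan k V x A \<Longrightarrow> (\<And>a. a \<in> A \<Longrightarrow> a \<in> exps_on V \<Longrightarrow> a \<in> B) \<Longrightarrow> z \<in> lspan k V x B"
  using lspan_mono[of A V B k x] by blast

text \<open>As \<open>p\<close> and \<open>q\<close> vanish at \<open>u\<close>, the polynomial
  \<open>P\<close> does not involve the exchanged variable and is the same expression in both
  clusters. This makes the situation symmetric in \<open>x\<close> and \<open>y\<close>.\<close>

locale exchange = cluster_vars k V x for k :: "'a::field set" and V :: "'v set" and x +
  fixes y :: "'v \<Rightarrow> 'a" and u :: 'v and p q :: "'v \<Rightarrow> int" and P :: 'a
  assumes u_in: "u \<in> V" and p_on: "p \<in> exps_on V" and q_on: "q \<in> exps_on V"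
    and p_u: "p u = 0" and q_u: "q u = 0"
    and P_def: "P = laurent_monom V x p + laurent_monom V x q" and P_nonzero: "P \<noteq> 0"
    and y_def: "y = x(u := P / x u)"
begin

lemma mono_y_eq: "a u = 0 \<Longrightarrow> laurent_monom V y a = mon a"
  unfolding y_def by (intro laurent_monom_cong) auto

lemma P_y: "P = laurent_monom V y p + laurent_monom V y q"
  using mono_y_eq p_u q_u P_def by simp

lemma x_eq: "x = y(u := P / y u)"
  using u_in var_nonzero P_nonzero by (auto simp: y_def)

lemma y_nonzero: "v \<in> V \<Longrightarrow> y v \<noteq> 0"
  using P_nonzero var_nonzero by (auto simp: y_def)

definition rest :: "('v \<Rightarrow> int) \<Rightarrow> 'v \<Rightarrow> int" where "rest a = a(u := 0)"

lemma mono_split_u: "mon a = x u powi a u * mon (rest a)"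
proof -
  have "mon a = mon (\<lambda>v. (if v = u then a u else 0) + rest a v)"
    by (intro laurent_monom_cong) (auto simp: rest_def)
  then show ?thesis
    unfolding mono_add by (simp add: laurent_monom_single[OF finite_V u_in])
qed

text \<open>Substituting \<open>x u = P / y u\<close> produces the factor \<open>P\<close> to the
  power \<open>a u\<close>. Distributing it over both sides leaves natural powers of
  \<open>P\<close> only, ready for the binomial expansion.\<close>

lemma mono_exchange:
  assumes "int m = int n + a u"
  shows "P ^ n * mon a = P ^ m * laurent_monom V y (\<lambda>v. if v = u then - a v else a v)"
proof -
  have "laurent_monom V y (\<lambda>v. if v = u then - a v else a v)
      = laurent_monom V y (\<lambda>v. (if v = u then - a u else 0) + rest a v)"
    by (intro laurent_monom_cong) (auto simp: rest_def)
  also have "\<dots> = y u powi (- a u) * mon (rest a)"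
  proof -
    have "rest a u = 0" by (simp add: rest_def)
    then show ?thesis
      by (simp add: laurent_monom_add y_nonzero laurent_monom_single[OF finite_V u_in] mono_y_eq)
  qed
  also have "y u powi (- a u) = P powi (- a u) * x u powi a u"
    unfolding y_def by (simp add: power_int_divide_distrib power_int_minus field_simps)
  finally have "P ^ m * laurent_monom V y (\<lambda>v. if v = u then - a v else a v)
      = (P powi (int m) * P powi (- a u)) * mon a"
    by (simp add: mono_split_u[of a])
  also have "P powi (int m) * P powi (- a u) = P powi (int n)"
    using P_nonzero assms by (simp flip: power_int_add)
  finally show ?thesis by simp
qed

lemma P_power_expand:
  "P ^ m = (\<Sum>i\<le>m. of_nat (m choose i) * laurent_monom V y (\<lambda>v. int i * p v + int (m - i) * q v))"
  unfolding P_y binomial_ring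
  by (intro sum.cong refl)
    (simp add: laurent_monom_add y_nonzero laurent_monom_scale mult.assoc del: of_nat_diff)

end

lemma (in subfield) of_nat_mem: "of_nat n \<in> k"
  by (induction n) (auto intro: add_mem zero_mem one_mem)

context exchange
begin

lemma P_power_mult_mono:
  assumes "int m = int n + a u" "a \<in> exps_on V"
  shows "P ^ n * mon a \<in> lspan k V y {exch_exp u p q a i j | i j. i + j = m}"
proof -
  let ?b = "\<lambda>v. if v = u then - a v else a v"
  have "P ^ n * mon a = P ^ m * laurent_monom V y ?b"
    using assms(1) by (rule mono_exchange)
  also have "\<dots> = (\<Sum>i\<le>m. of_nat (m choose i) * laurent_monom V y (exch_exp u p q a i (m - i)))"
    unfolding P_power_expand[of m] sum_distrib_right exch_exp_def
    by (intro sum.cong refl) (simp add: laurent_monom_add y_nonzero mult_ac del: of_nat_diff)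
  also have "\<dots> \<in> lspan k V y {exch_exp u p q a i j | i j. i + j = m}"
    unfolding lspan_def
  proof (intro k_span_sum k_span_scale k_span_base imageI of_nat_mem)
    fix i assume "i \<in> {..m}"
    then have "i + (m - i) = m" by simp
    moreover have "exch_exp u p q a i (m - i) \<in> exps_on V"
      using assms(2) p_on q_on u_in by (auto simp: exps_on_def exch_exp_def)
    ultimately show "exch_exp u p q a i (m - i) \<in> {exch_exp u p q a i j | i j. i + j = m} \<inter> exps_on V"
      by blast
  qed
  finally show ?thesis .
qed

text \<open>Asserted for all large \<open>n\<close> and not for a single one, so that finitely many
  terms, or several elements, can share one exponent.\<close>

lemma span_exchange:
  assumes "z \<in> sp A"
  shows "\<exists>N. \<forall>n\<ge>N. P ^ n * z \<in> lspan k V y {exch_exp u p q a i j | a i j. a \<in> A \<and> int i + int j = int n + a u}"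
    (is "\<exists>N. \<forall>n\<ge>N. _ \<in> lspan k V y (?B n)")
  using assms
proof (induction rule: span_induct)
  case zero
  then show ?case by (simp add: lspan_def)
next
  case (step z c a)
  then obtain N where N: "\<And>n. n \<ge> N \<Longrightarrow> P ^ n * z \<in> lspan k V y (?B n)" by blast
  have "P ^ n * (c * mon a + z) \<in> lspan k V y (?B n)" if n: "n \<ge> max N (nat (- a u))" for n
  proof -
    define m where "m = nat (int n + a u)"
    have m: "int m = int n + a u" using n unfolding m_def by linarith
    have "{exch_exp u p q a i j | i j. i + j = m} \<subseteq> ?B n"
    proof -
      have "int i + int j = int n + a u" if "i + j = m" for i j using that m by simp
      then show ?thesis using step(3) by blast
    qed
    then have "P ^ n * mon a \<in> lspan k V y (?B n)"
      using lspan_subset[OF P_power_mult_mono[OF m step(4)]] by blast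
    then have "c * (P ^ n * mon a) + P ^ n * z \<in> lspan k V y (?B n)"
      using k_span_add[OF k_span_scale[OF _ step(2)]] N[of n] n unfolding lspan_def by simp
    then show ?thesis by (simp add: algebra_simps)
  qed
  then show ?case by blast
qed

text \<open>A nonnegative power of \<open>x u = P / y u\<close> is already Laurent in the other
  cluster, so no multiplication by \<open>P\<close> is required.\<close>

lemma span_exchange_nonneg:
  assumes "z \<in> sp A" "\<And>a. a \<in> A \<Longrightarrow> a u \<ge> 0"
  shows "z \<in> lspan k V y {exch_exp u p q a i j | a i j. a \<in> A \<and> int i + int j = a u}"
  using assms(1)
proof (induction rule: span_induct)
  case zero
  then show ?case by (simp add: lspan_def)
next
  case (step z c a)
  let ?B = "{exch_exp u p q a i j | a i j. a \<in> A \<and> int i + int j = a u}"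
  define m where "m = nat (a u)"
  have m: "int m = int 0 + a u" using assms(2)[OF step(3)] by (simp add: m_def)
  have "int i + int j = a u" if "i + j = m" for i j using that m by simp
  then have "{exch_exp u p q a i j | i j. i + j = m} \<subseteq> ?B" using step(3) by blast
  then have "mon a \<in> lspan k V y ?B"
    using lspan_subset[OF P_power_mult_mono[OF m step(4)], of ?B] by auto
  then show ?case
    using step(1,2) unfolding lspan_def by (intro k_span_add k_span_scale) auto
qed

text \<open>Multiply a relation in \<open>y\<close> by a power of \<open>P\<close> and rewrite it in
  \<open>x\<close>. Since \<open>P\<close> is free of the variable at \<open>u\<close>, terms with
  different \<open>a u\<close> end up in different degrees in that variable. Each group therefore
  vanishes by itself, its power of \<open>P\<close> cancels, and a relation in \<open>x\<close>
  remains.\<close>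

lemma laurent_independent_exchange: "laurent_independent k V y"
  unfolding laurent_independent_def
proof (intro allI impI ballI)
  fix F c b assume *: "finite F \<and> F \<subseteq> exps_on V \<and> c ` F \<subseteq> k \<and> (\<Sum>a\<in>F. c a * laurent_monom V y a) = 0"
    and b: "b \<in> F"
  define N where "N = (\<Sum>a\<in>F. nat (- a u))"
  have N: "nat (- a u) \<le> N" if "a \<in> F" for a
    unfolding N_def using * that by (intro member_le_sum) auto
  \<comment> \<open>The involution on exponents that an exchange induces up to powers of
    \<open>P\<close>.\<close>
  define t where "t a = (\<lambda>v. if v = u then - a v else a v)" for a :: "'v \<Rightarrow> int"
  have t: "t (t a) = a" for a by (auto simp: t_def)
  have eq: "P ^ N * laurent_monom V y a = P ^ nat (int N + a u) * mon (t a)" if "a \<in> F" for a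
  proof -
    have i: "int N = int (nat (int N + a u)) + t a u" using N[OF that] by (simp add: t_def)
    have "t (t a) = (\<lambda>v. if v = u then - t a v else t a v)" by (subst t_def) simp
    then show ?thesis using mono_exchange[of N "nat (int N + a u)" "t a", OF i] by (simp add: t)
  qed
  define D where "D = (\<lambda>a. a u) ` F"
  define g where "g d = P ^ nat (int N + d) * (\<Sum>a\<in>{a\<in>F. a u = d}. c a * mon (t a))" for d
  have "sum g D = (\<Sum>d\<in>D. \<Sum>a\<in>{a\<in>F. a u = d}. P ^ nat (int N + a u) * (c a * mon (t a)))"
    by (intro sum.cong refl) (auto simp: g_def sum_distrib_left)
  also have "\<dots> = (\<Sum>a\<in>F. P ^ nat (int N + a u) * (c a * mon (t a)))"
    unfolding D_def using * by (intro sum.group) auto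
  also have "\<dots> = (\<Sum>a\<in>F. P ^ N * (c a * laurent_monom V y a))"
    using eq by (intro sum.cong refl) (simp add: mult_ac)
  also have "\<dots> = P ^ N * (\<Sum>a\<in>F. c a * laurent_monom V y a)"
    by (simp add: sum_distrib_left)
  finally have sum0: "sum g D = 0" using * by simp
  have tc: "c a * mon (t a) \<in> sp {a'. - a' u = d}" if "a \<in> {a\<in>F. a u = d}" for a d
    using that * u_in by (intro span_scale span_mono_mem) (auto simp: t_def exps_on_def)
  have Pm: "P ^ m \<in> sp {a. a u = 0}" for m
  proof (induction m)
    case 0
    then show ?case by (auto intro: one_mem_span)
  next
    case (Suc m)
    have "P \<in> sp {a. a u = 0}"
      unfolding P_def using p_u q_u p_on q_on by (intro span_add span_mono_mem) auto
    from span_mult[OF this Suc, of "{a. a u = 0}"] show ?case by simp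
  qed
  have gd: "g d \<in> sp {a'. - a' u = d}" for d
    unfolding g_def using tc
    by (intro span_mult[OF Pm, of _ "{a'. - a' u = d}"] span_sum) auto
  have "g (b u) = 0"
    using span_sum_eq_0[OF _ sum0, of "\<lambda>a. - a u" "b u"] gd * b by (simp add: D_def)
  then have 0: "(\<Sum>a\<in>{a\<in>F. a u = b u}. c a * mon (t a)) = 0"
    using P_nonzero by (simp add: g_def)
  have inj: "inj t" using t by (metis injI)
  have inv: "inv t (t a) = a" for a using inj by simp
  have "(\<Sum>a\<in>t ` {a\<in>F. a u = b u}. c (inv t a) * mon a) = (\<Sum>a\<in>{a\<in>F. a u = b u}. c a * mon (t a))"
    using inj by (subst sum.reindex) (auto simp: inv intro: inj_on_subset)
  then have "c (inv t (t b)) = 0"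
    using 0 * b u_in
    by (intro laurent_independentD[OF indep, of "t ` {a\<in>F. a u = b u}" "\<lambda>a. c (inv t a)" "t b"])
      (auto simp: inv, auto simp: t_def exps_on_def)
  then show "c b = 0" by (simp add: inv)
qed

lemma exchange_sym: "exchange k V y x u p q P"
  using finite_V laurent_independent_exchange u_in p_on q_on p_u q_u P_y P_nonzero x_eq
  by unfold_locales

end

section \<open>Gradings and graded division\<close>

text \<open>The scalar action is a parameter because two kinds of weights occur: vectors, for the
  given grading, and integers, for orders along a variable and for the degree that separates the
  terms of an exchange polynomial.\<close>

definition wdeg :: "(int \<Rightarrow> 'g \<Rightarrow> 'g) \<Rightarrow> 'v set \<Rightarrow> ('v \<Rightarrow> 'g) \<Rightarrow> ('v \<Rightarrow> int) \<Rightarrow> 'g::ab_group_add" where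
  "wdeg sc V \<sigma> a = (\<Sum>v\<in>V. sc (a v) (\<sigma> v))"

lemma wdeg_single:
  "finite V \<Longrightarrow> u \<in> V \<Longrightarrow> wdeg (*) V (\<lambda>v. if v = u then 1 else 0) a = a u"
  by (simp add: wdeg_def if_distrib sum.delta cong: if_cong)

lemma wdeg_add:
  "module sc \<Longrightarrow> wdeg sc V \<sigma> (\<lambda>v. a v + b v) = wdeg sc V \<sigma> a + wdeg sc V \<sigma> b"
  by (simp add: wdeg_def module.scale_left_distrib sum.distrib)

lemma wdeg_scale:
  "module sc \<Longrightarrow> wdeg sc V \<sigma> (\<lambda>v. c * a v) = sc c (wdeg sc V \<sigma> a)"
  by (simp add: wdeg_def module.scale_sum_right module.scale_scale)

lemma module_int_mult: "module ((*) :: int \<Rightarrow> int \<Rightarrow> int)"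
  by unfold_locales (auto simp: algebra_simps)

context cluster_vars
begin

text \<open>
  The component of lowest degree of \<open>(s + t) z\<close> is \<open>s\<close> times that of \<open>z\<close>, so the components of \<open>z\<close>
  can be moved into \<open>M\<close> one after the other.
\<close>

lemma graded_division_step:
  fixes deg :: "('v \<Rightarrow> int) \<Rightarrow> int"
  assumes deg: "\<And>a b. deg (\<lambda>v. a v + b v) = deg a + deg b"
    and s: "s \<in> sp {a. deg a = \<delta>}" and t: "t \<in> sp {a. deg a > \<delta>}"
    and zero: "0 \<in> M" and add: "\<And>a b. a \<in> M \<Longrightarrow> b \<in> M \<Longrightarrow> a + b \<in> M"
    and diff: "\<And>a b. a \<in> M \<Longrightarrow> b \<in> M \<Longrightarrow> a - b \<in> M"
    and mult: "\<And>m. m \<in> M \<Longrightarrow> (s + t) * m \<in> M"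
    and homogeneous: "\<And>d z1 z2. z1 + z2 \<in> M \<Longrightarrow> z1 \<in> sp {a. deg a = d} \<Longrightarrow> z2 \<in> sp {a. deg a > d} \<Longrightarrow> z1 \<in> M"
    and cancel: "\<And>d w. w \<in> sp {a. deg a = d} \<Longrightarrow> s * w \<in> M \<Longrightarrow> w \<in> M"
    and z: "z \<in> sp UNIV" and Uz: "(s + t) * z \<in> M"
  shows "z \<in> M"
proof -
  \<comment> \<open>Induction on the length of an interval of degrees that contains the support; the
    bottom degree is peeled off in each round.\<close>
  have "z \<in> M" if "z \<in> sp {a. l \<le> deg a \<and> deg a < l + int n}" "(s + t) * z \<in> M" for z l n
    using that
  proof (induction n arbitrary: l z)
    case 0
    have "z \<in> sp {}" using 0(1) by (rule lspan_subset) auto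
    then show ?case using span_empty[of z] zero by simp
  next
    case (Suc n)
    obtain z1 z2 where z12: "z = z1 + z2"
      "z1 \<in> sp ({a. l \<le> deg a \<and> deg a < l + int (Suc n)} \<inter> {a. deg a = l})"
      "z2 \<in> sp ({a. l \<le> deg a \<and> deg a < l + int (Suc n)} - {a. deg a = l})"
      by (rule span_split[OF Suc.prems(1)])
    have z1: "z1 \<in> sp {a. deg a = l}" using z12(2) by (rule lspan_subset) auto
    have z2: "z2 \<in> sp {a. l + 1 \<le> deg a \<and> deg a < l + 1 + int n}"
      using z12(3) by (rule lspan_subset) auto
    have "s * z1 \<in> sp {a. deg a = \<delta> + l}"
      using s z1 by (rule span_mult) (auto simp: deg)
    moreover have "t * z1 + (s * z2 + t * z2) \<in> sp {a. deg a > \<delta> + l}"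
      by (intro span_add span_mult[OF t z1] span_mult[OF s z2] span_mult[OF t z2]) (auto simp: deg)
    moreover have "s * z1 + (t * z1 + (s * z2 + t * z2)) \<in> M"
      using Suc.prems(2) by (simp add: z12(1) algebra_simps)
    ultimately have "s * z1 \<in> M" using homogeneous by blast
    then have "z1 \<in> M" using cancel z1 by blast
    then have "(s + t) * z - (s + t) * z1 \<in> M" using Suc.prems(2) diff mult by blast
    then have "(s + t) * z2 \<in> M" by (simp add: z12(1) algebra_simps)
    then have "z2 \<in> M" using Suc.IH[OF z2] by simp
    then show ?case using \<open>z1 \<in> M\<close> add z12(1) by simp
  qed
  moreover have "\<exists>l n. z \<in> sp {a. l \<le> deg a \<and> deg a < l + int n}"
    using z
  proof (induction rule: span_induct)
    case zero
    then show ?case by simp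
  next
    case (step z c a)
    then obtain l n where ln: "z \<in> sp {a. l \<le> deg a \<and> deg a < l + int n}" by blast
    define l' where "l' = min l (deg a)"
    define n' where "n' = nat (max (l + int n) (deg a + 1) - l')"
    have n': "l' + int n' = max (l + int n) (deg a + 1)" by (auto simp: n'_def l'_def)
    have "z \<in> sp {a. l' \<le> deg a \<and> deg a < l' + int n'}"
      using ln by (rule lspan_subset) (simp add: n', auto simp: l'_def)
    moreover have "l' \<le> deg a" "deg a < l' + int n'" unfolding n' by (simp_all add: l'_def)
    ultimately have "c * mon a + z \<in> sp {a. l' \<le> deg a \<and> deg a < l' + int n'}"
      using step by (intro span_step) simp_all
    then show ?case by blast
  qed
  ultimately show ?thesis using Uz by blast
qed

text \<open>Powers of \<open>s + t\<close> are removed one at a time. \<open>M\<close> is kept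
  abstract since it is used once for Laurent polynomials with a nonnegative exponent and once for
  the intersection of two Laurent rings.\<close>

lemma graded_division:
  fixes deg :: "('v \<Rightarrow> int) \<Rightarrow> int"
  assumes "\<And>a b. deg (\<lambda>v. a v + b v) = deg a + deg b"
    and s: "s \<in> sp {a. deg a = \<delta>}" and t: "t \<in> sp {a. deg a > \<delta>}"
    and "0 \<in> M" and "\<And>a b. a \<in> M \<Longrightarrow> b \<in> M \<Longrightarrow> a + b \<in> M"
    and "\<And>a b. a \<in> M \<Longrightarrow> b \<in> M \<Longrightarrow> a - b \<in> M"
    and "\<And>m. m \<in> M \<Longrightarrow> (s + t) * m \<in> M"
    and "\<And>d z1 z2. z1 + z2 \<in> M \<Longrightarrow> z1 \<in> sp {a. deg a = d} \<Longrightarrow> z2 \<in> sp {a. deg a > d} \<Longrightarrow> z1 \<in> M"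
    and "\<And>d w. w \<in> sp {a. deg a = d} \<Longrightarrow> s * w \<in> M \<Longrightarrow> w \<in> M"
    and z: "z \<in> sp UNIV" and "(s + t) ^ N * z \<in> M"
  shows "z \<in> M"
  using assms(11)
proof (induction N)
  case (Suc N)
  have "s + t \<in> sp UNIV"
    using lspan_subset[OF s] lspan_subset[OF t] by (intro span_add) auto
  then have "(s + t) ^ i * z \<in> sp UNIV" for i
  proof (induction i)
    case (Suc i)
    then show ?case using span_mult[OF Suc.prems Suc.IH[OF Suc.prems], of UNIV] by (simp add: mult.assoc)
  qed (use z in simp)
  then have "(s + t) ^ N * z \<in> M"
    using Suc.prems
    by (intro graded_division_step[OF assms(1-9), where z = "(s + t) ^ N * z"]) (auto simp: mult.assoc)
  then show ?case by (rule Suc.IH)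
qed simp

lemma span_power: "z \<in> sp UNIV \<Longrightarrow> z ^ n \<in> sp UNIV"
  by (induction n) (simp_all add: one_mem_span span_mult[of _ UNIV _ UNIV UNIV])

end

section \<open>Gradings and frozen orders across one exchange\<close>

context exchange
begin

text \<open>The two terms of \<open>P\<close> share the degree \<delta>. Giving the new variable the
  weight \<delta> minus the old one makes \<open>P = x u * y u\<close> homogeneous of degree
  \<delta> in both clusters, so multiplication by the \<open>n\<close>-th power of \<open>P\<close>
  shifts degrees by \<open>n\<close> times \<delta>.\<close>

lemma wdeg_exch_exp:
  assumes sc: "module sc" and pq: "wdeg sc V \<sigma> p = wdeg sc V \<sigma> q"
    and ij: "int i + int j = n + a u"
  shows "wdeg sc V (\<sigma>(u := wdeg sc V \<sigma> p - \<sigma> u)) (exch_exp u p q a i j)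
    = wdeg sc V \<sigma> a + sc n (wdeg sc V \<sigma> p)"
proof -
  interpret module sc by (rule sc)
  define \<delta> where "\<delta> = wdeg sc V \<sigma> p"
  define \<sigma>' where "\<sigma>' = \<sigma>(u := \<delta> - \<sigma> u)"
  have same: "wdeg sc V \<sigma>' r = wdeg sc V \<sigma> r" if "r u = 0" for r
    unfolding wdeg_def \<sigma>'_def using that by (intro sum.cong) auto
  have "wdeg sc V \<sigma>' (\<lambda>v. if v = u then - a v else a v)
      = sc (- a u) (\<delta> - \<sigma> u) + (\<Sum>v\<in>V - {u}. sc (a v) (\<sigma> v))"
    unfolding wdeg_def \<sigma>'_def using finite_V u_in by (subst sum.remove[of _ u]) auto
  also have "(\<Sum>v\<in>V - {u}. sc (a v) (\<sigma> v)) = wdeg sc V \<sigma> a - sc (a u) (\<sigma> u)"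
    unfolding wdeg_def using finite_V u_in by (subst sum.remove[of _ u]) auto
  finally have "wdeg sc V \<sigma>' (\<lambda>v. if v = u then - a v else a v) = wdeg sc V \<sigma> a - sc (a u) \<delta>"
    by (simp add: scale_right_diff_distrib)
  then have "wdeg sc V \<sigma>' (exch_exp u p q a i j)
      = wdeg sc V \<sigma> a - sc (a u) \<delta> + (sc (int i) \<delta> + sc (int j) \<delta>)"
    unfolding exch_exp_def using pq
    by (simp add: wdeg_add[OF sc] wdeg_scale[OF sc] same p_u q_u \<delta>_def)
  also have "sc (int i) \<delta> + sc (int j) \<delta> = sc n \<delta> + sc (a u) \<delta>"
    using ij by (simp flip: scale_left_distrib)
  finally have "wdeg sc V \<sigma>' (exch_exp u p q a i j) = wdeg sc V \<sigma> a + sc n \<delta>" by simp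
  then show ?thesis unfolding \<sigma>'_def \<delta>_def .
qed

lemma P_power_homogeneous:
  assumes sc: "module sc" and pq: "wdeg sc V \<sigma> p = wdeg sc V \<sigma> q"
  shows "P ^ n \<in> lspan k V y {a. wdeg sc V (\<sigma>(u := wdeg sc V \<sigma> p - \<sigma> u)) a = sc (int n) (wdeg sc V \<sigma> p)}"
proof -
  have "P ^ n * mon (\<lambda>v. 0) \<in> lspan k V y {exch_exp u p q (\<lambda>v. 0) i j | i j. i + j = n}"
    by (rule P_power_mult_mono) (auto simp: exps_on_def)
  moreover have "wdeg sc V \<sigma> (\<lambda>v. 0) = 0"
    using sc by (simp add: wdeg_def module.scale_zero_left)
  ultimately show ?thesis
    by (simp, elim lspan_subset) (auto simp: wdeg_exch_exp[OF sc pq])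
qed

text \<open>
  In each cluster, \<open>P\<^sup>N\<close> is homogeneous and \<open>P\<^sup>N z\<^sub>1\<close>, \<open>P\<^sup>N z\<^sub>2\<close> are Laurent polynomials, so the
  decompositions of \<open>P\<^sup>N (z\<^sub>1 + z\<^sub>2)\<close> in the two clusters agree.
\<close>

lemma exchange_grading:
  assumes sc: "module sc" and pq: "wdeg sc V \<sigma> p = wdeg sc V \<sigma> q"
    and z: "z1 + z2 \<in> lspan k V y UNIV"
    and z1: "z1 \<in> sp {a. wdeg sc V \<sigma> a \<in> D}" and z2: "z2 \<in> sp {a. wdeg sc V \<sigma> a \<notin> D}"
  shows "z1 \<in> lspan k V y {a. wdeg sc V (\<sigma>(u := wdeg sc V \<sigma> p - \<sigma> u)) a \<in> D}"
proof -
  interpret Y: exchange k V y x u p q P by (rule exchange_sym)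
  let ?d = "wdeg sc V (\<sigma>(u := wdeg sc V \<sigma> p - \<sigma> u))" and ?\<delta> = "wdeg sc V \<sigma> p"
  obtain w1 w2 where w: "z1 + z2 = w1 + w2" and w12: "w1 \<in> Y.sp (UNIV \<inter> {a. ?d a \<in> D})"
    "w2 \<in> Y.sp (UNIV - {a. ?d a \<in> D})"
    by (rule Y.span_split[OF z])
  have w1: "w1 \<in> Y.sp {a. ?d a \<in> D}" using w12(1) by (rule lspan_subset) auto
  have w2: "w2 \<in> Y.sp {a. ?d a \<notin> D}" using w12(2) by (rule lspan_subset) auto
  \<comment> \<open>\<open>E\<close> is a parameter because the claim is used for \<open>D\<close>
    and for its complement: the two parts need not be Laurent in \<open>y\<close> separately until a
    power of \<open>P\<close> is applied.\<close>
  have shift: "\<exists>N. \<forall>n\<ge>N. P ^ n * z \<in> Y.sp {a. ?d a - sc (int n) ?\<delta> \<in> E}"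
    if z: "z \<in> sp {a. wdeg sc V \<sigma> a \<in> E}" for z E
  proof -
    obtain N where N: "\<And>n. n \<ge> N \<Longrightarrow> P ^ n * z \<in>
      Y.sp {exch_exp u p q a i j | a i j. a \<in> {a. wdeg sc V \<sigma> a \<in> E} \<and> int i + int j = int n + a u}"
      using span_exchange[OF z] by blast
    have "P ^ n * z \<in> Y.sp {a. ?d a - sc (int n) ?\<delta> \<in> E}" if "n \<ge> N" for n
      using N[OF that] by (rule lspan_subset) (auto simp: wdeg_exch_exp[OF sc pq])
    then show ?thesis by blast
  qed
  have shift': "P ^ n * z \<in> Y.sp {a. ?d a - sc (int n) ?\<delta> \<in> E}" if z: "z \<in> Y.sp {a. ?d a \<in> E}" for z E n
    using P_power_homogeneous[OF sc pq] z
    by (rule Y.span_mult) (auto simp: wdeg_add[OF sc])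
  obtain N1 where N1: "\<And>n. n \<ge> N1 \<Longrightarrow> P ^ n * z1 \<in> Y.sp {a. ?d a - sc (int n) ?\<delta> \<in> D}"
    using shift[of z1 D] z1 by blast
  obtain N2 where N2: "\<And>n. n \<ge> N2 \<Longrightarrow> P ^ n * z2 \<in> Y.sp {a. ?d a - sc (int n) ?\<delta> \<in> - D}"
    using shift[of z2 "- D"] z2 by auto
  let ?n = "max N1 N2"
  have "P ^ ?n * z1 = P ^ ?n * w1"
  proof (rule Y.span_split_unique)
    show "P ^ ?n * z1 + P ^ ?n * z2 = P ^ ?n * w1 + P ^ ?n * w2"
      using w by (simp flip: distrib_left)
    show "P ^ ?n * z1 \<in> Y.sp {a. ?d a - sc (int ?n) ?\<delta> \<in> D}" using N1 by simp
    show "P ^ ?n * z2 \<in> Y.sp {a. ?d a - sc (int ?n) ?\<delta> \<in> - D}" using N2 by simp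
    show "P ^ ?n * w1 \<in> Y.sp {a. ?d a - sc (int ?n) ?\<delta> \<in> D}" using shift' w1 by blast
    show "P ^ ?n * w2 \<in> Y.sp {a. ?d a - sc (int ?n) ?\<delta> \<in> - D}" using shift'[of w2 "- D"] w2 by simp
  qed auto
  then have "z1 = w1" using P_nonzero by simp
  then show ?thesis using w1 by simp
qed

text \<open>Some power of \<open>P\<close> times \<open>z\<close> has nonnegative order along
  \<open>f\<close> in the new cluster, and \<open>P\<close> has order 0 there with lowest component
  \<open>s\<close>. Graded division by \<open>P\<close> with respect to this order then brings
  \<open>z\<close> back.\<close>

lemma exchange_nonneg_aux:
  assumes st: "P = s + t" "s \<noteq> 0" and s: "s \<in> lspan k V y {a. a f = 0}"
    and t: "t \<in> lspan k V y {a. a f > 0}"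
    and fu: "f \<noteq> u" and pq: "p f \<ge> 0" "q f \<ge> 0"
    and z: "z \<in> sp {a. a f \<ge> 0}" "z \<in> lspan k V y UNIV"
  shows "z \<in> lspan k V y {a. a f \<ge> 0}"
proof -
  interpret Y: exchange k V y x u p q P by (rule exchange_sym)
  obtain N where "P ^ N * z \<in> Y.sp {exch_exp u p q a i j | a i j. a \<in> {a. a f \<ge> 0} \<and> int i + int j = int N + a u}"
    using span_exchange[OF z(1)] by blast
  then have Nz: "(s + t) ^ N * z \<in> Y.sp {a. a f \<ge> 0}"
    unfolding st(1) by (rule lspan_subset) (use fu pq in \<open>auto simp: exch_exp_def\<close>)
  have U: "s + t \<in> Y.sp {a. a f \<ge> 0}"
    using lspan_subset[OF s] lspan_subset[OF t] by (intro Y.span_add) auto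
  show ?thesis
  proof (rule Y.graded_division[where deg = "\<lambda>a. a f" and s = s and t = t and \<delta> = 0 and z = z and N = N])
    fix d z1 z2 assume a: "z1 + z2 \<in> Y.sp {a. a f \<ge> 0}" "z1 \<in> Y.sp {a. a f = d}" "z2 \<in> Y.sp {a. d < a f}"
    have "z2 \<in> Y.sp (- {a. a f = d})" using a(3) by (rule lspan_subset) auto
    then show "z1 \<in> Y.sp {a. a f \<ge> 0}"
      using lspan_subset[OF Y.span_summand[OF a(1,2)]] by auto
  next
    fix d w assume a: "w \<in> Y.sp {a. a f = d}" "s * w \<in> Y.sp {a. a f \<ge> 0}"
    show "w \<in> Y.sp {a. a f \<ge> 0}"
    proof (cases "d \<ge> 0")
      case True
      then show ?thesis using lspan_subset[OF a(1)] by auto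
    next
      case False
      \<comment> \<open>In a negative degree \<open>s * w\<close> would have both negative and
        nonnegative exponents at \<open>f\<close>, hence it is 0.\<close>
      have "s * w \<in> Y.sp {a. a f = d}" using s a(1) by (rule Y.span_mult) auto
      then have "s * w = 0"
        using Y.span_disjoint[of "s * w" "{a. a f = d}" "{a. a f \<ge> 0}"] a(2) False by auto
      then show ?thesis using st(2) by simp
    qed
  next
    show "(s + t) * m \<in> Y.sp {a. a f \<ge> 0}" if "m \<in> Y.sp {a. a f \<ge> 0}" for m
      using U that by (rule Y.span_mult) auto
  qed (simp_all add: s t z(2) Nz Y.span_add Y.span_diff)
qed

text \<open>At least one term of \<open>P\<close> is free of the variable at \<open>f\<close>, which
  supplies the component of order 0. If both are, the whole of \<open>P\<close> plays that role and
  the remainder is 0.\<close>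

lemma exchange_nonneg:
  assumes fu: "f \<noteq> u" and pq: "p f \<ge> 0" "q f \<ge> 0" "p f = 0 \<or> q f = 0"
    and z: "z \<in> sp {a. a f \<ge> 0}" "z \<in> lspan k V y UNIV"
  shows "z \<in> lspan k V y {a. a f \<ge> 0}"
proof -
  interpret Y: exchange k V y x u p q P by (rule exchange_sym)
  consider "p f = 0" "q f = 0" | "p f = 0" "q f > 0" | "p f > 0" "q f = 0" using pq by linarith
  then show ?thesis
  proof cases
    case 1
    have "P \<in> Y.sp {a. a f = 0}"
      unfolding P_y using 1 p_on q_on by (intro Y.span_add Y.span_mono_mem) auto
    then show ?thesis
      using exchange_nonneg_aux[of P 0 f z] fu pq z P_nonzero by simp
  next
    case 2
    then show ?thesis
      using fu pq z P_y Y.mono_nonzero Y.span_mono_mem[of p "{a. a f = 0}"] p_on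
        Y.span_mono_mem[of q "{a. a f > 0}"] q_on
      by (intro exchange_nonneg_aux[of "Y.mon p" "Y.mon q" f z]) auto
  next
    case 3
    then show ?thesis
      using fu pq z P_y Y.mono_nonzero Y.span_mono_mem[of q "{a. a f = 0}"] p_on
        Y.span_mono_mem[of p "{a. a f > 0}"] q_on
      by (intro exchange_nonneg_aux[of "Y.mon q" "Y.mon p" f z]) (auto simp: add.commute)
  qed
qed

lemma exchange_swap: "exchange k V x y u q p P"
  using u_in p_on q_on p_u q_u P_def P_nonzero y_def by unfold_locales (auto simp: add.commute)

end

section \<open>The rank two step of the upper bound theorem\<close>

lemma (in exchange) y_var_exchange: "y u = P / x u" and y_var_other: "v \<noteq> u \<Longrightarrow> y v = x v"
  by (simp_all add: y_def)

text \<open>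
  The cluster \<open>x\<close> is the centre: \<open>x1\<close> is its neighbour at \<open>u1\<close>, \<open>w\<close> its neighbour at \<open>u2\<close>, and \<open>y\<close>
  the neighbour of \<open>x1\<close> at \<open>u2\<close>. The new variable \<open>y\<^sub>u\<^sub>2\<close> is Laurent in \<open>w\<close>, so a power of \<open>P1\<close>
  clears the denominators of \<open>z\<close> with respect to \<open>w\<close>. The grading by \<open>\<Lambda>\<close>, for which \<open>P2\<close> is
  homogeneous but \<open>P1\<close> is not, then allows division by \<open>P1\<close>; its existence replaces the
  coprimality of \<open>P1\<close> and \<open>P2\<close>.
\<close>

lemma exchange_upper_bound:
  fixes x :: "'v \<Rightarrow> 'a::field" and \<Lambda> :: "'v \<Rightarrow> int"
  assumes E1: "exchange k V x x1 u1 p1 q1 P1"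
    and E2: "exchange k V x w u2 p2 q2 P2"
    and E3: "exchange k V x1 y u2 p2' q2' P2'"
    and u12: "u1 \<noteq> u2"
    and nonneg: "\<And>v. p1 v \<ge> 0" "\<And>v. q1 v \<ge> 0" "\<And>v. p2 v \<ge> 0" "\<And>v. q2 v \<ge> 0"
    and b: "p1 u2 = int b" "q1 u2 = 0" "q2 u1 = int b" "p2 u1 = 0" "p2' u1 = int b" "q2' u1 = 0"
    and pq2': "\<And>v. v \<noteq> u1 \<Longrightarrow> p2 v - p2' v = q2 v + int b * q1 v - q2' v"
    and st: "(s0 = p1 \<and> t0 = q1) \<or> (s0 = q1 \<and> t0 = p1)" "s0 u2 = 0"
    and deg: "wdeg (*) V \<Lambda> s0 < wdeg (*) V \<Lambda> t0" "wdeg (*) V \<Lambda> p2 = wdeg (*) V \<Lambda> q2"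
    and z: "z \<in> lspan k V x UNIV" "z \<in> lspan k V x1 UNIV" "z \<in> lspan k V y UNIV"
  shows "z \<in> lspan k V w UNIV"
proof -
  interpret E1: exchange k V x x1 u1 p1 q1 P1 by (rule E1)
  interpret E2: exchange k V x w u2 p2 q2 P2 by (rule E2)
  interpret E3: exchange k V x1 y u2 p2' q2' P2' by (rule E3)
  interpret W: exchange k V w x u2 p2 q2 P2 by (rule E2.exchange_sym)
  interpret X1: exchange k V x1 x u1 p1 q1 P1 by (rule E1.exchange_sym)
  interpret Y: exchange k V y x1 u2 p2' q2' P2' by (rule E3.exchange_sym)
  \<comment> \<open>Laurent polynomials in \<open>x\<close> without negative powers of
    \<open>x u2\<close>. They lie in the Laurent ring of \<open>w\<close>, because
    \<open>x u2 = P2 / w u2\<close>.\<close>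
  let ?X0 = "E1.sp {a. a u2 \<ge> 0}"
  have X0_W: "z \<in> W.sp UNIV" if "z \<in> ?X0" for z
    using E2.span_exchange_nonneg[OF that] by (auto intro: lspan_subset)
  have X0_mult: "z * z' \<in> ?X0" if "z \<in> ?X0" "z' \<in> ?X0" for z z'
    using that by (rule E1.span_mult) auto
  have X0_power: "z ^ n \<in> ?X0" if "z \<in> ?X0" for z n
    using that by (induction n) (auto intro: E1.one_mem_span X0_mult)
  have W_mult: "z * z' \<in> W.sp UNIV" if "z \<in> W.sp UNIV" "z' \<in> W.sp UNIV" for z z'
    using that by (rule W.span_mult) auto
  have mon_X0: "E1.mon a \<in> ?X0" if "a \<in> exps_on V" "a u2 \<ge> 0" for a
    using that by (intro E1.span_mono_mem) auto
  have P1_X0: "P1 \<in> ?X0"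
    unfolding E1.P_def using nonneg E1.p_on E1.q_on by (intro E1.span_add mon_X0) auto

  have y2_W: "y u2 \<in> W.sp UNIV"
  proof -
    \<comment> \<open>The monomial \<open>mb\<close> links the two exchange polynomials at
      \<open>u2\<close>. Off \<open>u1\<close> it turns \<open>p2'\<close> into \<open>p2\<close>
      and, by \<open>pq2'\<close>, turns \<open>q2'\<close> into \<open>q2\<close> times a power of
      \<open>q1\<close>. Its factor \<open>x u1 ^ b\<close> cancels the denominator of
      \<open>x1 u1 ^ b\<close>, where \<open>x1 u1 = P1 / x u1\<close>.\<close>
    define m where "m v = (if v = u1 then 0 else p2 v - p2' v)" for v
    define mb where "mb v = m v + (if v = u1 then int b else 0)" for v
    have m_on: "m \<in> exps_on V" and mb_on: "mb \<in> exps_on V"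
      using E2.p_on E3.p_on E1.u_in by (auto simp: exps_on_def m_def mb_def)
    have m2: "mb u2 = 0" using E2.p_u E3.p_u u12 by (simp add: mb_def m_def)
    have x1b: "E1.mon mb = E1.mon m * x u1 ^ b"
      unfolding mb_def by (simp add: E1.mono_add laurent_monom_single[OF E1.finite_V E1.u_in])
    have "E3.mon p2' = x1 u1 ^ b * E1.mon (\<lambda>v. if v = u1 then 0 else p2' v)"
    proof -
      have "E3.mon p2' = x1 u1 ^ b * E3.mon (X1.rest p2')"
        using X1.mono_split_u[of p2'] b by simp
      also have "E3.mon (X1.rest p2') = E1.mon (X1.rest p2')"
        by (rule E1.mono_y_eq) (simp add: X1.rest_def)
      also have "X1.rest p2' = (\<lambda>v. if v = u1 then 0 else p2' v)" by (auto simp: X1.rest_def)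
      finally show ?thesis .
    qed
    then have "E1.mon mb * E3.mon p2'
        = P1 ^ b * (E1.mon m * E1.mon (\<lambda>v. if v = u1 then 0 else p2' v))"
      unfolding x1b E1.y_var_exchange using E1.var_nonzero[OF E1.u_in] by (simp add: field_simps)
    also have "E1.mon m * E1.mon (\<lambda>v. if v = u1 then 0 else p2' v) = E1.mon p2"
      unfolding E1.mono_add[symmetric] using b by (intro laurent_monom_cong) (auto simp: m_def)
    finally have 1: "E1.mon mb * E3.mon p2' = P1 ^ b * E1.mon p2" .
    have "E1.mon mb * E3.mon q2' = E1.mon (\<lambda>v. mb v + q2' v)"
      using E1.mono_y_eq[of q2'] b by (simp add: E1.mono_add)
    also have "\<dots> = E1.mon (\<lambda>v. q2 v + int b * q1 v)"
      using b E1.q_u pq2' by (intro laurent_monom_cong) (auto simp: mb_def m_def)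
    finally have 2: "E1.mon mb * E3.mon q2' = E1.mon q2 * E1.mon q1 ^ b"
      by (simp add: E1.mono_add laurent_monom_scale)
    \<comment> \<open>The cofactor of \<open>P1 - q1 = p1\<close> in the difference of the
      \<open>b\<close>-th powers of \<open>P1\<close> and \<open>q1\<close>. Replacing one power by
      the other exposes \<open>P2\<close>, which is divisible by \<open>x u2\<close> with quotient
      \<open>w u2\<close>.\<close>
    define S where "S = (\<Sum>i<b. P1 ^ i * E1.mon q1 ^ (b - Suc i))"
    have S: "S \<in> ?X0"
      unfolding S_def using P1_X0 nonneg E1.q_on
      by (intro E1.span_sum X0_mult X0_power mon_X0) auto
    have "E1.mon mb * P2' = P1 ^ b * E1.mon p2 + E1.mon q2 * E1.mon q1 ^ b"
      unfolding E3.P_def distrib_left 1 2 ..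
    also have "\<dots> = E1.mon q1 ^ b * P2 + E1.mon p2 * (P1 ^ b - E1.mon q1 ^ b)"
      unfolding E2.P_def by (simp add: algebra_simps)
    also have "P1 ^ b - E1.mon q1 ^ b = E1.mon p1 * S"
      unfolding S_def power_diff_sumr2 by (simp add: E1.P_def mult.commute)
    finally have "E1.mon mb * P2' / x u2 = (E1.mon q1 ^ b * P2 + E1.mon p2 * (E1.mon p1 * S)) / x u2"
      by simp
    then have "E1.mon mb * y u2 = E1.mon q1 ^ b * w u2 + E1.mon p2 * (E1.mon p1 / x u2 * S)"
      using E1.y_var_other[of u2] u12 unfolding E3.y_var_exchange E2.y_var_exchange
      by (simp add: add_divide_distrib)
    then have y2: "y u2 = E1.mon (\<lambda>v. - mb v) * (E1.mon q1 ^ b * w u2 + E1.mon p2 * (E1.mon p1 / x u2 * S))"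
      using E1.mono_nonzero[of mb] unfolding E1.mono_minus by (simp add: field_simps)
    \<comment> \<open>For positive \<open>b\<close> the monomial \<open>p1\<close> contains
      \<open>x u2\<close> and absorbs the denominator; for \<open>b = 0\<close> the sum
      \<open>S\<close> is empty.\<close>
    have R: "E1.mon p1 / x u2 * S \<in> ?X0"
    proof (cases "b = 0")
      case True
      then show ?thesis by (simp add: S_def)
    next
      case False
      have "E1.mon (\<lambda>v. if v = u2 then - 1 else 0) = inverse (x u2)"
        by (simp add: laurent_monom_single[OF E1.finite_V E2.u_in] power_int_minus)
      then have "E1.mon p1 / x u2 = E1.mon (\<lambda>v. p1 v + (if v = u2 then - 1 else 0))"
        unfolding E1.mono_add by (simp add: field_simps)
      moreover have "(\<lambda>v. p1 v + (if v = u2 then - 1 else 0)) \<in> exps_on V"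
        using E1.p_on E2.u_in by (auto simp: exps_on_def)
      ultimately have "E1.mon p1 / x u2 \<in> ?X0" using b(1) False mon_X0 by simp
      then show ?thesis using S X0_mult by blast
    qed
    have w2: "w u2 \<in> W.sp UNIV"
    proof -
      have "(\<lambda>v. if v = u2 then 1 else 0) \<in> exps_on V" using E2.u_in by (auto simp: exps_on_def)
      then have "W.mon (\<lambda>v. if v = u2 then 1 else 0) \<in> W.sp UNIV" by (intro W.span_mono_mem) auto
      then show ?thesis by (simp add: laurent_monom_single[OF E1.finite_V E2.u_in])
    qed
    have "(\<lambda>v. - mb v) \<in> exps_on V" using mb_on by (auto simp: exps_on_def)
    then have m: "E1.mon (\<lambda>v. - mb v) \<in> ?X0" using m2 by (intro mon_X0) auto
    have q: "E1.mon q1 ^ b \<in> ?X0" and p: "E1.mon p2 \<in> ?X0"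
      using nonneg E1.q_on E2.p_on by (auto intro: X0_power mon_X0)
    show ?thesis
      unfolding y2 by (intro W_mult W.span_add X0_W[OF m] X0_W[OF q] X0_W[OF p] X0_W[OF R] w2)
  qed

  \<comment> \<open>Passing from \<open>x1\<close> back to \<open>x\<close> exchanges only the
    variable at \<open>u1\<close>. A power of \<open>P1\<close> pays for this, and the exponent at
    \<open>u2\<close> stays nonnegative.\<close>
  have clear: "\<exists>N. \<forall>n\<ge>N. P1 ^ n * z \<in> W.sp UNIV" if z: "z \<in> E3.sp {a. a u2 \<ge> 0}" for z
  proof -
    obtain N where N: "\<And>n. n \<ge> N \<Longrightarrow> P1 ^ n * z \<in>
        E1.sp {exch_exp u1 p1 q1 a i j | a i j. a \<in> {a. a u2 \<ge> 0} \<and> int i + int j = int n + a u1}"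
      using X1.span_exchange[OF z] by blast
    have "P1 ^ n * z \<in> W.sp UNIV" if "n \<ge> N" for n
      using N[OF that]
      by (intro X0_W, elim lspan_subset) (use u12 nonneg in \<open>auto simp: exch_exp_def\<close>)
    then show ?thesis by blast
  qed

  have clear_y: "\<exists>N. \<forall>n\<ge>N. P1 ^ n * z \<in> W.sp UNIV" if "z \<in> Y.sp {a. a u2 \<ge> 0}" for z
    using that
  proof (induction rule: Y.span_induct)
    case zero
    then show ?case by simp
  next
    case (step z c a)
    have r: "Y.rest a \<in> exps_on V" "Y.rest a u2 = 0" using step by (auto simp: exps_on_def Y.rest_def)
    have "E3.mon (Y.rest a) \<in> E3.sp {a. a u2 \<ge> 0}"
      using r by (intro E3.span_mono_mem) auto
    then obtain N1 where N1: "\<And>n. n \<ge> N1 \<Longrightarrow> P1 ^ n * E3.mon (Y.rest a) \<in> W.sp UNIV"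
      using clear by blast
    obtain N2 where N2: "\<And>n. n \<ge> N2 \<Longrightarrow> P1 ^ n * z \<in> W.sp UNIV" using step by blast
    have "P1 ^ n * (c * Y.mon a + z) \<in> W.sp UNIV" if n: "n \<ge> max N1 N2" for n
    proof -
      have "a u2 = int (nat (a u2))" using step by simp
      then have "Y.mon a = y u2 ^ nat (a u2) * E3.mon (Y.rest a)"
        using Y.mono_split_u[of a] E3.mono_y_eq[of "Y.rest a"] r by (metis power_int_of_nat)
      then have "P1 ^ n * (c * Y.mon a + z)
          = c * (y u2 ^ nat (a u2) * (P1 ^ n * E3.mon (Y.rest a))) + P1 ^ n * z"
        by (simp add: algebra_simps)
      moreover have "c * (y u2 ^ nat (a u2) * (P1 ^ n * E3.mon (Y.rest a))) \<in> W.sp UNIV"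
        using n by (intro W.span_scale[OF W_mult[OF W.span_power[OF y2_W] N1[of n]] step(2)]) auto
      ultimately show ?thesis using N2[of n] n by (simp add: W.span_add)
    qed
    then show ?case by blast
  qed

  \<comment> \<open>The exponent of the variable at \<open>u2\<close> is a grading in which the
    exchange polynomial at \<open>u2\<close> has degree 0, and the exchange changes its sign. So the
    part of \<open>z\<close> with negative exponents in \<open>x1\<close> has positive ones in
    \<open>y\<close>, and both parts can be cleared by powers of \<open>P1\<close>.\<close>
  define e2 :: "'v \<Rightarrow> int" where "e2 = (\<lambda>v. if v = u2 then 1 else 0)"
  have wdeg_e2: "wdeg (*) V e2 a = a u2" for a
    unfolding e2_def by (rule wdeg_single[OF E1.finite_V E2.u_in])
  obtain z1 z2 where zz: "z = z1 + z2" and z12: "z1 \<in> E3.sp (UNIV \<inter> {a. a u2 \<ge> 0})"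
    "z2 \<in> E3.sp (UNIV - {a. a u2 \<ge> 0})"
    by (rule E3.span_split[OF z(2)])
  have z1: "z1 \<in> E3.sp {a. a u2 \<ge> 0}" using z12(1) by (rule lspan_subset) auto
  have z2: "z2 \<in> E3.sp {a. wdeg (*) V e2 a \<in> {..<0}}"
    using z12(2) by (rule lspan_subset) (auto simp: wdeg_e2)
  have "z2 \<in> Y.sp {a. wdeg (*) V (e2(u2 := wdeg (*) V e2 p2' - e2 u2)) a \<in> {..<0}}"
  proof (rule E3.exchange_grading[OF module_int_mult])
    show "wdeg (*) V e2 p2' = wdeg (*) V e2 q2'" by (simp add: wdeg_e2 E3.p_u E3.q_u)
    show "z2 + z1 \<in> Y.sp UNIV" using z(3) zz by (simp add: add.commute)
    show "z1 \<in> E3.sp {a. wdeg (*) V e2 a \<notin> {..<0}}"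
      using z1 by (rule lspan_subset) (auto simp: wdeg_e2)
  qed (rule z2)
  then have z2y: "z2 \<in> Y.sp {a. a u2 \<ge> 0}"
  proof (rule lspan_subset)
    fix a
    have "e2(u2 := wdeg (*) V e2 p2' - e2 u2) = (\<lambda>v. - 1 * e2 v)"
      unfolding wdeg_e2 E3.p_u by (auto simp: e2_def)
    then have "wdeg (*) V (e2(u2 := wdeg (*) V e2 p2' - e2 u2)) a = - a u2"
      using wdeg_e2[of a] by (simp add: wdeg_def sum_negf)
    then show "a \<in> {a. wdeg (*) V (e2(u2 := wdeg (*) V e2 p2' - e2 u2)) a \<in> {..<0}} \<Longrightarrow> a \<in> {a. a u2 \<ge> 0}"
      by simp
  qed
  obtain N1 where N1: "\<And>n. n \<ge> N1 \<Longrightarrow> P1 ^ n * z1 \<in> W.sp UNIV" using clear[OF z1] by blast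
  obtain N2 where N2: "\<And>n. n \<ge> N2 \<Longrightarrow> P1 ^ n * z2 \<in> W.sp UNIV" using clear_y[OF z2y] by blast
  define N where "N = max N1 N2"
  have PN: "P1 ^ N * z \<in> W.sp UNIV"
    unfolding zz distrib_left using N1[of N] N2[of N] by (intro W.span_add) (auto simp: N_def)

  have P1_st: "P1 = E1.mon s0 + E1.mon t0" using st E1.P_def by (auto simp: add.commute)
  have st_on: "s0 \<in> exps_on V" "t0 \<in> exps_on V" using st E1.p_on E1.q_on by auto
  have P1_X: "P1 \<in> E1.sp UNIV" using P1_X0 by (rule lspan_subset) auto
  let ?deg = "wdeg (*) V \<Lambda>"
  \<comment> \<open>Division by \<open>P1\<close> takes place in the intersection of the Laurent
    rings of \<open>x\<close> and \<open>w\<close>.\<close>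
  have "z \<in> E1.sp UNIV \<inter> W.sp UNIV"
  proof (rule E1.graded_division[where deg = ?deg and s = "E1.mon s0" and t = "E1.mon t0"
        and \<delta> = "?deg s0" and z = z and N = N])
    show "?deg (\<lambda>v. a v + b v) = ?deg a + ?deg b" for a b
      by (rule wdeg_add[OF module_int_mult])
    show "E1.mon s0 \<in> E1.sp {a. ?deg a = ?deg s0}" using st_on by (intro E1.span_mono_mem) auto
    show "E1.mon t0 \<in> E1.sp {a. ?deg s0 < ?deg a}" using st_on deg by (intro E1.span_mono_mem) auto
    show "(E1.mon s0 + E1.mon t0) * m \<in> E1.sp UNIV \<inter> W.sp UNIV" if "m \<in> E1.sp UNIV \<inter> W.sp UNIV" for m
      using that W_mult[OF X0_W[OF P1_X0]] E1.span_mult[OF P1_X, of m UNIV UNIV] P1_st by auto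
    show "z1 \<in> E1.sp UNIV \<inter> W.sp UNIV" if "z1 + z2 \<in> E1.sp UNIV \<inter> W.sp UNIV"
      "z1 \<in> E1.sp {a. ?deg a = d}" "z2 \<in> E1.sp {a. d < ?deg a}" for d z1 z2
    proof
      show "z1 \<in> E1.sp UNIV" using that(2) by (rule lspan_subset) auto
      \<comment> \<open>Homogeneity of \<open>P2\<close> for \<Lambda> makes the components in
        \<open>x\<close> and in \<open>w\<close> agree, so the lowest component is again Laurent in
        \<open>w\<close>.\<close>
      have "z1 \<in> W.sp {a. wdeg (*) V (\<Lambda>(u2 := ?deg p2 - \<Lambda> u2)) a \<in> {d}}"
      proof (rule E2.exchange_grading[OF module_int_mult deg(2)])
        show "z1 + z2 \<in> W.sp UNIV" using that by simp
        show "z1 \<in> E1.sp {a. ?deg a \<in> {d}}" using that by simp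
        show "z2 \<in> E1.sp {a. ?deg a \<notin> {d}}" using that(3) by (rule lspan_subset) auto
      qed
      then show "z1 \<in> W.sp UNIV" by (rule lspan_subset) auto
    qed
    show "v \<in> E1.sp UNIV \<inter> W.sp UNIV"
      if "v \<in> E1.sp {a. ?deg a = d}" "E1.mon s0 * v \<in> E1.sp UNIV \<inter> W.sp UNIV" for d v
    proof
      show "v \<in> E1.sp UNIV" using that(1) by (rule lspan_subset) auto
      \<comment> \<open>Since \<open>s0\<close> is free of the variable at \<open>u2\<close>, its
        monomial is a unit in both Laurent rings.\<close>
      have "E1.mon (\<lambda>v. - s0 v) \<in> W.sp UNIV"
        using st(2) st_on by (intro X0_W[OF mon_X0]) (auto simp: exps_on_def)
      then have "E1.mon (\<lambda>v. - s0 v) * (E1.mon s0 * v) \<in> W.sp UNIV" using that(2) W_mult by blast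
      then show "v \<in> W.sp UNIV"
        using E1.mono_nonzero[of s0] by (simp add: E1.mono_minus flip: mult.assoc)
    qed
    have "P1 ^ N * z \<in> E1.sp UNIV"
      using E1.span_power[OF P1_X] z(1) by (rule E1.span_mult) auto
    then show "(E1.mon s0 + E1.mon t0) ^ N * z \<in> E1.sp UNIV \<inter> W.sp UNIV"
      using PN P1_st by simp
  qed (use z(1) in \<open>auto intro: E1.span_add W.span_add E1.span_diff W.span_diff\<close>)
  then show ?thesis by simp
qed

section \<open>Seeds and the rank of the exchange matrix\<close>

definition in_exp :: "'v ice_quiver \<Rightarrow> 'v \<Rightarrow> 'v \<Rightarrow> int" where
  "in_exp Q u = (\<lambda>v. int (arr Q v u))"

definition out_exp :: "'v ice_quiver \<Rightarrow> 'v \<Rightarrow> 'v \<Rightarrow> int" where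
  "out_exp Q u = (\<lambda>v. int (arr Q u v))"

definition exch_poly :: "'v ice_quiver \<Rightarrow> ('v \<Rightarrow> 'a::field) \<Rightarrow> 'v \<Rightarrow> 'a" where
  "exch_poly Q x u = laurent_monom (verts Q) x (in_exp Q u) + laurent_monom (verts Q) x (out_exp Q u)"

lemma mutate_seed_eq: "mutate_seed u (Q, x) = (mutate_quiver u Q, x(u := exch_poly Q x u / x u))"
  by (simp add: mutate_seed_def exch_poly_def in_exp_def out_exp_def laurent_monom_nat)

lemma mutate_quiver_simps [simp]:
  "verts (mutate_quiver u Q) = verts Q" "mut (mutate_quiver u Q) = mut Q"
  "frozen (mutate_quiver u Q) = frozen Q"
  by (simp_all add: mutate_quiver_def frozen_def)

lemma ice_quiverD:
  assumes "ice_quiver Q"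
  shows "finite (verts Q)" "mut Q \<subseteq> verts Q" "arr Q u v \<noteq> 0 \<Longrightarrow> u \<in> verts Q" "arr Q u v \<noteq> 0 \<Longrightarrow> v \<in> verts Q"
    "arr Q v v = 0" "arr Q u v = 0 \<or> arr Q v u = 0"
  using assms unfolding ice_quiver_def by simp_all

lemma exp_on_verts:
  assumes "ice_quiver Q"
  shows "in_exp Q u \<in> exps_on (verts Q)" "out_exp Q u \<in> exps_on (verts Q)"
proof -
  have "arr Q v u = 0" "arr Q u v = 0" if "v \<notin> verts Q" for v
    using ice_quiverD(3)[OF assms, of v u] ice_quiverD(4)[OF assms, of u v] that by auto
  then show "in_exp Q u \<in> exps_on (verts Q)" "out_exp Q u \<in> exps_on (verts Q)"
    unfolding exps_on_def in_exp_def out_exp_def by auto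
qed

lemma ice_quiver_mutate:
  assumes Q: "ice_quiver Q"
  shows "ice_quiver (mutate_quiver u Q)"
proof -
  have "v \<in> verts Q \<and> w \<in> verts Q" if nz: "arr (mutate_quiver u Q) v w \<noteq> 0" for v w
  proof -
    have "arr Q w v \<noteq> 0 \<or> arr Q v w \<noteq> 0 \<or> (arr Q v u \<noteq> 0 \<and> arr Q u w \<noteq> 0)"
    proof (rule ccontr)
      assume "\<not> ?thesis"
      then have "arr (mutate_quiver u Q) v w = 0" by (auto simp: mutate_quiver_def)
      then show False using nz by simp
    qed
    then show ?thesis using ice_quiverD(3,4)[OF Q] by blast
  qed
  moreover have "arr (mutate_quiver u Q) v v = 0" for v
    using ice_quiverD(5)[OF Q] by (auto simp: mutate_quiver_def)
  moreover have "arr (mutate_quiver u Q) v w = 0 \<or> arr (mutate_quiver u Q) w v = 0" for v w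
    using ice_quiverD(6)[OF Q] by (auto simp: mutate_quiver_def)
  ultimately show ?thesis
    using ice_quiverD(1,2)[OF Q] unfolding ice_quiver_def by auto
qed

lemma mutate_quiver_mutate_quiver:
  assumes Q: "ice_quiver Q"
  shows "mutate_quiver u (mutate_quiver u Q) = Q"
proof -
  \<comment> \<open>\<open>A\<close> and \<open>C\<close> count arrows in opposite directions,
    \<open>X\<close> and \<open>Y\<close> the paths through the mutated vertex, which are reversed
    by the first mutation. Over the integers the left side is \<open>A - C\<close>; truncation is
    harmless because one of them is 0.\<close>
  have cancel: "((A + X - (C + Y)) + Y) - ((C + Y - (A + X)) + X) = A" if "A = 0 \<or> C = 0"
    for A C X Y :: nat using that by auto
  have "arr (mutate_quiver u (mutate_quiver u Q)) v w = arr Q v w" for v w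
    using cancel[OF ice_quiverD(6)[OF Q, of v w], of "arr Q v u * arr Q u w" "arr Q w u * arr Q u v"]
    by (simp add: mutate_quiver_def mult.commute)
  then show ?thesis by (intro ice_quiver.equality) (auto simp: mutate_quiver_def)
qed

lemma B_entry_eq: "B_entry Q u v = out_exp Q u v - in_exp Q u v"
  by (simp add: B_entry_def in_exp_def out_exp_def)

text \<open>An asymmetric form of matrix mutation, in which the products
  \<open>arr Q v u * arr Q w u\<close> cancel. A new row is thus the old row plus a multiple of row
  \<open>u\<close> plus a correction proportional to an entry of column \<open>u\<close>, the shape
  used for weights and for ranks.\<close>

lemma B_entry_mutate:
  assumes "v \<in> mut Q \<or> w \<in> mut Q"
  shows "B_entry (mutate_quiver u Q) v w = (if v = u \<or> w = u then - B_entry Q v w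
    else B_entry Q v w + int (arr Q v u) * B_entry Q u w + int (arr Q w u) * B_entry Q v u)"
proof -
  have diff: "int (a - b) - int (b - a) = int a - int b" for a b by simp
  show ?thesis
  proof (cases "v = u \<or> w = u")
    case True
    then show ?thesis by (auto simp: B_entry_def mutate_quiver_def)
  next
    case False
    let ?X = "arr Q v w + arr Q v u * arr Q u w" and ?Y = "arr Q w v + arr Q w u * arr Q u v"
    have "B_entry (mutate_quiver u Q) v w = int (?X - ?Y) - int (?Y - ?X)"
      using False assms by (auto simp: B_entry_def mutate_quiver_def simp del: of_nat_diff)
    also have "\<dots> = int ?X - int ?Y" by (rule diff)
    finally show ?thesis using False by (simp add: B_entry_def algebra_simps)
  qed
qed

lemma is_seedD: "is_seed k (Q, x) \<Longrightarrow> ice_quiver Q" "is_seed k (Q, x) \<Longrightarrow> alg_independent k (verts Q) x"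
  by (simp_all add: is_seed_def)

context subfield
begin

lemma cluster_vars_seed: "is_seed k (Q, x) \<Longrightarrow> cluster_vars k (verts Q) x"
  using is_seedD ice_quiverD(1) laurent_independent_iff is_subfield
  by unfold_locales blast+

lemma exchange_seed:
  assumes s: "is_seed k (Q, x)" and u: "u \<in> mut Q" and P: "exch_poly Q x u \<noteq> 0"
  shows "exchange k (verts Q) x (snd (mutate_seed u (Q, x))) u (in_exp Q u) (out_exp Q u) (exch_poly Q x u)"
proof -
  interpret cluster_vars k "verts Q" x using s by (rule cluster_vars_seed)
  note Q = is_seedD(1)[OF s]
  show ?thesis
    using u ice_quiverD(2,5)[OF Q] P exp_on_verts[OF Q]
    by unfold_locales (auto simp: in_exp_def out_exp_def exch_poly_def mutate_seed_eq)
qed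

text \<open>Independence survives an exchange as soon as the exchange polynomial is nonzero; if it
  is zero, the new variable is 0 and cannot belong to a cluster.\<close>

lemma is_seed_mutate_iff:
  assumes s: "is_seed k (Q, x)" and u: "u \<in> mut Q"
  shows "is_seed k (mutate_seed u (Q, x)) \<longleftrightarrow> exch_poly Q x u \<noteq> 0"
proof
  assume "is_seed k (mutate_seed u (Q, x))"
  then interpret Y: cluster_vars k "verts Q" "x(u := exch_poly Q x u / x u)"
    using cluster_vars_seed[of "mutate_quiver u Q"] by (simp add: mutate_seed_eq)
  show "exch_poly Q x u \<noteq> 0"
    using Y.var_nonzero[of u] u ice_quiverD(2)[OF is_seedD(1)[OF s]] by auto
next
  assume "exch_poly Q x u \<noteq> 0"
  with s u interpret exchange k "verts Q" x "snd (mutate_seed u (Q, x))" u "in_exp Q u" "out_exp Q u" "exch_poly Q x u"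
    by (rule exchange_seed)
  show "is_seed k (mutate_seed u (Q, x))"
    using laurent_independent_exchange ice_quiver_mutate[OF is_seedD(1)[OF s]]
      laurent_independent_iff[OF finite_V]
    by (simp add: is_seed_def mutate_seed_eq)
qed

lemma exchange_step:
  assumes "is_seed k (Q, x)" "is_seed k (mutate_seed u (Q, x))" "u \<in> mut Q"
  shows "exchange k (verts Q) x (snd (mutate_seed u (Q, x))) u (in_exp Q u) (out_exp Q u) (exch_poly Q x u)"
  using exchange_seed[OF assms(1,3)] is_seed_mutate_iff[OF assms(1,3)] assms(2) by simp

lemma mutate_seed_mutate_seed:
  assumes s: "is_seed k (Q, x)" and u: "u \<in> mut Q" and P: "exch_poly Q x u \<noteq> 0"
  shows "mutate_seed u (mutate_seed u (Q, x)) = (Q, x)"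
proof -
  interpret exchange k "verts Q" x "snd (mutate_seed u (Q, x))" u "in_exp Q u" "out_exp Q u" "exch_poly Q x u"
    using assms by (rule exchange_seed)
  have "exch_poly (mutate_quiver u Q) (snd (mutate_seed u (Q, x))) u = exch_poly Q x u"
    using P_y by (simp add: exch_poly_def in_exp_def out_exp_def mutate_quiver_def add.commute)
  then show ?thesis
    using x_eq mutate_quiver_mutate_quiver[OF is_seedD(1)[OF s]] by (simp add: mutate_seed_eq)
qed

end

section \<open>Laurent rings and weights in terms of exponent vectors\<close>

lemma laurent_ring_eq:
  fixes Q :: "'v ice_quiver"
  shows "laurent_ring k (Q, x) = lspan k (verts Q) x {a. \<forall>v\<in>frozen Q. a v \<ge> 0}"
proof -
  have "{laurent_monom (verts Q) x a | a. \<forall>v\<in>frozen Q. a v \<ge> 0}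
      = laurent_monom (verts Q) x ` ({a. \<forall>v\<in>frozen Q. a v \<ge> 0} \<inter> exps_on (verts Q))"
  proof safe
    fix a :: "'v \<Rightarrow> int" assume a: "\<forall>v\<in>frozen Q. a v \<ge> 0"
    show "laurent_monom (verts Q) x a \<in> laurent_monom (verts Q) x ` ({a. \<forall>v\<in>frozen Q. a v \<ge> 0} \<inter> exps_on (verts Q))"
      using a by (intro image_eqI[of _ _ "\<lambda>v. if v \<in> verts Q then a v else 0"])
        (auto simp: restrict_exps)
  qed auto
  then show ?thesis by (simp add: laurent_ring_def lspan_def)
qed

lemma graded_part_eq:
  fixes Q :: "'v ice_quiver"
  shows "graded_part k (Q, x) \<sigma> A \<alpha> = A \<inter> lspan k (verts Q) x {a. wdeg (*s) (verts Q) \<sigma> a = \<alpha>}"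
proof -
  have "{laurent_monom (verts Q) x a | a. (\<Sum>v\<in>verts Q. a v *s \<sigma> v) = \<alpha>}
      = laurent_monom (verts Q) x ` ({a. wdeg (*s) (verts Q) \<sigma> a = \<alpha>} \<inter> exps_on (verts Q))"
  proof safe
    fix a :: "'v \<Rightarrow> int"
    show "laurent_monom (verts Q) x a \<in> laurent_monom (verts Q) x `
        ({b. wdeg (*s) (verts Q) \<sigma> b = (\<Sum>v\<in>verts Q. a v *s \<sigma> v)} \<inter> exps_on (verts Q))"
      by (intro image_eqI[of _ _ "\<lambda>v. if v \<in> verts Q then a v else 0"])
        (auto simp: wdeg_def restrict_exps)
  qed (auto simp: wdeg_def)
  then show ?thesis by (simp add: graded_part_def lspan_def)
qed

lemma module_vec: "module ((*s) :: int \<Rightarrow> int^'n \<Rightarrow> int^'n)"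
  by unfold_locales (auto simp: vec_eq_iff algebra_simps)

text \<open>The weight of the new variable is forced by homogeneity of the exchange
  relation.\<close>

definition mutate_weights :: "'v \<Rightarrow> 'v ice_quiver \<Rightarrow> ('v \<Rightarrow> int^'n) \<Rightarrow> 'v \<Rightarrow> int^'n" where
  "mutate_weights u Q \<sigma> = \<sigma>(u := wdeg (*s) (verts Q) \<sigma> (in_exp Q u) - \<sigma> u)"

lemma weight_configD:
  "weight_config Q \<sigma> \<Longrightarrow> u \<in> mut Q \<Longrightarrow>
    wdeg (*s) (verts Q) \<sigma> (in_exp Q u) = wdeg (*s) (verts Q) \<sigma> (out_exp Q u)"
  by (simp add: weight_config_def wdeg_def in_exp_def out_exp_def)

lemma weight_config_iff:
  "weight_config Q \<sigma> \<longleftrightarrow> (\<forall>u\<in>mut Q. wdeg (*s) (verts Q) \<sigma> (B_entry Q u) = 0)"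
proof -
  have "wdeg (*s) (verts Q) \<sigma> (B_entry Q u)
      = (\<Sum>v\<in>verts Q. int (arr Q u v) *s \<sigma> v) - (\<Sum>v\<in>verts Q. int (arr Q v u) *s \<sigma> v)" for u
    by (simp add: wdeg_def B_entry_def sum_subtractf module.scale_left_diff_distrib[OF module_vec])
  then show ?thesis unfolding weight_config_def by auto
qed

text \<open>For \<open>v\<close> different from \<open>u\<close>, the old rows contribute 0 and the
  correction \<open>in_exp Q u\<close> contributes \<open>B_entry Q v u\<close> times the degree of
  the exchange polynomial. This is exactly what the sign change at \<open>u\<close> together with
  the new weight there takes away.\<close>

lemma weight_config_mutate:
  fixes \<sigma> :: "'v \<Rightarrow> int^'n"
  assumes Q: "ice_quiver Q" and w: "weight_config Q \<sigma>" and u: "u \<in> mut Q"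
  shows "weight_config (mutate_quiver u Q) (mutate_weights u Q \<sigma>)"
  unfolding weight_config_iff mutate_quiver_simps
proof
  interpret module "(*s) :: int \<Rightarrow> int^'n \<Rightarrow> int^'n" by (rule module_vec)
  fix v
  assume v: "v \<in> mut Q"
  let ?V = "verts Q" and ?Q' = "mutate_quiver u Q" and ?\<tau> = "mutate_weights u Q \<sigma>"
  let ?\<delta> = "wdeg (*s) ?V \<sigma> (in_exp Q u)"
  have fin: "finite ?V" and uV: "u \<in> ?V" using ice_quiverD[OF Q] u by auto
  have Bu: "B_entry Q u u = 0" by (simp add: B_entry_def)
  have w0: "wdeg (*s) ?V \<sigma> (B_entry Q a) = 0" if "a \<in> mut Q" for a
    using w that by (simp add: weight_config_iff)
  show "wdeg (*s) ?V ?\<tau> (B_entry ?Q' v) = 0"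
  proof (cases "v = u")
    case True
    have "wdeg (*s) ?V ?\<tau> (B_entry ?Q' v) = wdeg (*s) ?V \<sigma> (\<lambda>a. - 1 * B_entry Q u a)"
      unfolding wdeg_def using u Bu True
      by (intro sum.cong refl) (auto simp: B_entry_mutate mutate_weights_def)
    then show ?thesis using w0[OF u] by (simp only: wdeg_scale[OF module_vec] scale_zero_right)
  next
    case False
    have "wdeg (*s) ?V ?\<tau> (B_entry ?Q' v)
        = - B_entry Q v u *s (?\<delta> - \<sigma> u) + (\<Sum>a\<in>?V - {u}. B_entry ?Q' v a *s \<sigma> a)"
      unfolding wdeg_def using fin uV v
      by (subst sum.remove[of _ u]) (auto simp: B_entry_mutate mutate_weights_def wdeg_def)
    also have "(\<Sum>a\<in>?V - {u}. B_entry ?Q' v a *s \<sigma> a) = (\<Sum>a\<in>?V - {u}.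
        (B_entry Q v a + (int (arr Q v u) * B_entry Q u a + B_entry Q v u * in_exp Q u a)) *s \<sigma> a)"
      using v False by (intro sum.cong refl) (auto simp: B_entry_mutate in_exp_def algebra_simps)
    also have "\<dots> = wdeg (*s) ?V \<sigma> (\<lambda>a. B_entry Q v a + (int (arr Q v u) * B_entry Q u a + B_entry Q v u * in_exp Q u a))
        - B_entry Q v u *s \<sigma> u"
      unfolding wdeg_def using fin uV ice_quiverD(5)[OF Q, of u] Bu
      by (subst (2) sum.remove[of _ u]) (auto simp: in_exp_def)
    also have "wdeg (*s) ?V \<sigma> (\<lambda>a. B_entry Q v a + (int (arr Q v u) * B_entry Q u a + B_entry Q v u * in_exp Q u a))
        = B_entry Q v u *s ?\<delta>"
      using w0[OF u] w0[OF v] by (simp only: wdeg_add[OF module_vec] wdeg_scale[OF module_vec] scale_zero_right add_0_left)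
    finally show ?thesis by (simp add: scale_right_diff_distrib)
  qed
qed

section \<open>Full rank as independence of rows, and its behaviour under mutation\<close>

lemma sum_fun_apply: "sum f A v = (\<Sum>i\<in>A. f i v)" for f :: "'i \<Rightarrow> 'v \<Rightarrow> 'b::comm_monoid_add"
  by (induction A rule: infinite_finite_induct) auto

text \<open>Independence of the rows as a family: two equal rows at different vertices count as
  dependent.\<close>

definition B_rows_independent :: "'v ice_quiver \<Rightarrow> bool" where
  "B_rows_independent Q \<longleftrightarrow> (\<forall>c :: 'v \<Rightarrow> rat. (\<forall>v\<in>verts Q. (\<Sum>u\<in>mut Q. c u * of_int (B_entry Q u v)) = 0)
     \<longrightarrow> (\<forall>u\<in>mut Q. c u = 0))"

text \<open>A basis chosen among the rows has as many elements as there are mutable vertices. So the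
  rows are pairwise distinct and all of them belong to the basis.\<close>

lemma B_full_rank_imp_independent:
  fixes Q :: "'v ice_quiver"
  assumes Q: "ice_quiver Q" and "B_full_rank Q"
  shows "B_rows_independent Q"
  unfolding B_rows_independent_def
proof (intro allI impI ballI)
  fix c :: "'v \<Rightarrow> rat" and u
  assume c: "\<forall>v\<in>verts Q. (\<Sum>u\<in>mut Q. c u * of_int (B_entry Q u v)) = 0" and u: "u \<in> mut Q"
  have fin: "finite (mut Q)" using ice_quiverD(1,2)[OF Q] finite_subset by blast
  obtain B where B: "B \<subseteq> B_row Q ` mut Q" "rat_fun.independent B" "card B = card (mut Q)"
    using rat_fun.basis_exists[of "B_row Q ` mut Q"] assms(2) by (metis B_full_rank_def B_rank_def)
  have card: "card (B_row Q ` mut Q) = card (mut Q)"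
    using B(1,3) card_image_le[OF fin, of "B_row Q"] card_mono[OF finite_imageI[OF fin] B(1)] by simp
  then have inj: "inj_on (B_row Q) (mut Q)" using fin by (rule eq_card_imp_inj_on[rotated])
  have "B = B_row Q ` mut Q" using B(1,3) card fin by (intro card_subset_eq) auto
  then have ind: "rat_fun.independent (B_row Q ` mut Q)" using B by simp
  have "(\<Sum>f\<in>B_row Q ` mut Q. (\<lambda>v. c (inv_into (mut Q) (B_row Q) f) * f v)) = 0"
  proof
    fix v
    show "(\<Sum>f\<in>B_row Q ` mut Q. (\<lambda>v. c (inv_into (mut Q) (B_row Q) f) * f v)) v = 0 v"
    proof -
      have "(\<Sum>f\<in>B_row Q ` mut Q. c (inv_into (mut Q) (B_row Q) f) * f v) = (\<Sum>a\<in>mut Q. c a * B_row Q a v)"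
        using inj by (simp add: sum.reindex)
      also have "\<dots> = 0" using c by (cases "v \<in> verts Q") (simp_all add: B_row_def)
      finally show ?thesis by (simp add: sum_fun_apply)
    qed
  qed
  note eq = this
  show "c u = 0"
  proof (rule ccontr)
    assume "c u \<noteq> 0"
    then have "c (inv_into (mut Q) (B_row Q) (B_row Q u)) \<noteq> 0" using inj u by simp
    with eq u have "rat_fun.dependent (B_row Q ` mut Q)"
      unfolding rat_fun.dependent_finite[OF finite_imageI[OF fin], of "B_row Q"]
      by (intro exI[of _ "\<lambda>f. c (inv_into (mut Q) (B_row Q) f)"] conjI bexI[of _ "B_row Q u"]) simp_all
    then show False using ind by simp
  qed
qed

lemma B_rows_independent_mutate:
  fixes Q :: "'v ice_quiver"
  assumes Q: "ice_quiver Q" and ind: "B_rows_independent Q" and u: "u \<in> mut Q"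
  shows "B_rows_independent (mutate_quiver u Q)"
  unfolding B_rows_independent_def mutate_quiver_simps
proof (intro allI impI)
  fix c :: "'v \<Rightarrow> rat"
  let ?B = "\<lambda>a b. of_int (B_entry Q a b) :: rat" and ?B' = "\<lambda>a b. of_int (B_entry (mutate_quiver u Q) a b) :: rat"
  assume c: "\<forall>v\<in>verts Q. (\<Sum>a\<in>mut Q. c a * ?B' a v) = 0"
  have fin: "finite (mut Q)" and uV: "u \<in> verts Q" using ice_quiverD(1,2)[OF Q] finite_subset u by blast+
  have Bu: "B_entry Q u u = 0" by (simp add: B_entry_def)
  \<comment> \<open>Written in the old rows, the given combination of new rows has coefficient
    \<open>T - c u\<close> at row \<open>u\<close> and keeps the others. The column corrections drop
    out by the relation in column \<open>u\<close>.\<close>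
  define T where "T = (\<Sum>a\<in>mut Q - {u}. c a * of_nat (arr Q a u))"
  define c' where "c' = c(u := T - c u)"
  have split: "(\<Sum>a\<in>mut Q. f a) = f u + (\<Sum>a\<in>mut Q - {u}. f a)" for f :: "'v \<Rightarrow> rat"
    using fin u by (rule sum.remove)
  have "(\<Sum>a\<in>mut Q - {u}. c a * ?B' a u) = 0"
  proof -
    have "?B' u u = 0" by (simp add: B_entry_def)
    then show ?thesis using bspec[OF c uV] unfolding split by simp
  qed
  moreover have "(\<Sum>a\<in>mut Q - {u}. c a * ?B' a u) = - (\<Sum>a\<in>mut Q - {u}. c a * ?B a u)"
    unfolding sum_negf[symmetric] by (intro sum.cong) (auto simp: B_entry_mutate)
  ultimately have col_u: "(\<Sum>a\<in>mut Q - {u}. c a * ?B a u) = 0" by simp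
  have "(\<Sum>a\<in>mut Q. c' a * ?B a v) = 0" if v: "v \<in> verts Q" for v
  proof (cases "v = u")
    case True
    have "(\<Sum>a\<in>mut Q - {u}. c' a * ?B a u) = (\<Sum>a\<in>mut Q - {u}. c a * ?B a u)"
      by (intro sum.cong) (auto simp: c'_def)
    then show ?thesis unfolding split True using col_u Bu by simp
  next
    case False
    have "0 = c u * ?B' u v + (\<Sum>a\<in>mut Q - {u}. c a * ?B' a v)"
      using c v unfolding split by simp
    also have "(\<Sum>a\<in>mut Q - {u}. c a * ?B' a v) = (\<Sum>a\<in>mut Q - {u}.
        c a * ?B a v + (c a * of_nat (arr Q a u)) * ?B u v + of_nat (arr Q v u) * (c a * ?B a u))"
      using False by (intro sum.cong refl) (auto simp: B_entry_mutate algebra_simps)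
    also have "\<dots> = (\<Sum>a\<in>mut Q - {u}. c a * ?B a v) + T * ?B u v"
      using col_u by (simp add: sum.distrib T_def sum_distrib_right sum_distrib_left[symmetric])
    also have "c u * ?B' u v = - c u * ?B u v" using u by (simp add: B_entry_mutate)
    finally have "(T - c u) * ?B u v + (\<Sum>a\<in>mut Q - {u}. c a * ?B a v) = 0" by (simp add: algebra_simps)
    moreover have "(\<Sum>a\<in>mut Q - {u}. c' a * ?B a v) = (\<Sum>a\<in>mut Q - {u}. c a * ?B a v)"
      by (intro sum.cong) (auto simp: c'_def)
    ultimately show ?thesis unfolding split by (simp add: c'_def)
  qed
  then have c'0: "\<forall>a\<in>mut Q. c' a = 0" using ind unfolding B_rows_independent_def by blast
  then have c0: "c a = 0" if "a \<in> mut Q" "a \<noteq> u" for a using that by (auto simp: c'_def)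
  then have "T = 0" by (simp add: T_def)
  then have "c u = 0" using c'0 u by (auto simp: c'_def)
  then show "\<forall>a\<in>mut Q. c a = 0" using c0 by blast
qed

lemma B_row_nonzero:
  assumes "finite (mut Q)" "B_rows_independent Q" "u \<in> mut Q"
  obtains v where "v \<in> verts Q" "B_entry Q u v \<noteq> 0"
proof -
  have "\<exists>v\<in>verts Q. B_entry Q u v \<noteq> 0"
  proof (rule ccontr)
    assume *: "\<not> ?thesis"
    have "(\<Sum>a\<in>mut Q. (if a = u then 1 else 0) * of_int (B_entry Q a v)) = (0::rat)" if "v \<in> verts Q" for v
      using * that by (intro sum.neutral) auto
    then have "(if u = u then 1 else 0) = (0::rat)"
      using assms(2,3) unfolding B_rows_independent_def
      by (elim allE[of _ "\<lambda>a. if a = u then 1 else 0"]) auto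
    then show False by simp
  qed
  then show thesis using that by blast
qed

text \<open>Choose a column \<open>j\<close> in which row \<open>u1\<close> is nonzero. If all
  minors through \<open>j\<close> vanished, \<open>- B_entry Q u2 j\<close> and
  \<open>B_entry Q u1 j\<close> would be the coefficients of a relation between the two
  rows.\<close>

lemma B_minor_nonzero:
  assumes fin: "finite (mut Q)" and ind: "B_rows_independent Q" and u: "u1 \<in> mut Q" "u2 \<in> mut Q" "u1 \<noteq> u2"
  obtains i j where "i \<in> verts Q" "j \<in> verts Q" "B_entry Q u1 i * B_entry Q u2 j \<noteq> B_entry Q u1 j * B_entry Q u2 i"
proof -
  obtain j where j: "j \<in> verts Q" "B_entry Q u1 j \<noteq> 0" by (rule B_row_nonzero[OF fin ind u(1)])
  have "\<exists>i\<in>verts Q. B_entry Q u1 i * B_entry Q u2 j \<noteq> B_entry Q u1 j * B_entry Q u2 i"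
  proof (rule ccontr)
    assume "\<not> ?thesis"
    then have *: "B_entry Q u1 i * B_entry Q u2 j = B_entry Q u1 j * B_entry Q u2 i" if "i \<in> verts Q" for i
      using that by blast
    define c :: "'a \<Rightarrow> rat" where "c a = (if a = u1 then - of_int (B_entry Q u2 j) else 0) +
        (if a = u2 then of_int (B_entry Q u1 j) else 0)" for a
    have "(\<Sum>a\<in>mut Q. c a * of_int (B_entry Q a v)) = 0" if "v \<in> verts Q" for v
    proof -
      have "(\<Sum>a\<in>mut Q. c a * of_int (B_entry Q a v))
          = - of_int (B_entry Q u2 j) * of_int (B_entry Q u1 v) + of_int (B_entry Q u1 j) * of_int (B_entry Q u2 v)"
        using fin u by (simp add: c_def distrib_right sum.distrib if_distrib[of "\<lambda>t. t * _"] cong: if_cong)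
      also have "\<dots> = of_int (B_entry Q u1 j * B_entry Q u2 v - B_entry Q u1 v * B_entry Q u2 j)" by simp
      finally show ?thesis using *[OF that] by simp
    qed
    then have "c u2 = 0" using ind u(2) unfolding B_rows_independent_def by blast
    then show False using j(2) u(3) by (simp add: c_def)
  qed
  then show thesis using that j by blast
qed

section \<open>The upper bound and graded mutation\<close>

context subfield
begin

text \<open>A nonzero row makes the two monomials of the exchange polynomial different, so they
  cannot cancel, even in characteristic 2.\<close>

lemma exch_poly_nonzero:
  assumes s: "is_seed k (Q, x)" and ind: "B_rows_independent Q" and u: "u \<in> mut Q"
  shows "exch_poly Q x u \<noteq> 0"
proof
  interpret cluster_vars k "verts Q" x using s by (rule cluster_vars_seed)
  have Q: "ice_quiver Q" using s by (rule is_seedD)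
  have fin: "finite (mut Q)" using ice_quiverD(1,2)[OF Q] finite_subset by blast
  obtain v where "B_entry Q u v \<noteq> 0" by (rule B_row_nonzero[OF fin ind u])
  then have ne: "in_exp Q u \<noteq> out_exp Q u" by (auto simp: B_entry_eq)
  assume "exch_poly Q x u = 0"
  then have eq: "mon (in_exp Q u) = - mon (out_exp Q u)"
    by (simp add: exch_poly_def eq_neg_iff_add_eq_0)
  have "mon (in_exp Q u) \<in> sp {in_exp Q u}"
    using exp_on_verts[OF Q] by (intro span_mono_mem) auto
  moreover have "mon (in_exp Q u) \<in> sp {out_exp Q u}"
    unfolding eq using exp_on_verts[OF Q] by (intro span_minus span_mono_mem) auto
  ultimately have "mon (in_exp Q u) = 0"
    using span_disjoint ne by blast
  then show False using mono_nonzero by blast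
qed

text \<open>The grading needed to divide by the exchange polynomial at \<open>u1\<close>. If
  \<open>u1\<close> and \<open>u2\<close> are joined by arrows, the exponent at \<open>u2\<close>
  serves, with \<open>s0\<close> the term free of that variable. Otherwise both terms are free of it
  and a nonzero minor of rows \<open>u1\<close> and \<open>u2\<close> supplies the weights.\<close>

lemma separating_degree:
  fixes Q :: "'v ice_quiver"
  assumes Q: "ice_quiver Q" and ind: "B_rows_independent Q"
    and u: "u1 \<in> mut Q" "u2 \<in> mut Q" "u1 \<noteq> u2"
  obtains \<Lambda> s0 t0 where
    "(s0 = in_exp Q u1 \<and> t0 = out_exp Q u1) \<or> (s0 = out_exp Q u1 \<and> t0 = in_exp Q u1)" "s0 u2 = 0"
    "wdeg (*) (verts Q) \<Lambda> s0 < wdeg (*) (verts Q) \<Lambda> t0"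
    "wdeg (*) (verts Q) \<Lambda> (in_exp Q u2) = wdeg (*) (verts Q) \<Lambda> (out_exp Q u2)"
proof -
  have fin: "finite (verts Q)" "finite (mut Q)" using ice_quiverD(1,2)[OF Q] finite_subset by blast+
  have u2: "u2 \<in> verts Q" using u ice_quiverD(2)[OF Q] by blast
  define e2 :: "'v \<Rightarrow> int" where "e2 = (\<lambda>v. if v = u2 then 1 else 0)"
  have d: "wdeg (*) (verts Q) e2 a = a u2" for a
    unfolding e2_def by (rule wdeg_single[OF fin(1) u2])
  have loop: "in_exp Q u2 u2 = 0" "out_exp Q u2 u2 = 0"
    using ice_quiverD(5)[OF Q] by (simp_all add: in_exp_def out_exp_def)
  have pos: "in_exp Q u1 u2 \<ge> 0" "out_exp Q u1 u2 \<ge> 0" "in_exp Q u1 u2 = 0 \<or> out_exp Q u1 u2 = 0"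
    using ice_quiverD(6)[OF Q, of u1 u2] by (auto simp: in_exp_def out_exp_def)
  consider "in_exp Q u1 u2 = 0" "out_exp Q u1 u2 > 0" | "in_exp Q u1 u2 > 0" "out_exp Q u1 u2 = 0"
    | "in_exp Q u1 u2 = 0" "out_exp Q u1 u2 = 0" using pos by linarith
  then show thesis
  proof cases
    case 1
    then show thesis using that[of "in_exp Q u1" "out_exp Q u1" e2] d loop by simp
  next
    case 2
    then show thesis using that[of "out_exp Q u1" "in_exp Q u1" e2] d loop by simp
  next
    case 3
    obtain i j where ij: "i \<in> verts Q" "j \<in> verts Q"
      "B_entry Q u1 i * B_entry Q u2 j \<noteq> B_entry Q u1 j * B_entry Q u2 i"
      by (rule B_minor_nonzero[OF fin(2) ind u])
    \<comment> \<open>The coefficients of a nonzero minor: \<open>\<Lambda>\<close> kills the row of \<open>u2\<close> but not that of \<open>u1\<close>.\<close>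
    define \<Lambda> where "\<Lambda> v = (if v = i then B_entry Q u2 j else 0) + (if v = j then - B_entry Q u2 i else 0)" for v
    have \<Lambda>: "wdeg (*) (verts Q) \<Lambda> a = a i * B_entry Q u2 j - a j * B_entry Q u2 i" for a
      unfolding wdeg_def \<Lambda>_def using fin(1) ij(1,2)
      by (simp add: distrib_left sum.distrib if_distrib[of "\<lambda>t. _ * t"] cong: if_cong)
    have 2: "wdeg (*) (verts Q) \<Lambda> (in_exp Q u2) = wdeg (*) (verts Q) \<Lambda> (out_exp Q u2)"
      unfolding \<Lambda> B_entry_eq by (simp add: algebra_simps)
    have "wdeg (*) (verts Q) \<Lambda> (in_exp Q u1) \<noteq> wdeg (*) (verts Q) \<Lambda> (out_exp Q u1)"
      using ij(3) unfolding \<Lambda> B_entry_eq by (simp add: algebra_simps)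
    then consider "wdeg (*) (verts Q) \<Lambda> (in_exp Q u1) < wdeg (*) (verts Q) \<Lambda> (out_exp Q u1)"
      | "wdeg (*) (verts Q) \<Lambda> (out_exp Q u1) < wdeg (*) (verts Q) \<Lambda> (in_exp Q u1)" by linarith
    then show thesis
    proof cases
      case 1
      then show thesis using that[of "in_exp Q u1" "out_exp Q u1" \<Lambda>] 2 3 by simp
    next
      case 2
      then show thesis
        using that[of "out_exp Q u1" "in_exp Q u1" \<Lambda>] 3
          \<open>wdeg (*) (verts Q) \<Lambda> (in_exp Q u2) = wdeg (*) (verts Q) \<Lambda> (out_exp Q u2)\<close> by simp
    qed
  qed
qed

text \<open>The number \<open>b\<close> counts the arrows between \<open>u1\<close> and
  \<open>u2\<close>. Their direction decides which monomial is called \<open>p\<close>;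
  interchanging the two monomials of every exchange polynomial covers the opposite
  direction.\<close>

lemma seed_upper_bound:
  assumes s: "is_seed k (Q, x)" and ind: "B_rows_independent Q"
    and u: "u1 \<in> mut Q" "u2 \<in> mut Q" "u1 \<noteq> u2"
    and z: "z \<in> lspan k (verts Q) x UNIV" "z \<in> lspan k (verts Q) (snd (mutate_seed u1 (Q, x))) UNIV"
      "z \<in> lspan k (verts Q) (snd (mutate_seed u2 (mutate_seed u1 (Q, x)))) UNIV"
  shows "z \<in> lspan k (verts Q) (snd (mutate_seed u2 (Q, x))) UNIV"
proof -
  have Q: "ice_quiver Q" using s by (rule is_seedD)
  let ?Q1 = "mutate_quiver u1 Q" and ?x1 = "snd (mutate_seed u1 (Q, x))"
  have m1: "mutate_seed u1 (Q, x) = (?Q1, ?x1)" by (simp add: mutate_seed_eq)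
  have s1: "is_seed k (?Q1, ?x1)"
    using is_seed_mutate_iff[OF s u(1)] exch_poly_nonzero[OF s ind u(1)] m1 by simp
  have ind1: "B_rows_independent ?Q1" by (rule B_rows_independent_mutate[OF Q ind u(1)])
  note E1 = exchange_seed[OF s u(1) exch_poly_nonzero[OF s ind u(1)]]
  note E2 = exchange_seed[OF s u(2) exch_poly_nonzero[OF s ind u(2)]]
  have u2': "u2 \<in> mut ?Q1" using u by simp
  note E3 = exchange_seed[OF s1 u2' exch_poly_nonzero[OF s1 ind1 u2'], unfolded mutate_quiver_simps, folded m1]
  obtain \<Lambda> s0 t0 where st:
    "(s0 = in_exp Q u1 \<and> t0 = out_exp Q u1) \<or> (s0 = out_exp Q u1 \<and> t0 = in_exp Q u1)" "s0 u2 = 0"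
    and deg: "wdeg (*) (verts Q) \<Lambda> s0 < wdeg (*) (verts Q) \<Lambda> t0"
    "wdeg (*) (verts Q) \<Lambda> (in_exp Q u2) = wdeg (*) (verts Q) \<Lambda> (out_exp Q u2)"
    by (rule separating_degree[OF Q ind u])
  have nonneg: "in_exp Q v w \<ge> 0" "out_exp Q v w \<ge> 0" for v w by (simp_all add: in_exp_def out_exp_def)
  have swap: "arr ?Q1 u1 u2 = arr Q u2 u1" "arr ?Q1 u2 u1 = arr Q u1 u2"
    by (simp_all add: mutate_quiver_def)
  have B: "B_entry ?Q1 u2 v = B_entry Q u2 v + int (arr Q u2 u1) * B_entry Q u1 v
      + int (arr Q v u1) * B_entry Q u2 u1" if "v \<noteq> u1" for v
    using that u by (simp add: B_entry_mutate)
  consider "arr Q u1 u2 = 0" | "arr Q u2 u1 = 0" using ice_quiverD(6)[OF Q, of u1 u2] by auto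
  then show ?thesis
  proof cases
    case 1
    show ?thesis
    proof (rule exchange_upper_bound[OF E1 E2 E3 u(3), where b = "arr Q u2 u1" and ?s0.0 = s0 and ?t0.0 = t0 and \<Lambda> = \<Lambda>])
      fix v assume "v \<noteq> u1"
      from B[OF this] show "in_exp Q u2 v - in_exp ?Q1 u2 v
          = out_exp Q u2 v + int (arr Q u2 u1) * out_exp Q u1 v - out_exp ?Q1 u2 v"
        using 1 by (simp add: B_entry_def in_exp_def out_exp_def algebra_simps)
    qed (use 1 st deg z swap nonneg in \<open>simp_all add: in_exp_def out_exp_def\<close>)
  next
    case 2
    show ?thesis
    proof (rule exchange_upper_bound[OF exchange.exchange_swap[OF E1] exchange.exchange_swap[OF E2]
            exchange.exchange_swap[OF E3] u(3), where b = "arr Q u1 u2" and ?s0.0 = s0 and ?t0.0 = t0 and \<Lambda> = \<Lambda>])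
      fix v assume "v \<noteq> u1"
      from B[OF this] show "out_exp Q u2 v - out_exp ?Q1 u2 v
          = in_exp Q u2 v + int (arr Q u1 u2) * in_exp Q u1 v - in_exp ?Q1 u2 v"
        using 2 by (simp add: B_entry_def in_exp_def out_exp_def algebra_simps)
    next
      show "(s0 = out_exp Q u1 \<and> t0 = in_exp Q u1) \<or> (s0 = in_exp Q u1 \<and> t0 = out_exp Q u1)"
        using st by blast
    qed (use 2 st deg z swap nonneg in \<open>simp_all add: in_exp_def out_exp_def\<close>)
  qed
qed

text \<open>The property carried along a mutation path is being Laurent in a cluster and in all its
  neighbours. After a mutation at \<open>w\<close>, the neighbour at \<open>w\<close> is the
  previous cluster. Another neighbour, at \<open>u\<close>, is handled by the rank two step centred
  at the new cluster, whose remaining input is the neighbour of the previous cluster at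
  \<open>u\<close>.\<close>

lemma upper_bound_mutation_invariant:
  assumes s: "is_seed k (Q, x)" and ind: "B_rows_independent Q"
    and z: "z \<in> lspan k (verts Q) x UNIV"
      "\<And>u. u \<in> mut Q \<Longrightarrow> z \<in> lspan k (verts Q) (snd (mutate_seed u (Q, x))) UNIV"
    and t: "mutation_equivalent k (Q, x) t"
  shows "z \<in> lspan k (verts Q) (snd t) UNIV"
proof -
  have "is_seed k t \<and> B_rows_independent (fst t) \<and> verts (fst t) = verts Q \<and> mut (fst t) = mut Q \<and>
    z \<in> lspan k (verts Q) (snd t) UNIV \<and>
    (\<forall>u\<in>mut Q. z \<in> lspan k (verts Q) (snd (mutate_seed u t)) UNIV)"
    using t unfolding mutation_equivalent_def
  proof (induction rule: rtranclp_induct)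
    case base
    then show ?case using s ind z by simp
  next
    case (step t t')
    obtain R y where t_eq: "t = (R, y)" by (cases t)
    obtain w where w: "w \<in> mut R" "t' = mutate_seed w (R, y)" and s': "is_seed k t'"
      using step(2) by (auto simp: mutation_step_def t_eq)
    have R: "is_seed k (R, y)" "B_rows_independent R" "verts R = verts Q" "mut R = mut Q"
      and zR: "z \<in> lspan k (verts Q) y UNIV"
      "\<And>u. u \<in> mut Q \<Longrightarrow> z \<in> lspan k (verts Q) (snd (mutate_seed u (R, y))) UNIV"
      using step(3) by (auto simp: t_eq)
    obtain R' y' where t'_eq: "t' = (R', y')" by (cases t')
    have R': "R' = mutate_quiver w R" using w(2) t'_eq by (simp add: mutate_seed_eq)
    have ind': "B_rows_independent R'"
      unfolding R' by (rule B_rows_independent_mutate[OF is_seedD(1)[OF R(1)] R(2) w(1)])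
    have invol: "mutate_seed w t' = (R, y)"
      unfolding w(2) by (rule mutate_seed_mutate_seed[OF R(1) w(1) exch_poly_nonzero[OF R(1,2) w(1)]])
    have zt': "z \<in> lspan k (verts Q) y' UNIV"
      using zR(2)[of w] w(1) R(4) unfolding w(2)[symmetric] t'_eq by simp
    have "z \<in> lspan k (verts Q) (snd (mutate_seed u t')) UNIV" if u: "u \<in> mut Q" for u
    proof (cases "u = w")
      case True
      then show ?thesis using invol zR(1) by simp
    next
      case False
      have V: "verts R' = verts Q" "mut R' = mut Q" using R R' by simp_all
      show ?thesis
        using seed_upper_bound[of R' y' w u z] s' ind' u w(1) False zR zt' invol R(4)
        unfolding t'_eq V by auto
    qed
    then show ?case using s' ind' zt' R R' by (simp add: t'_eq)
  qed
  then show ?thesis by blast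
qed

end

text \<open>Weights travel with the mutation path. The set \<open>W\<close> of permitted directions
  is everything, everything but \<open>e\<close>, or everything but one frozen vertex; variables and
  weights outside \<open>W\<close> stay fixed along the path.\<close>

definition graded_step :: "'a::field set \<Rightarrow> 'v set \<Rightarrow> ('v, 'a) seed \<times> ('v \<Rightarrow> int^'n) \<Rightarrow>
    ('v, 'a) seed \<times> ('v \<Rightarrow> int^'n) \<Rightarrow> bool" where
  "graded_step k W = (\<lambda>(s, \<sigma>) (t, \<tau>). is_seed k s \<and> is_seed k t \<and>
     (\<exists>u\<in>mut (fst s) \<inter> W. t = mutate_seed u s \<and> \<tau> = mutate_weights u (fst s) \<sigma>))"

lemma graded_step_cases:
  assumes "graded_step k W (s, \<sigma>) (t, \<tau>)"
  obtains Q x u where "s = (Q, x)" "u \<in> mut Q" "u \<in> W" "t = mutate_seed u (Q, x)"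
    "\<tau> = mutate_weights u Q \<sigma>" "is_seed k (Q, x)" "is_seed k (mutate_seed u (Q, x))"
  using assms by (cases s) (auto simp: graded_step_def)

lemma graded_steps_invariant:
  assumes "(graded_step k W)\<^sup>*\<^sup>* (s, \<sigma>) (t, \<tau>)" and "is_seed k s" "weight_config (fst s) \<sigma>"
  shows "is_seed k t" "weight_config (fst t) \<tau>" "verts (fst t) = verts (fst s)"
    "mut (fst t) = mut (fst s)" "frozen (fst t) = frozen (fst s)" "mutation_equivalent k s t"
    "v \<notin> W \<Longrightarrow> snd t v = snd s v" "v \<notin> W \<Longrightarrow> \<tau> v = \<sigma> v"
proof -
  have "is_seed k t \<and> weight_config (fst t) \<tau> \<and> verts (fst t) = verts (fst s) \<and>
    mut (fst t) = mut (fst s) \<and> mutation_equivalent k s t \<and> (\<forall>v. v \<notin> W \<longrightarrow> snd t v = snd s v \<and> \<tau> v = \<sigma> v)"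
    using assms(1)
  proof (induction rule: rtranclp_induct2)
    case refl
    then show ?case using assms(2,3) by (simp add: mutation_equivalent_def)
  next
    case (step t \<tau> t' \<tau>')
    from step(2) show ?case
    proof (cases rule: graded_step_cases)
      case (1 Q x u)
      have "mutation_step k t t'" using 1 by (auto simp: mutation_step_def)
      moreover have "\<tau>' v = \<tau> v" if "v \<noteq> u" for v using that 1 by (simp add: mutate_weights_def)
      moreover have "weight_config (mutate_quiver u Q) \<tau>'"
        unfolding 1(5) using step(3) 1(1,2,6) by (intro weight_config_mutate is_seedD(1)) auto
      ultimately show ?thesis
        using 1(1-4,6,7) step(3) unfolding mutation_equivalent_def
        by (auto simp: mutate_seed_eq)
    qed
  qed
  then show "is_seed k t" "weight_config (fst t) \<tau>" "verts (fst t) = verts (fst s)"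
    "mut (fst t) = mut (fst s)" "frozen (fst t) = frozen (fst s)" "mutation_equivalent k s t"
    "v \<notin> W \<Longrightarrow> snd t v = snd s v" "v \<notin> W \<Longrightarrow> \<tau> v = \<sigma> v"
    by (auto simp: frozen_def)
qed

lemma graded_steps_exist:
  assumes "mutation_equivalent k s t" "mut (fst s) \<subseteq> W"
  shows "\<exists>\<tau>. (graded_step k W)\<^sup>*\<^sup>* (s, \<sigma>) (t, \<tau>)"
proof -
  have "mut (fst t) = mut (fst s) \<and> (\<exists>\<tau>. (graded_step k W)\<^sup>*\<^sup>* (s, \<sigma>) (t, \<tau>))"
    using assms(1) unfolding mutation_equivalent_def
  proof (induction rule: rtranclp_induct)
    case (step t t')
    obtain Q x where t: "t = (Q, x)" by (cases t)
    obtain u where u: "u \<in> mut Q" "t' = mutate_seed u (Q, x)" "is_seed k t" "is_seed k t'"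
      using step(2) by (auto simp: mutation_step_def t)
    obtain \<tau> where \<tau>: "(graded_step k W)\<^sup>*\<^sup>* (s, \<sigma>) (t, \<tau>)" using step by blast
    have "graded_step k W (t, \<tau>) (t', mutate_weights u Q \<tau>)"
      using u step(3) assms(2) by (auto simp: graded_step_def t)
    then show ?case
      using rtranclp.rtrancl_into_rtrancl[OF \<tau>] step(3) u by (auto simp: t mutate_seed_eq)
  qed auto
  then show ?thesis by blast
qed

context subfield
begin

lemma exchange_graded_step:
  assumes "u \<in> mut Q" "is_seed k (Q, x)" "is_seed k (mutate_seed u (Q, x))"
    and "verts Q = V"
  shows "exchange k V x (snd (mutate_seed u (Q, x))) u (in_exp Q u) (out_exp Q u) (exch_poly Q x u)"
  using exchange_step[OF assms(2,3,1)] assms(4) by simp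

text \<open>Only the sum is assumed to be Laurent everywhere; the exchange step transports one
  summand at a time. Stating both conclusions, for \<open>D\<close> and its complement, provides the
  hypotheses of the next step.\<close>

lemma graded_steps_split:
  fixes \<sigma> :: "'v \<Rightarrow> int^'n"
  assumes t: "(graded_step k W)\<^sup>*\<^sup>* ((Q, x), \<sigma>) (t, \<tau>)"
    and s: "is_seed k (Q, x)" "weight_config Q \<sigma>"
    and z: "\<And>t. mutation_equivalent k (Q, x) t \<Longrightarrow> z1 + z2 \<in> lspan k (verts Q) (snd t) UNIV"
    and z1: "z1 \<in> lspan k (verts Q) x {a. wdeg (*s) (verts Q) \<sigma> a \<in> D}"
    and z2: "z2 \<in> lspan k (verts Q) x {a. wdeg (*s) (verts Q) \<sigma> a \<notin> D}"
  shows "z1 \<in> lspan k (verts Q) (snd t) {a. wdeg (*s) (verts Q) \<tau> a \<in> D} \<and>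
    z2 \<in> lspan k (verts Q) (snd t) {a. wdeg (*s) (verts Q) \<tau> a \<notin> D}"
  using t
proof (induction rule: rtranclp_induct2)
  case refl
  then show ?case using z1 z2 by simp
next
  case (step t \<tau> t' \<tau>')
  note inv = graded_steps_invariant[OF step(1), unfolded fst_conv, OF s]
  have "(graded_step k W)\<^sup>*\<^sup>* ((Q, x), \<sigma>) (t', \<tau>')" using step(1,2) by simp
  note inv' = graded_steps_invariant[OF this, unfolded fst_conv, OF s]
  from step(2) show ?case
  proof (cases rule: graded_step_cases)
    case (1 R y u)
    have V: "verts R = verts Q" using inv(3) 1 by simp
    note ex = exchange_graded_step[OF 1(2,6,7) V]
    have \<tau>': "\<tau>' = \<tau>(u := wdeg (*s) (verts Q) \<tau> (in_exp R u) - \<tau> u)"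
      using 1 V by (simp add: mutate_weights_def)
    have pq: "wdeg (*s) (verts Q) \<tau> (in_exp R u) = wdeg (*s) (verts Q) \<tau> (out_exp R u)"
      using weight_configD[OF inv(2), of u] 1 V by simp
    have zt: "z1 + z2 \<in> lspan k (verts Q) (snd t') UNIV" using z inv'(6) by blast
    have "z1 \<in> lspan k (verts Q) (snd t') {a. wdeg (*s) (verts Q) \<tau>' a \<in> D}"
      unfolding \<tau>' using exchange.exchange_grading[OF ex module_vec pq, of z1 z2 D] zt step(3) 1(1,4) by simp
    moreover have "z2 \<in> lspan k (verts Q) (snd t') {a. wdeg (*s) (verts Q) \<tau>' a \<notin> D}"
      unfolding \<tau>' using exchange.exchange_grading[OF ex module_vec pq, of z2 z1 "- D"] zt step(3) 1(1,4)
      by (simp add: add.commute)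
    ultimately show ?thesis by blast
  qed
qed

text \<open>Since \<open>f\<close> is never mutated, its order passes through each exchange. Being
  Laurent is demanded only along permitted paths, which suits elements not yet known to be Laurent
  elsewhere.\<close>

lemma graded_steps_nonneg:
  fixes \<sigma> :: "'v \<Rightarrow> int^'n"
  assumes t: "(graded_step k W)\<^sup>*\<^sup>* ((Q, x), \<sigma>) (t, \<tau>)"
    and s: "is_seed k (Q, x)" "weight_config Q \<sigma>" and f: "f \<notin> W"
    and z: "\<And>t \<tau>. (graded_step k W)\<^sup>*\<^sup>* ((Q, x), \<sigma>) (t, \<tau>) \<Longrightarrow> z \<in> lspan k (verts Q) (snd t) UNIV"
    and z1: "z \<in> lspan k (verts Q) x {a. a f \<ge> 0}"
  shows "z \<in> lspan k (verts Q) (snd t) {a. a f \<ge> 0}"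
  using t
proof (induction rule: rtranclp_induct2)
  case refl
  then show ?case using z1 by simp
next
  case (step t \<tau> t' \<tau>')
  note inv = graded_steps_invariant[OF step(1), unfolded fst_conv, OF s]
  have t': "(graded_step k W)\<^sup>*\<^sup>* ((Q, x), \<sigma>) (t', \<tau>')" using step(1,2) by simp
  from step(2) show ?case
  proof (cases rule: graded_step_cases)
    case (1 R y u)
    have V: "verts R = verts Q" using inv(3) 1 by simp
    note ex = exchange_graded_step[OF 1(2,6,7) V]
    have "in_exp R u f = 0 \<or> out_exp R u f = 0"
      using ice_quiverD(6)[OF is_seedD(1)[OF 1(6)], of u f] by (auto simp: in_exp_def out_exp_def)
    then show ?thesis
      using exchange.exchange_nonneg[OF ex, of f z] z[OF t'] step(3) 1 f
      by (auto simp: in_exp_def out_exp_def)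
  qed
qed

end

lemma (in cluster_vars) span_nonneg:
  assumes "finite F" "z \<in> sp A" "\<And>f. f \<in> F \<Longrightarrow> z \<in> sp {a. a f \<ge> 0}"
  shows "z \<in> sp (A \<inter> {a. \<forall>f\<in>F. a f \<ge> 0})"
  using assms
proof (induction F rule: finite_induct)
  case (insert f F)
  have "z \<in> sp (A \<inter> {a. \<forall>f\<in>F. a f \<ge> 0})" using insert by auto
  moreover have "z \<in> sp {a. a f \<ge> 0}" using insert by auto
  ultimately have "z \<in> sp ((A \<inter> {a. \<forall>f\<in>F. a f \<ge> 0}) \<inter> {a. a f \<ge> 0})" by (rule span_Int)
  then show ?case by (rule lspan_subset) auto
qed simp

section \<open>Projection along a real vertex\<close>

locale real_vertex = subfield k for k :: "'a::field set" +
  fixes form :: "int^'n \<Rightarrow> int^'n \<Rightarrow> int" and e :: 'v and \<epsilon> :: "int^'n"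
  assumes bilinear: "bilinear_form form" and real: "form \<epsilon> \<epsilon> = 1"
begin

lemma form_add: "form \<epsilon> (a + b) = form \<epsilon> a + form \<epsilon> b"
  using bilinear by (simp add: bilinear_form_def)

lemma form_zero: "form \<epsilon> 0 = 0"
  using form_add[of 0 0] by simp

lemma form_minus: "form \<epsilon> (- a) = - form \<epsilon> a"
  using form_add[of a "- a"] form_zero by simp

lemma form_diff: "form \<epsilon> (a - b) = form \<epsilon> a - form \<epsilon> b"
  using form_add[of a "- b"] form_minus[of b] by simp

lemma form_scale: "form \<epsilon> (c *s a) = c * form \<epsilon> a"
proof (induction c rule: int_induct[where k = 0])
  case base
  then show ?case by (simp add: form_zero)
next
  case (step1 i)
  have eq: "(i + 1) *s a = i *s a + a" by (simp add: vec_eq_iff algebra_simps)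
  show ?case using step1 unfolding eq form_add by (simp add: algebra_simps)
next
  case (step2 i)
  have eq: "(i - 1) *s a = i *s a - a" by (simp add: vec_eq_iff algebra_simps)
  show ?case using step2 unfolding eq form_diff by (simp add: algebra_simps)
qed

lemma form_sum: "form \<epsilon> (sum g I) = (\<Sum>i\<in>I. form \<epsilon> (g i))"
  by (induction I rule: infinite_finite_induct) (auto simp: form_zero form_add)

text \<open>By reality \<open>x e\<close> has height 1, so changing the exponent at \<open>e\<close>
  brings any exponent vector to height 0 in exactly one way.\<close>

definition height :: "'v set \<Rightarrow> ('v \<Rightarrow> int^'n) \<Rightarrow> ('v \<Rightarrow> int) \<Rightarrow> int" where
  "height V \<sigma> a = form \<epsilon> (wdeg (*s) V \<sigma> a)"

lemma height_eq: "height V \<sigma> a = (\<Sum>v\<in>V. a v * form \<epsilon> (\<sigma> v))"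
  by (simp add: height_def wdeg_def form_sum form_scale)

lemma height_remove:
  "finite V \<Longrightarrow> e \<in> V \<Longrightarrow> \<sigma> e = \<epsilon> \<Longrightarrow> height V \<sigma> a = a e + (\<Sum>v\<in>V - {e}. a v * form \<epsilon> (\<sigma> v))"
  unfolding height_eq by (simp add: sum.remove real)

lemma height_upd:
  assumes "finite V" "e \<in> V" "\<sigma> e = \<epsilon>"
  shows "height V \<sigma> (a(e := c)) = height V \<sigma> a - a e + c"
proof -
  have "(\<Sum>v\<in>V - {e}. (a(e := c)) v * form \<epsilon> (\<sigma> v)) = (\<Sum>v\<in>V - {e}. a v * form \<epsilon> (\<sigma> v))"
    by (intro sum.cong) auto
  then show ?thesis using height_remove[where V = V and \<sigma> = \<sigma>, OF assms] by simp
qed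

lemma laurent_monom_proj:
  assumes V: "finite V" "e \<in> V" and \<sigma>: "\<sigma> e = \<epsilon>" and x: "\<And>v. v \<in> V \<Longrightarrow> x v \<noteq> (0::'a)"
  shows "laurent_monom (V - {e}) (proj_vars form e \<sigma> x) r = x e powi (- height V \<sigma> r) * laurent_monom V x r"
proof -
  have sum_powi: "(\<Prod>v\<in>S. x e powi g v) = x e powi (\<Sum>v\<in>S. g v)" for S and g :: "'v \<Rightarrow> int"
    using x[OF V(2)] by (induction S rule: infinite_finite_induct) (auto simp: power_int_add)
  have "laurent_monom (V - {e}) (proj_vars form e \<sigma> x) r
      = (\<Prod>v\<in>V - {e}. x e powi (- (r v * form \<epsilon> (\<sigma> v))) * x v powi r v)"
    unfolding laurent_monom_def proj_vars_def \<sigma>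
    by (intro prod.cong refl) (simp add: power_int_mult_distrib power_int_mult[symmetric] mult.commute)
  also have "\<dots> = x e powi (- (\<Sum>v\<in>V - {e}. r v * form \<epsilon> (\<sigma> v))) * (\<Prod>v\<in>V - {e}. x v powi r v)"
    by (simp add: prod.distrib sum_powi sum_negf)
  also have "(\<Sum>v\<in>V - {e}. r v * form \<epsilon> (\<sigma> v)) = height V \<sigma> r - r e"
    using height_remove[where \<sigma> = \<sigma>, OF V \<sigma>] by simp
  also have "x e powi (- (height V \<sigma> r - r e)) = x e powi (- height V \<sigma> r) * x e powi r e"
    using x[OF V(2)] by (simp flip: power_int_add)
  also have "x e powi (- height V \<sigma> r) * x e powi r e * (\<Prod>v\<in>V - {e}. x v powi r v)
      = x e powi (- height V \<sigma> r) * laurent_monom V x r"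
    unfolding laurent_monom_def using V by (simp add: prod.remove[of V e] mult.assoc)
  finally show ?thesis .
qed

text \<open>Exponents of the projected cluster correspond to exponents of height 0 on
  \<open>V\<close>: the entry at \<open>e\<close> is set to minus the height in one direction and
  erased in the other, and the monomials agree.\<close>

lemma lspan_proj:
  assumes "cluster_vars k V x" and e: "e \<in> V" and \<sigma>: "\<sigma> e = \<epsilon>"
  shows "lspan k (V - {e}) (proj_vars form e \<sigma> x) A
    = lspan k V x {b. height V \<sigma> b = 0 \<and> b(e := 0) \<in> A}"
proof -
  interpret cluster_vars k V x by fact
  let ?mon' = "laurent_monom (V - {e}) (proj_vars form e \<sigma> x)"
  have mon': "?mon' (b(e := 0)) = mon b" if "height V \<sigma> b = 0" for b
  proof -
    have "?mon' (b(e := 0)) = ?mon' b" by (intro laurent_monom_cong) auto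
    then show ?thesis using laurent_monom_proj[where \<sigma> = \<sigma> and r = b, OF finite_V e \<sigma> var_nonzero] that by simp
  qed
  have "?mon' ` (A \<inter> exps_on (V - {e})) = mon ` ({b. height V \<sigma> b = 0 \<and> b(e := 0) \<in> A} \<inter> exps_on V)"
  proof safe
    fix a assume a: "a \<in> A" "a \<in> exps_on (V - {e})"
    let ?b = "a(e := - height V \<sigma> a)"
    have ae: "a e = 0" using a(2) by (auto simp: exps_on_def)
    then have b: "?b(e := 0) = a" by auto
    have h: "height V \<sigma> ?b = 0" using height_upd[where \<sigma> = \<sigma>, OF finite_V e \<sigma>] ae by simp
    have "?b \<in> exps_on V" using a(2) e by (auto simp: exps_on_def)
    moreover have "?mon' a = mon ?b" using mon'[OF h] b by simp
    ultimately show "?mon' a \<in> mon ` ({b. height V \<sigma> b = 0 \<and> b(e := 0) \<in> A} \<inter> exps_on V)"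
      using h a(1) b by (intro image_eqI[of _ _ ?b]) auto
  next
    fix b assume b: "height V \<sigma> b = 0" "b(e := 0) \<in> A" "b \<in> exps_on V"
    then have "b(e := 0) \<in> exps_on (V - {e})" by (auto simp: exps_on_def)
    then show "mon b \<in> ?mon' ` (A \<inter> exps_on (V - {e}))"
      using mon'[OF b(1)] b(2) by (intro image_eqI[of _ _ "b(e := 0)"]) auto
  qed
  then show ?thesis by (simp add: lspan_def)
qed

section \<open>Projected seeds, their mutations and their gradings\<close>

lemma proj_seed_eq: "proj_seed form e \<sigma> (Q, x) = (delete_vertex e Q, proj_vars form e \<sigma> x)"
  by (simp add: proj_seed_def)

lemma delete_vertex_simps:
  "verts (delete_vertex e Q) = verts Q - {e}" "mut (delete_vertex e Q) = mut Q - {e}"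
  "frozen (delete_vertex e Q) = frozen Q - {e}"
  by (auto simp: delete_vertex_def frozen_def)

lemma ice_quiver_delete_vertex: "ice_quiver Q \<Longrightarrow> ice_quiver (delete_vertex e Q)"
  unfolding ice_quiver_def delete_vertex_def by auto

lemma is_seed_proj:
  assumes s: "is_seed k (Q, x)" and e: "e \<in> verts Q" and \<sigma>: "\<sigma> e = \<epsilon>"
  shows "is_seed k (proj_seed form e \<sigma> (Q, x))"
proof -
  let ?V = "verts Q"
  interpret cluster_vars k ?V x using s by (rule cluster_vars_seed)
  let ?x = "proj_vars form e \<sigma> x"
  let ?mon' = "laurent_monom (?V - {e}) ?x"
  \<comment> \<open>The height 0 lift of an exponent vector. It is injective because erasing the
    entry at \<open>e\<close> inverts it, so a relation among projected monomials becomes one in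
    \<open>x\<close>.\<close>
  define r where "r a = a(e := - height ?V \<sigma> a)" for a
  have r: "?mon' a = mon (r a)" "r a \<in> exps_on ?V" "(r a)(e := 0) = a" if "a \<in> exps_on (?V - {e})" for a
  proof -
    have ae: "a e = 0" using that by (auto simp: exps_on_def)
    have "?mon' a = ?mon' (r a)" by (intro laurent_monom_cong) (auto simp: r_def)
    also have "height ?V \<sigma> (r a) = 0" unfolding r_def using height_upd[where \<sigma> = \<sigma>, OF finite_V e \<sigma>] ae by simp
    then have "?mon' (r a) = mon (r a)"
      using laurent_monom_proj[where \<sigma> = \<sigma> and r = "r a", OF finite_V e \<sigma> var_nonzero] by simp
    finally show "?mon' a = mon (r a)" .
    show "r a \<in> exps_on ?V" using that e by (auto simp: exps_on_def r_def)
    show "(r a)(e := 0) = a" using ae by (auto simp: r_def)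
  qed
  have "laurent_independent k (?V - {e}) ?x"
    unfolding laurent_independent_def
  proof (intro allI impI ballI)
    fix F c b assume *: "finite F \<and> F \<subseteq> exps_on (?V - {e}) \<and> c ` F \<subseteq> k \<and> (\<Sum>a\<in>F. c a * ?mon' a) = 0"
      and b: "b \<in> F"
    have inj: "inj_on r F"
      using r(3) * by (intro inj_on_inverseI[where g = "\<lambda>a. a(e := 0)"]) auto
    have "(\<Sum>a\<in>r ` F. c (inv_into F r a) * mon a) = (\<Sum>a\<in>F. c a * mon (r a))"
      using inj by (simp add: sum.reindex)
    also have "\<dots> = (\<Sum>a\<in>F. c a * ?mon' a)"
      using r(1) * by (intro sum.cong refl) auto
    finally have "(\<Sum>a\<in>r ` F. c (inv_into F r a) * mon a) = 0" using * by simp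
    then have "c (inv_into F r (r b)) = 0"
      using * b inj r(2)
      by (intro laurent_independentD[OF indep, of "r ` F" "\<lambda>a. c (inv_into F r a)"]) auto
    then show "c b = 0" using inj b by simp
  qed
  then have "alg_independent k (?V - {e}) ?x"
    using laurent_independent_iff[of "?V - {e}"] finite_V by simp
  then show ?thesis
    using ice_quiver_delete_vertex[OF is_seedD(1)[OF s]]
    by (simp add: is_seed_def proj_seed_eq delete_vertex_simps)
qed

text \<open>The weight condition at \<open>u\<close> gives both terms the same height, so they are
  rescaled by one common power of \<open>x e\<close>. Without this, projection would not respect
  exchange relations.\<close>

lemma exch_poly_proj:
  assumes s: "is_seed k (Q, x)" and w: "weight_config Q \<sigma>" and e: "e \<in> verts Q" and \<sigma>: "\<sigma> e = \<epsilon>"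
    and u: "u \<in> mut Q" "u \<noteq> e"
  shows "exch_poly (delete_vertex e Q) (proj_vars form e \<sigma> x) u
    = x e powi (- height (verts Q) \<sigma> (in_exp Q u)) * exch_poly Q x u"
proof -
  let ?V = "verts Q"
  interpret cluster_vars k ?V x using s by (rule cluster_vars_seed)
  have "laurent_monom (?V - {e}) (proj_vars form e \<sigma> x) (in_exp (delete_vertex e Q) u)
      = laurent_monom (?V - {e}) (proj_vars form e \<sigma> x) (in_exp Q u)"
    "laurent_monom (?V - {e}) (proj_vars form e \<sigma> x) (out_exp (delete_vertex e Q) u)
      = laurent_monom (?V - {e}) (proj_vars form e \<sigma> x) (out_exp Q u)"
    using u(2) by (auto simp: in_exp_def out_exp_def delete_vertex_def intro!: laurent_monom_cong split: if_splits)
  moreover have "height ?V \<sigma> (in_exp Q u) = height ?V \<sigma> (out_exp Q u)"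
    using weight_configD[OF w u(1)] by (simp add: height_def)
  ultimately show ?thesis
    by (simp add: exch_poly_def delete_vertex_simps laurent_monom_proj[where \<sigma> = \<sigma>, OF finite_V e \<sigma> var_nonzero]
        distrib_left)
qed

text \<open>The exchange polynomial and the old variable are each rescaled by \<open>x e\<close> to
  minus their heights. The quotient of these factors is the one prescribed by the mutated weight at
  \<open>u\<close>.\<close>

lemma mutate_seed_proj:
  assumes s: "is_seed k (Q, x)" and w: "weight_config Q \<sigma>" and e: "e \<in> verts Q" and \<sigma>: "\<sigma> e = \<epsilon>"
    and u: "u \<in> mut Q" "u \<noteq> e"
  shows "mutate_seed u (proj_seed form e \<sigma> (Q, x))
    = proj_seed form e (mutate_weights u Q \<sigma>) (mutate_seed u (Q, x))"
proof -
  let ?V = "verts Q"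
  interpret cluster_vars k ?V x using s by (rule cluster_vars_seed)
  let ?\<tau> = "mutate_weights u Q \<sigma>" and ?\<delta> = "wdeg (*s) (verts Q) \<sigma> (in_exp Q u)"
  have quiver: "mutate_quiver u (delete_vertex e Q) = delete_vertex e (mutate_quiver u Q)"
  proof (rule ice_quiver.equality)
    show "arr (mutate_quiver u (delete_vertex e Q)) = arr (delete_vertex e (mutate_quiver u Q))"
    proof (intro ext)
      fix v w
      show "arr (mutate_quiver u (delete_vertex e Q)) v w = arr (delete_vertex e (mutate_quiver u Q)) v w"
        using u(2) u(2)[symmetric]
        by (cases "v = e"; cases "w = e"; cases "v = u"; cases "w = u")
          (simp_all add: mutate_quiver_def delete_vertex_def)
    qed
  qed (simp_all add: delete_vertex_simps)
  have \<tau>e: "?\<tau> e = \<epsilon>" and \<tau>u: "?\<tau> u = ?\<delta> - \<sigma> u" and \<tau>: "v \<noteq> u \<Longrightarrow> ?\<tau> v = \<sigma> v" for v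
    using u \<sigma> by (auto simp: mutate_weights_def)
  have "exch_poly (delete_vertex e Q) (proj_vars form e \<sigma> x) u / proj_vars form e \<sigma> x u
      = x e powi (- form \<epsilon> (?\<delta> - \<sigma> u)) * (exch_poly Q x u / x u)"
  proof -
    have "x e powi (- form \<epsilon> (?\<delta> - \<sigma> u)) = x e powi (- form \<epsilon> ?\<delta>) / x e powi (- form \<epsilon> (\<sigma> u))"
      using var_nonzero[OF e] by (simp add: form_diff flip: power_int_diff)
    then show ?thesis
      unfolding exch_poly_proj[OF s w e \<sigma> u] proj_vars_def \<sigma> height_def by simp
  qed
  then have "(proj_vars form e \<sigma> x)(u := exch_poly (delete_vertex e Q) (proj_vars form e \<sigma> x) u / proj_vars form e \<sigma> x u)
      = proj_vars form e ?\<tau> (x(u := exch_poly Q x u / x u))"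
    using u(2) \<tau> \<tau>u \<tau>e \<sigma> by (auto simp: proj_vars_def fun_eq_iff)
  then show ?thesis
    by (simp add: proj_seed_eq mutate_seed_eq quiver)
qed

lemma mutation_step_proj:
  assumes step: "graded_step k (- {e}) (s, \<sigma>) (t, \<tau>)" and w: "weight_config (fst s) \<sigma>"
    and e: "e \<in> verts (fst s)" and \<sigma>: "\<sigma> e = \<epsilon>"
  shows "mutation_step k (proj_seed form e \<sigma> s) (proj_seed form e \<tau> t)"
  using step
proof (cases rule: graded_step_cases)
  case (1 Q x u)
  have \<tau>e: "\<tau> e = \<epsilon>" using 1 \<sigma> by (auto simp: mutate_weights_def)
  have "is_seed k (proj_seed form e \<sigma> s)" using is_seed_proj 1 e \<sigma> by simp
  moreover have "is_seed k (proj_seed form e \<tau> t)"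
    using is_seed_proj[of "mutate_quiver u Q" _ \<tau>] \<tau>e 1 e by (simp add: mutate_seed_eq)
  moreover have "proj_seed form e \<tau> t = mutate_seed u (proj_seed form e \<sigma> s)"
    using mutate_seed_proj[of Q x \<sigma> u] 1 w e \<sigma> by simp
  moreover have "u \<in> mut (fst (proj_seed form e \<sigma> s))"
    using 1 by (simp add: proj_seed_eq delete_vertex_simps)
  ultimately show ?thesis unfolding mutation_step_def by blast
qed

lemma graded_steps_proj:
  assumes t: "(graded_step k (- {e}))\<^sup>*\<^sup>* (s, \<sigma>) (t, \<tau>)" and s: "is_seed k s" "weight_config (fst s) \<sigma>"
    and e: "e \<in> verts (fst s)" and \<sigma>: "\<sigma> e = \<epsilon>"
  shows "mutation_equivalent k (proj_seed form e \<sigma> s) (proj_seed form e \<tau> t)"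
  using t
proof (induction rule: rtranclp_induct2)
  case refl
  then show ?case by (simp add: mutation_equivalent_def)
next
  case (step t \<tau> t' \<tau>')
  note inv = graded_steps_invariant[OF step(1) s]
  have "mutation_step k (proj_seed form e \<tau> t) (proj_seed form e \<tau>' t')"
    using mutation_step_proj[OF step(2)] inv e \<sigma> by simp
  then show ?case using step(3) unfolding mutation_equivalent_def by simp
qed

text \<open>A permitted mutation of the projected seed lifts to a permitted one: the two exchange
  polynomials differ by a power of \<open>x e\<close>, so neither can vanish alone.\<close>

lemma mutation_proj_lift:
  assumes t: "mutation_equivalent k (proj_seed form e \<sigma> s) t'" and s: "is_seed k s" "weight_config (fst s) \<sigma>"
    and e: "e \<in> verts (fst s)" and \<sigma>: "\<sigma> e = \<epsilon>"
  shows "\<exists>t \<tau>. (graded_step k (- {e}))\<^sup>*\<^sup>* (s, \<sigma>) (t, \<tau>) \<and> t' = proj_seed form e \<tau> t"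
  using t unfolding mutation_equivalent_def
proof (induction rule: rtranclp_induct)
  case base
  then show ?case by blast
next
  case (step t1 t2)
  then obtain t \<tau> where t: "(graded_step k (- {e}))\<^sup>*\<^sup>* (s, \<sigma>) (t, \<tau>)" "t1 = proj_seed form e \<tau> t" by blast
  note inv = graded_steps_invariant[OF t(1) s]
  obtain Q x where Q: "t = (Q, x)" by (cases t)
  have Qs: "is_seed k (Q, x)" "weight_config Q \<tau>" "e \<in> verts Q" "\<tau> e = \<epsilon>"
    using inv e \<sigma> by (simp_all add: Q)
  obtain u where u: "u \<in> mut Q" "u \<noteq> e" and t2: "t2 = mutate_seed u t1" "is_seed k t1" "is_seed k t2"
    using step(2) by (auto simp: mutation_step_def t(2) Q proj_seed_eq delete_vertex_simps)
  have "exch_poly (delete_vertex e Q) (proj_vars form e \<tau> x) u \<noteq> 0"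
    using is_seed_mutate_iff[of "delete_vertex e Q" "proj_vars form e \<tau> x" u] t2 u t(2)
    by (simp add: Q proj_seed_eq delete_vertex_simps)
  then have "exch_poly Q x u \<noteq> 0" using exch_poly_proj[OF Qs u] by auto
  then have "is_seed k (mutate_seed u (Q, x))" using is_seed_mutate_iff[OF Qs(1) u(1)] by simp
  then have "graded_step k (- {e}) (t, \<tau>) (mutate_seed u (Q, x), mutate_weights u Q \<tau>)"
    using Qs u by (auto simp: graded_step_def Q)
  then have "(graded_step k (- {e}))\<^sup>*\<^sup>* (s, \<sigma>) (mutate_seed u (Q, x), mutate_weights u Q \<tau>)"
    using t(1) by simp
  moreover have "t2 = proj_seed form e (mutate_weights u Q \<tau>) (mutate_seed u (Q, x))"
    using mutate_seed_proj[OF Qs u] t2 t(2) Q by simp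
  ultimately show ?case by blast
qed

lemma laurent_ring_proj:
  assumes s: "is_seed k (Q, x)" and e: "e \<in> verts Q" and \<sigma>: "\<sigma> e = \<epsilon>"
  shows "laurent_ring k (proj_seed form e \<sigma> (Q, x))
    = lspan k (verts Q) x {b. height (verts Q) \<sigma> b = 0 \<and> (\<forall>v\<in>frozen Q - {e}. b v \<ge> 0)}"
proof -
  have "{b. height (verts Q) \<sigma> b = 0 \<and> b(e := 0) \<in> {a. \<forall>v\<in>frozen Q - {e}. a v \<ge> 0}}
      = {b. height (verts Q) \<sigma> b = 0 \<and> (\<forall>v\<in>frozen Q - {e}. b v \<ge> 0)}" by auto
  then show ?thesis
    using lspan_proj[where \<sigma> = \<sigma> and A = "{a. \<forall>v\<in>frozen Q - {e}. a v \<ge> 0}", OF cluster_vars_seed[OF s] e \<sigma>]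
    by (simp add: proj_seed_eq laurent_ring_eq delete_vertex_simps)
qed

text \<open>Projecting the weights subtracts a multiple of \<epsilon> equal to the height
  contributed by the vertices other than \<open>e\<close>. At height 0 this restores precisely the
  erased term of \<open>e\<close>.\<close>

lemma wdeg_proj_weights:
  assumes V: "finite V" "e \<in> V" and \<sigma>: "\<sigma> e = \<epsilon>" and h: "height V \<sigma> b = 0"
  shows "wdeg (*s) (V - {e}) (proj_weights form e \<sigma>) (b(e := 0)) = wdeg (*s) V \<sigma> b"
proof -
  interpret module "(*s) :: int \<Rightarrow> int^'n \<Rightarrow> int^'n" by (rule module_vec)
  have "wdeg (*s) (V - {e}) (proj_weights form e \<sigma>) (b(e := 0))
      = (\<Sum>v\<in>V - {e}. b v *s \<sigma> v - (b v * form \<epsilon> (\<sigma> v)) *s \<epsilon>)"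
    unfolding wdeg_def proj_weights_def \<sigma>
    by (intro sum.cong refl) (auto simp: scale_right_diff_distrib)
  also have "\<dots> = (\<Sum>v\<in>V - {e}. b v *s \<sigma> v) - (\<Sum>v\<in>V - {e}. b v * form \<epsilon> (\<sigma> v)) *s \<epsilon>"
    by (simp add: sum_subtractf scale_sum_left)
  also have "(\<Sum>v\<in>V - {e}. b v * form \<epsilon> (\<sigma> v)) = - b e"
    using height_remove[where \<sigma> = \<sigma> and a = b, OF V \<sigma>] h by simp
  also have "(\<Sum>v\<in>V - {e}. b v *s \<sigma> v) - (- b e) *s \<epsilon> = wdeg (*s) V \<sigma> b"
    unfolding wdeg_def using V \<sigma> by (simp add: sum.remove[of V e] add.commute)
  finally show ?thesis .
qed

lemma graded_part_proj:
  assumes s: "is_seed k (Q, x)" and e: "e \<in> verts Q" and \<sigma>: "\<sigma> e = \<epsilon>"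
  shows "graded_part k (proj_seed form e \<sigma> (Q, x)) (proj_weights form e \<sigma>) A \<alpha>
    = A \<inter> lspan k (verts Q) x {b. height (verts Q) \<sigma> b = 0 \<and> wdeg (*s) (verts Q) \<sigma> b = \<alpha>}"
proof -
  have fin: "finite (verts Q)" by (rule ice_quiverD(1)[OF is_seedD(1)[OF s]])
  have "{b. height (verts Q) \<sigma> b = 0 \<and>
        b(e := 0) \<in> {a. wdeg (*s) (verts Q - {e}) (proj_weights form e \<sigma>) a = \<alpha>}}
      = {b. height (verts Q) \<sigma> b = 0 \<and> wdeg (*s) (verts Q) \<sigma> b = \<alpha>}"
    using wdeg_proj_weights[where \<sigma> = \<sigma>, OF fin e \<sigma>] by auto
  then show ?thesis
    using lspan_proj[where \<sigma> = \<sigma> and A = "{a. wdeg (*s) (verts Q - {e}) (proj_weights form e \<sigma>) a = \<alpha>}", OF cluster_vars_seed[OF s] e \<sigma>]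
    by (simp add: proj_seed_eq graded_part_eq delete_vertex_simps)
qed

end

section \<open>Comparison of the two algebras\<close>

lemma (in cluster_vars) span_shift:
  assumes e: "e \<in> V" and z: "z \<in> sp A" and AB: "\<And>a. a \<in> A \<Longrightarrow> a(e := a e + c) \<in> B"
  shows "x e powi c * z \<in> sp B"
proof -
  let ?s = "\<lambda>v. if v = e then c else 0"
  have "mon ?s \<in> sp {?s}" using e by (intro span_mono_mem) (auto simp: exps_on_def)
  then have "mon ?s * z \<in> sp B"
  proof (rule span_mult[OF _ z])
    fix s a assume "s \<in> {?s}" "a \<in> A"
    then have "(\<lambda>v. s v + a v) = a(e := a e + c)" by auto
    then show "(\<lambda>v. s v + a v) \<in> B" using AB[OF \<open>a \<in> A\<close>] by simp
  qed
  then show ?thesis by (simp add: laurent_monom_single[OF finite_V e])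
qed

lemma (in cluster_vars) span_clear_denominator:
  assumes e: "e \<in> V" and z: "z \<in> sp A" and A: "\<And>a c. a \<in> A \<Longrightarrow> a(e := c) \<in> A"
  shows "\<exists>n. x e ^ n * z \<in> sp (A \<inter> {a. a e \<ge> 0})"
proof -
  have "\<exists>n. \<forall>m\<ge>n. x e ^ m * z \<in> sp (A \<inter> {a. a e \<ge> 0})"
    using z
  proof (induction rule: span_induct)
    case zero
    then show ?case by simp
  next
    case (step z c a)
    then obtain n where n: "\<And>m. m \<ge> n \<Longrightarrow> x e ^ m * z \<in> sp (A \<inter> {a. a e \<ge> 0})" by blast
    have "x e ^ m * (c * mon a + z) \<in> sp (A \<inter> {a. a e \<ge> 0})" if m: "m \<ge> max n (nat (- a e))" for m
    proof -
      have "mon a \<in> sp {a}" using step by (intro span_mono_mem) auto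
      then have "x e powi int m * mon a \<in> sp (A \<inter> {a. a e \<ge> 0})"
        by (rule span_shift[OF e]) (use A[OF step(3)] m in auto)
      then have "c * (x e ^ m * mon a) \<in> sp (A \<inter> {a. a e \<ge> 0})"
        using step(2) span_scale by simp
      then have "c * (x e ^ m * mon a) + x e ^ m * z \<in> sp (A \<inter> {a. a e \<ge> 0})"
        using n[of m] m span_add by simp
      then show ?thesis by (simp add: algebra_simps)
    qed
    then show ?case by blast
  qed
  then show ?thesis by blast
qed

lemma upper_cluster_algebra_iff:
  "z \<in> upper_cluster_algebra k s \<longleftrightarrow> (\<forall>t. mutation_equivalent k s t \<longrightarrow> z \<in> laurent_ring k t)"
  unfolding upper_cluster_algebra_def by blast


lemma (in subfield) laurent_ring_sum:
  "(\<And>i. i \<in> I \<Longrightarrow> g i \<in> laurent_ring k t) \<Longrightarrow> sum g I \<in> laurent_ring k t"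
  by (cases t) (auto simp: laurent_ring_eq lspan_def intro: k_span_sum)

section \<open>The fixed graded seed and the seeds reachable from it\<close>

locale real_vertex_seed = real_vertex k form e \<epsilon> for k :: "'a::field set"
    and form :: "int^'n \<Rightarrow> int^'n \<Rightarrow> int" and e :: 'v and \<epsilon> +
  fixes Q :: "'v ice_quiver" and x :: "'v \<Rightarrow> 'a" and \<sigma> :: "'v \<Rightarrow> int^'n"
  assumes seed: "is_seed k (Q, x)" and weights: "weight_config Q \<sigma>"
    and e_in: "e \<in> verts Q" and \<sigma>_e: "\<sigma> e = \<epsilon>"
begin

sublocale cluster_vars k "verts Q" x
  using seed by (rule cluster_vars_seed)

abbreviation "V \<equiv> verts Q"
abbreviation "upper \<equiv> upper_cluster_algebra k (Q, x)"
abbreviation "upper_proj \<equiv> upper_cluster_algebra k (proj_seed form e \<sigma> (Q, x))"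
abbreviation "upper_perp \<equiv> perp_part form (\<sigma> e) (graded_part k (Q, x) \<sigma> (localization_at upper (x e)))"

lemma reachable:
  assumes "(graded_step k W)\<^sup>*\<^sup>* ((Q, x), \<sigma>) (t, \<tau>)"
  shows "is_seed k t" "weight_config (fst t) \<tau>" "cluster_vars k V (snd t)"
    "laurent_ring k t = lspan k V (snd t) {a. \<forall>v\<in>frozen Q. a v \<ge> 0}"
    "mutation_equivalent k (Q, x) t"
proof -
  note inv = graded_steps_invariant[OF assms, unfolded fst_conv, OF seed weights]
  show "is_seed k t" "weight_config (fst t) \<tau>" "mutation_equivalent k (Q, x) t" using inv by auto
  obtain R y where t: "t = (R, y)" by (cases t)
  show "cluster_vars k V (snd t)" using cluster_vars_seed[of R y] inv t by simp
  show "laurent_ring k t = lspan k V (snd t) {a. \<forall>v\<in>frozen Q. a v \<ge> 0}"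
    using inv(3,5) by (simp add: t laurent_ring_eq)
qed

lemma reachable_fixed:
  assumes "(graded_step k (- {e}))\<^sup>*\<^sup>* ((Q, x), \<sigma>) (t, \<tau>)"
  shows "snd t e = x e" "\<tau> e = \<epsilon>"
    "mutation_equivalent k (proj_seed form e \<sigma> (Q, x)) (proj_seed form e \<tau> t)"
    "laurent_ring k (proj_seed form e \<tau> t)
      = lspan k V (snd t) {b. height V \<tau> b = 0 \<and> (\<forall>v\<in>frozen Q - {e}. b v \<ge> 0)}"
proof -
  note inv = graded_steps_invariant[OF assms, unfolded fst_conv, OF seed weights]
  show "snd t e = x e" "\<tau> e = \<epsilon>" using inv(7,8)[of e] \<sigma>_e by auto
  show "mutation_equivalent k (proj_seed form e \<sigma> (Q, x)) (proj_seed form e \<tau> t)"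
    using graded_steps_proj[OF assms] seed weights e_in \<sigma>_e by simp
  obtain R y where t: "t = (R, y)" by (cases t)
  show "laurent_ring k (proj_seed form e \<tau> t)
      = lspan k V (snd t) {b. height V \<tau> b = 0 \<and> (\<forall>v\<in>frozen Q - {e}. b v \<ge> 0)}"
    using laurent_ring_proj[of R y \<tau>] inv \<open>\<tau> e = \<epsilon>\<close> e_in by (simp add: t)
qed

lemma mutation_equivalent_reachable:
  assumes "mutation_equivalent k (Q, x) t" "mut Q \<subseteq> W"
  obtains \<tau> where "(graded_step k W)\<^sup>*\<^sup>* ((Q, x), \<sigma>) (t, \<tau>)"
  using graded_steps_exist[of k "(Q, x)" t W \<sigma>] assms by auto

lemma upper_span:
  assumes z: "z \<in> upper" and eq: "mutation_equivalent k (Q, x) t"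
  shows "z \<in> lspan k V (snd t) UNIV"
proof -
  obtain \<tau> where \<tau>: "(graded_step k UNIV)\<^sup>*\<^sup>* ((Q, x), \<sigma>) (t, \<tau>)"
    by (rule mutation_equivalent_reachable[OF eq subset_UNIV])
  have "z \<in> laurent_ring k t" using z eq unfolding upper_cluster_algebra_iff by blast
  then show ?thesis unfolding reachable(4)[OF \<tau>] by (rule lspan_subset) auto
qed

lemma upper_homogeneous:
  assumes w: "z1 + z2 \<in> upper"
    and z1: "z1 \<in> sp {a. wdeg (*s) V \<sigma> a \<in> D}" and z2: "z2 \<in> sp {a. wdeg (*s) V \<sigma> a \<notin> D}"
  shows "z1 \<in> upper"
  unfolding upper_cluster_algebra_def
proof safe
  fix t assume t: "mutation_equivalent k (Q, x) t"
  obtain \<tau> where \<tau>: "(graded_step k UNIV)\<^sup>*\<^sup>* ((Q, x), \<sigma>) (t, \<tau>)"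
    by (rule mutation_equivalent_reachable[OF t subset_UNIV])
  interpret T: cluster_vars k V "snd t" by (rule reachable[OF \<tau>])
  have U: "z1 + z2 \<in> laurent_ring k t" using w t unfolding upper_cluster_algebra_iff by blast
  from graded_steps_split[OF \<tau> seed weights upper_span[OF w] z1 z2]
  have "z1 \<in> T.sp {a. wdeg (*s) V \<tau> a \<in> D}" "z2 \<in> T.sp (- {a. wdeg (*s) V \<tau> a \<in> D})"
    by (auto simp: Collect_neg_eq)
  then have "z1 \<in> T.sp ({a. \<forall>v\<in>frozen Q. a v \<ge> 0} \<inter> {a. wdeg (*s) V \<tau> a \<in> D})"
    using U unfolding reachable(4)[OF \<tau>] by (intro T.span_summand[of z1 z2])
  then show "z1 \<in> laurent_ring k t"
    unfolding reachable(4)[OF \<tau>] by (rule lspan_subset) auto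
qed

lemma wdeg_upd: "wdeg (*s) V \<tau> (a(e := c)) = wdeg (*s) V \<tau> a + (c - a e) *s \<tau> e"
proof -
  have "(\<Sum>v\<in>V - {e}. (a(e := c)) v *s \<tau> v) = (\<Sum>v\<in>V - {e}. a v *s \<tau> v)"
    by (intro sum.cong) auto
  moreover have "c *s \<tau> e = a e *s \<tau> e + (c - a e) *s \<tau> e"
    by (simp add: vec_eq_iff algebra_simps)
  ultimately show ?thesis
    unfolding wdeg_def using finite_V e_in by (simp add: sum.remove[of V e])
qed

text \<open>Homogeneous pieces suffice. Such a piece is \<open>b / x e ^ n\<close> with
  \<open>b\<close> homogeneous in every cluster. In clusters reached without mutating
  \<open>e\<close> the element \<open>x e\<close> is still a variable, so the division only lowers
  one exponent and yields height 0.\<close>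

lemma upper_perp_subset: "upper_perp \<subseteq> upper_proj"
proof
  fix z assume "z \<in> upper_perp"
  then obtain F g where F: "finite F" "\<And>\<alpha>. \<alpha> \<in> F \<Longrightarrow> form \<epsilon> \<alpha> = 0"
    and g: "\<And>\<alpha>. \<alpha> \<in> F \<Longrightarrow> g \<alpha> \<in> graded_part k (Q, x) \<sigma> (localization_at upper (x e)) \<alpha>"
    and z: "z = sum g F"
    unfolding perp_part_def \<sigma>_e by blast
  show "z \<in> upper_proj"
    unfolding upper_cluster_algebra_def z
  proof (safe, rule laurent_ring_sum)
    fix t' \<alpha> assume t': "mutation_equivalent k (proj_seed form e \<sigma> (Q, x)) t'" and \<alpha>: "\<alpha> \<in> F"
    obtain t \<tau> where t: "(graded_step k (- {e}))\<^sup>*\<^sup>* ((Q, x), \<sigma>) (t, \<tau>)" and t'_eq: "t' = proj_seed form e \<tau> t"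
      using mutation_proj_lift[OF t'] seed weights e_in \<sigma>_e by auto
    interpret T: cluster_vars k V "snd t" by (rule reachable[OF t])
    note fixed = reachable_fixed[OF t]
    have gs: "g \<alpha> \<in> sp {a. wdeg (*s) V \<sigma> a = \<alpha>}" and gl: "g \<alpha> \<in> localization_at upper (x e)"
      using g[OF \<alpha>] unfolding graded_part_eq by auto
    obtain b n where b: "b \<in> upper" and gb: "g \<alpha> = b / x e ^ n"
      using gl unfolding localization_at_def by blast
    let ?\<beta> = "\<alpha> + int n *s \<epsilon>"
    have b_eq: "b = x e powi int n * g \<alpha>" using gb var_nonzero[OF e_in] by simp
    have "b \<in> sp {a. wdeg (*s) V \<sigma> a \<in> {?\<beta>}}"
      unfolding b_eq by (rule span_shift[OF e_in gs]) (simp add: wdeg_upd \<sigma>_e)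
    moreover have "b + 0 \<in> lspan k V (snd t') UNIV" if "mutation_equivalent k (Q, x) t'" for t'
      using upper_span[OF b that] by simp
    ultimately have "b \<in> T.sp {a. wdeg (*s) V \<tau> a \<in> {?\<beta>}}"
      \<comment> \<open>A homogeneous element is treated as a sum with second summand 0.\<close>
      using graded_steps_split[OF t seed weights, of b 0 "{?\<beta>}"] by (simp del: split_paired_All)
    moreover have "b \<in> T.sp {a. \<forall>v\<in>frozen Q. a v \<ge> 0}"
      using b reachable(5)[OF t] unfolding upper_cluster_algebra_iff reachable(4)[OF t, symmetric] by blast
    ultimately have b_t: "b \<in> T.sp ({a. wdeg (*s) V \<tau> a \<in> {?\<beta>}} \<inter> {a. \<forall>v\<in>frozen Q. a v \<ge> 0})"
      by (rule T.span_Int)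
    have "snd t e powi (- int n) * b
        \<in> T.sp {b. height V \<tau> b = 0 \<and> (\<forall>v\<in>frozen Q - {e}. b v \<ge> 0)}"
    proof (rule T.span_shift[OF e_in b_t])
      fix a assume a: "a \<in> {a. wdeg (*s) V \<tau> a \<in> {?\<beta>}} \<inter> {a. \<forall>v\<in>frozen Q. a v \<ge> 0}"
      have "wdeg (*s) V \<tau> (a(e := a e + - int n)) = \<alpha>"
        using a by (simp add: wdeg_upd fixed(2) vec_eq_iff)
      then show "a(e := a e + - int n) \<in> {b. height V \<tau> b = 0 \<and> (\<forall>v\<in>frozen Q - {e}. b v \<ge> 0)}"
        using a F(2)[OF \<alpha>] by (simp add: height_def)
    qed
    moreover have "snd t e powi (- int n) * b = g \<alpha>"
      using gb fixed(1) by (simp add: power_int_minus field_simps)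
    ultimately show "g \<alpha> \<in> laurent_ring k t'"
      unfolding t'_eq fixed(4) by simp
  qed
qed

lemma upper_proj_reachable:
  assumes "z \<in> upper_proj" "(graded_step k (- {e}))\<^sup>*\<^sup>* ((Q, x), \<sigma>) (t, \<tau>)"
  shows "z \<in> lspan k V (snd t) {b. height V \<tau> b = 0 \<and> (\<forall>v\<in>frozen Q - {e}. b v \<ge> 0)}"
  using assms(1) reachable_fixed(3)[OF assms(2)]
  unfolding upper_cluster_algebra_iff reachable_fixed(4)[OF assms(2), symmetric] by blast

lemma upper_proj_span:
  "z \<in> upper_proj \<Longrightarrow> z \<in> sp {b. height V \<sigma> b = 0 \<and> (\<forall>v\<in>frozen Q - {e}. b v \<ge> 0)}"
  using upper_proj_reachable[of z "(Q, x)" \<sigma>] by simp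

lemma upper_proj_times_power:
  assumes z: "z \<in> upper_proj" and t: "(graded_step k (- {e}))\<^sup>*\<^sup>* ((Q, x), \<sigma>) (t, \<tau>)"
  shows "x e ^ n * z \<in> lspan k V (snd t) {b. \<forall>v\<in>frozen Q - {e}. b v \<ge> 0}"
proof -
  interpret T: cluster_vars k V "snd t" by (rule reachable[OF t])
  have "snd t e powi int n * z \<in> T.sp {b. \<forall>v\<in>frozen Q - {e}. b v \<ge> 0}"
    by (rule T.span_shift[OF e_in upper_proj_reachable[OF z t]]) auto
  then show ?thesis using reachable_fixed(1)[OF t] by simp
qed

lemma upper_proj_denominator:
  assumes z: "z \<in> upper_proj"
  obtains n where "x e ^ n * z \<in> sp {a. a e \<ge> 0 \<and> (\<forall>v\<in>frozen Q. a v \<ge> 0)}"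
proof -
  have "\<exists>n. x e ^ n * z \<in> sp ({b. \<forall>v\<in>frozen Q - {e}. b v \<ge> 0} \<inter> {a. a e \<ge> 0})"
    using upper_proj_times_power[OF z rtranclp.rtrancl_refl, of 0]
    by (intro span_clear_denominator[OF e_in]) auto
  then obtain n where "x e ^ n * z \<in> sp ({b. \<forall>v\<in>frozen Q - {e}. b v \<ge> 0} \<inter> {a. a e \<ge> 0})" by blast
  then have "x e ^ n * z \<in> sp {a. a e \<ge> 0 \<and> (\<forall>v\<in>frozen Q. a v \<ge> 0)}"
    by (rule lspan_subset) auto
  then show thesis by (rule that)
qed

text \<open>Every seed is reached without mutating \<open>e\<close>, so only the exponent of
  \<open>x e\<close> is in question, and the \<open>n\<close> that works in the initial cluster
  works in all.\<close>

lemma upper_proj_localization_frozen: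
  assumes z: "z \<in> upper_proj" and e: "e \<in> frozen Q"
  shows "\<exists>n. x e ^ n * z \<in> upper"
proof -
  obtain n where n: "x e ^ n * z \<in> sp {a. a e \<ge> 0 \<and> (\<forall>v\<in>frozen Q. a v \<ge> 0)}"
    by (rule upper_proj_denominator[OF z])
  have "x e ^ n * z \<in> laurent_ring k t" if eq: "mutation_equivalent k (Q, x) t" for t
  proof -
    have W: "mut Q \<subseteq> - {e}" using e by (auto simp: frozen_def)
    obtain \<tau> where t: "(graded_step k (- {e}))\<^sup>*\<^sup>* ((Q, x), \<sigma>) (t, \<tau>)"
      by (rule mutation_equivalent_reachable[OF eq W])
    interpret T: cluster_vars k V "snd t" by (rule reachable[OF t])
    have "x e ^ n * z \<in> T.sp {a. a e \<ge> 0}"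
    proof (rule graded_steps_nonneg[OF t seed weights])
      show "x e ^ n * z \<in> sp {a. a e \<ge> 0}" using n by (rule lspan_subset) auto
      show "x e ^ n * z \<in> lspan k V (snd t) UNIV"
        if "(graded_step k (- {e}))\<^sup>*\<^sup>* ((Q, x), \<sigma>) (t, \<tau>)" for t \<tau>
        using upper_proj_times_power[OF z that] by (rule lspan_subset) auto
    qed auto
    from T.span_Int[OF upper_proj_times_power[OF z t] this]
    show ?thesis unfolding reachable(4)[OF t] by (rule lspan_subset) auto
  qed
  then show ?thesis unfolding upper_cluster_algebra_iff by blast
qed

lemma upper_proj_localization_mutable:
  assumes z: "z \<in> upper_proj" and e: "e \<in> mut Q" and ind: "B_rows_independent Q"
  shows "\<exists>n. x e ^ n * z \<in> upper"
proof -
  obtain n where n: "x e ^ n * z \<in> sp {a. a e \<ge> 0 \<and> (\<forall>v\<in>frozen Q. a v \<ge> 0)}"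
    by (rule upper_proj_denominator[OF z])
  have w0: "x e ^ n * z \<in> sp UNIV" using n by (rule lspan_subset) auto
  have w1: "x e ^ n * z \<in> lspan k V (snd (mutate_seed u (Q, x))) UNIV" if u: "u \<in> mut Q" for u
  proof -
    interpret E: exchange k V x "snd (mutate_seed u (Q, x))" u "in_exp Q u" "out_exp Q u" "exch_poly Q x u"
      by (rule exchange_seed[OF seed u exch_poly_nonzero[OF seed ind u]])
    show ?thesis
    proof (cases "u = e")
      case True
      \<comment> \<open>The neighbour at \<open>e\<close> is invisible to the projected algebra;
        here it matters that \<open>n\<close> was chosen to make the exponents of \<open>x e\<close>
        nonnegative.\<close>
      show ?thesis using E.span_exchange_nonneg[OF n] True by (auto intro: lspan_subset)
    next
      case False
      have "is_seed k (mutate_seed u (Q, x))"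
        using is_seed_mutate_iff[OF seed u] exch_poly_nonzero[OF seed ind u] by simp
      then have "graded_step k (- {e}) ((Q, x), \<sigma>) (mutate_seed u (Q, x), mutate_weights u Q \<sigma>)"
        using seed u False by (auto simp: graded_step_def)
      then have "(graded_step k (- {e}))\<^sup>*\<^sup>* ((Q, x), \<sigma>) (mutate_seed u (Q, x), mutate_weights u Q \<sigma>)"
        by simp
      from upper_proj_times_power[OF z this] show ?thesis by (rule lspan_subset) auto
    qed
  qed
  have w: "x e ^ n * z \<in> lspan k V (snd t) UNIV" if "mutation_equivalent k (Q, x) t" for t
    by (rule upper_bound_mutation_invariant[OF seed ind w0 w1 that])
  have "x e ^ n * z \<in> laurent_ring k t" if eq: "mutation_equivalent k (Q, x) t" for t
  proof -
    obtain \<tau> where t: "(graded_step k UNIV)\<^sup>*\<^sup>* ((Q, x), \<sigma>) (t, \<tau>)"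
      by (rule mutation_equivalent_reachable[OF eq subset_UNIV])
    interpret T: cluster_vars k V "snd t" by (rule reachable[OF t])
    \<comment> \<open>Being Laurent with all variables inverted is now known for all seeds, so each
      frozen exponent can be followed along a path to \<open>t\<close> that never mutates
      \<open>f\<close>.\<close>
    have "x e ^ n * z \<in> T.sp {a. a f \<ge> 0}" if f: "f \<in> frozen Q" for f
    proof -
      have W: "mut Q \<subseteq> - {f}" using f by (auto simp: frozen_def)
      obtain \<tau> where t: "(graded_step k (- {f}))\<^sup>*\<^sup>* ((Q, x), \<sigma>) (t, \<tau>)"
        by (rule mutation_equivalent_reachable[OF eq W])
      show ?thesis
      proof (rule graded_steps_nonneg[OF t seed weights])
        show "x e ^ n * z \<in> sp {a. a f \<ge> 0}" using n by (rule lspan_subset) (use f in auto)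
      qed (use w reachable(5) in auto)
    qed
    moreover have "finite (frozen Q)" using finite_V by (simp add: frozen_def)
    ultimately have "x e ^ n * z \<in> T.sp (UNIV \<inter> {a. \<forall>f\<in>frozen Q. a f \<ge> 0})"
      using w[OF eq] by (intro T.span_nonneg)
    then show ?thesis unfolding reachable(4)[OF t] by simp
  qed
  then show ?thesis unfolding upper_cluster_algebra_iff by blast
qed

text \<open>One power of \<open>x e\<close> moves \<open>z\<close> into the upper cluster algebra,
  where it can be split into homogeneous elements; dividing each by that power gives the internal
  sum.\<close>

lemma upper_proj_subset:
  assumes e: "e \<in> frozen Q \<or> B_full_rank Q"
  shows "upper_proj \<subseteq> upper_perp"
proof
  fix z assume z: "z \<in> upper_proj"
  have "\<exists>n. x e ^ n * z \<in> upper"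
  proof (cases "e \<in> frozen Q")
    case True
    then show ?thesis using upper_proj_localization_frozen[OF z] by simp
  next
    case False
    then have "e \<in> mut Q" using e_in by (simp add: frozen_def)
    then show ?thesis
      using upper_proj_localization_mutable[OF z] False e
        B_full_rank_imp_independent[OF is_seedD(1)[OF seed]] by simp
  qed
  then obtain n where n: "x e ^ n * z \<in> upper" by blast
  have "x e powi int n * z \<in> sp {b. height V \<sigma> b = int n}"
    using upper_proj_span[OF z]
    by (rule span_shift[OF e_in]) (auto simp: height_upd[where \<sigma> = \<sigma>, OF finite_V e_in \<sigma>_e])
  then obtain D g where D: "finite D" "x e ^ n * z = sum g D"
    and g: "\<And>\<alpha>. g \<alpha> \<in> sp ({b. height V \<sigma> b = int n} \<inter> {a. wdeg (*s) V \<sigma> a = \<alpha>})"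
    by (auto elim: span_grading[where deg = "wdeg (*s) V \<sigma>"])
  have g0: "g \<alpha> = 0" if "form \<epsilon> \<alpha> \<noteq> int n" for \<alpha>
    using lspan_subset[OF g[of \<alpha>], of "{}"] that span_empty by (auto simp: height_def)
  have gs: "g \<alpha> \<in> sp {a. wdeg (*s) V \<sigma> a = \<alpha>}" for \<alpha>
    using g[of \<alpha>] by (rule lspan_subset) auto
  have g_upper: "g \<alpha> \<in> upper" if "\<alpha> \<in> D" for \<alpha>
  proof (rule upper_homogeneous[where D = "{\<alpha>}"])
    show "g \<alpha> + sum g (D - {\<alpha>}) \<in> upper"
      using n D that by (simp add: sum.remove)
    show "sum g (D - {\<alpha>}) \<in> sp {a. wdeg (*s) V \<sigma> a \<notin> {\<alpha>}}"
    proof (intro span_sum)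
      fix \<beta> assume "\<beta> \<in> D - {\<alpha>}"
      then show "g \<beta> \<in> sp {a. wdeg (*s) V \<sigma> a \<notin> {\<alpha>}}"
        using lspan_subset[OF gs[of \<beta>], of "{a. wdeg (*s) V \<sigma> a \<notin> {\<alpha>}}"] by auto
    qed
  qed (use gs in simp)
  \<comment> \<open>\<open>D\<close> may contain degrees of the wrong height, whose components are
    0. They are discarded because the shifted degrees must be orthogonal to \<epsilon>.\<close>
  define D' where "D' = {\<alpha>\<in>D. form \<epsilon> \<alpha> = int n}"
  define sh where "sh \<alpha> = \<alpha> - int n *s \<epsilon>" for \<alpha>
  define g' where "g' \<beta> = g (\<beta> + int n *s \<epsilon>) / x e ^ n" for \<beta>
  have "z = sum g D / x e ^ n" using D(2) var_nonzero[OF e_in] by (simp add: field_simps)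
  also have "sum g D = sum g D'"
    unfolding D'_def using D(1) g0 by (intro sum.mono_neutral_right) auto
  also have "sum g D' / x e ^ n = sum g' (sh ` D')"
    by (subst sum.reindex) (auto simp: sh_def g'_def inj_on_def sum_divide_distrib)
  finally have z_eq: "z = sum g' (sh ` D')" .
  have "form \<epsilon> \<beta> = 0 \<and> g' \<beta> \<in> graded_part k (Q, x) \<sigma> (localization_at upper (x e)) \<beta>"
    if \<beta>_in: "\<beta> \<in> sh ` D'" for \<beta>
  proof -
    obtain \<alpha> where \<alpha>: "\<alpha> \<in> D" "form \<epsilon> \<alpha> = int n" and \<beta>: "\<beta> = sh \<alpha>"
      using \<beta>_in by (auto simp: D'_def)
    have g'\<beta>: "g' \<beta> = g \<alpha> / x e ^ n" by (simp add: g'_def \<beta> sh_def)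
    have "g' \<beta> \<in> localization_at upper (x e)"
      using g_upper[OF \<alpha>(1)] unfolding g'\<beta> localization_at_def by blast
    moreover have "x e powi (- int n) * g \<alpha> \<in> sp {a. wdeg (*s) V \<sigma> a = \<beta>}"
      by (rule span_shift[OF e_in gs]) (auto simp: wdeg_upd \<sigma>_e \<beta> sh_def vec_eq_iff)
    moreover have "x e powi (- int n) * g \<alpha> = g' \<beta>"
      by (simp add: g'\<beta> power_int_minus field_simps)
    moreover have "form \<epsilon> \<beta> = 0"
      using \<alpha>(2) by (simp add: \<beta> sh_def form_diff form_scale real)
    ultimately show ?thesis by (simp add: graded_part_eq)
  qed
  then have "\<forall>\<beta>\<in>sh ` D'. form \<epsilon> \<beta> = 0 \<and> g' \<beta> \<in> graded_part k (Q, x) \<sigma> (localization_at upper (x e)) \<beta>"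
    by blast
  moreover have "finite (sh ` D')" using D(1) by (simp add: D'_def)
  ultimately show "z \<in> upper_perp"
    unfolding perp_part_def \<sigma>_e using z_eq
    by (intro CollectI exI[of _ "sh ` D'"] exI[of _ g'] conjI)
qed

text \<open>Elements of the projected algebra have height 0 automatically, so the extra height
  condition coming from projection changes nothing and the gradings agree.\<close>

lemma graded_part_upper_proj:
  "graded_part k (proj_seed form e \<sigma> (Q, x)) (proj_weights form e \<sigma>) upper_proj \<alpha>
    = graded_part k (Q, x) \<sigma> upper_proj \<alpha>"
proof -
  have "z \<in> sp {b. height V \<sigma> b = 0 \<and> wdeg (*s) V \<sigma> b = \<alpha>}"
    if "z \<in> upper_proj" "z \<in> sp {b. wdeg (*s) V \<sigma> b = \<alpha>}" for z
    using span_Int[OF upper_proj_span[OF that(1)] that(2)] by (rule lspan_subset) auto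
  moreover have "z \<in> sp {b. wdeg (*s) V \<sigma> b = \<alpha>}"
    if "z \<in> sp {b. height V \<sigma> b = 0 \<and> wdeg (*s) V \<sigma> b = \<alpha>}" for z
    using that by (rule lspan_subset) auto
  ultimately show ?thesis
    unfolding graded_part_proj[where \<sigma> = \<sigma>, OF seed e_in \<sigma>_e] graded_part_eq by blast
qed

end

theorem proposition2p8:
  fixes k :: "'a::field set"
    and \<Delta> :: "'v ice_quiver"
    and x :: "'v \<Rightarrow> 'a"
    and form :: "int^'n \<Rightarrow> int^'n \<Rightarrow> int"
    and \<sigma> :: "'v \<Rightarrow> int^'n"
    and e :: 'v
  defines "\<A> \<equiv> upper_cluster_algebra k (\<Delta>, x)"
    and "\<S> \<equiv> upper_cluster_algebra k (proj_seed form e \<sigma> (\<Delta>, x))"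
  defines "\<A>\<^sub>e_perp \<equiv> perp_part form (\<sigma> e) (graded_part k (\<Delta>, x) \<sigma> (localization_at \<A> (x e)))"
  assumes "is_subfield k"
    and "bilinear_form form" and "unimodular form"
    and "graded_seed k (\<Delta>, x) \<sigma>"
    and "e \<in> verts \<Delta>" and "real_vec form (\<sigma> e)"
    and "e \<in> frozen \<Delta> \<or> B_full_rank \<Delta>"
  shows "graded_algebra_iso k
           \<A>\<^sub>e_perp (graded_part k (\<Delta>, x) \<sigma> \<A>\<^sub>e_perp)
           \<S> (graded_part k (proj_seed form e \<sigma> (\<Delta>, x)) (proj_weights form e \<sigma>) \<S>)"
proof -
  interpret real_vertex_seed k form e "\<sigma> e" \<Delta> x \<sigma>
    using assms by unfold_locales (auto simp: graded_seed_def real_vec_def)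
  have "\<A>\<^sub>e_perp = \<S>"
    unfolding \<A>\<^sub>e_perp_def \<A>_def \<S>_def
    using upper_perp_subset upper_proj_subset[OF assms(10)] by (rule subset_antisym)
  then show ?thesis
    unfolding graded_algebra_iso_def \<S>_def
    by (intro exI[of _ "\<lambda>z. z"]) (simp add: graded_part_upper_proj bij_betw_def)
qed

end
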